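(* Let $T_n$ be a $2$-dimensional determinantal hypertree on $[n]$. Then \[\liminf_{n\to\infty} \mathbb{P}\left(\mathrm{syst}^1(T_n)\le \frac{7}{n^2}\right)>0.\]
   Context: A $2$-dimensional simplicial complex $S$ on the vertex set $[n]=\{1,\dots,n\}$ is called a ($2$-dimensional) hypertree if (a) $S$ has complete $1$-skeleton (all vertices and all pairs from $[n]$ are faces); (b) the number of triangular faces of $S$ is $\binom{n-1}{2}$; (c) the homology group $H_1(S,\mathbb{Z})$ is finite. Let $\mathcal{C}(n,2)$ be the set of hypertrees on $[n]$. Kalai's formula states $\sum_{S\in\mathcal{C}(n,2)}|H_1(S,\mathbb{Z})|^2=n^{\binom{n-2}{2}}$. A determinantal hypertree $T_n$ is a random element of $\mathcal{C}(n,2)$ with distribution $\mathbb{P}(T_n=S)=|H_1(S,\mathbb{Z})|^2/n^{\binom{n-2}{2}}$ for $S\in\mathcal{C}(n,2)$. Let $K$ be a $d$-dimensional simplicial complex and let $K(d)$ be its set of $d$-dimensional faces. The weight of an $i$-dimensional face $\sigma$ of $K$ is \[w(\sigma)=\frac{1}{\binom{d+1}{i+1}|K(d)|}\,|\{\tau\in K(d)\,:\,\sigma\subset \tau\}|.\] For a cochain $f\in C^i(K,\mathbb{F}_2)$, let $\|f\|=\sum_{\sigma\in\mathrm{supp} f} w(\sigma)$. With $Z^i$ and $B^i$ denoting cocycles and coboundaries, for $0\le i\le d-1$ define \[\mathrm{syst}^i(K)=\min_{f\in Z^i(K,\mathbb{F}_2)\setminus B^i(K,\mathbb{F}_2)}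 \|f\|,\] where the minimum over the empty set is $+\infty$. *)

theory Defs
  imports
    "HOL-Probability.Probability"
    "HOL-Algebra.Free_Abelian_Groups"
    "HOL-Library.Z2"
begin

(* The empty face is excluded, so (co)homology below is unreduced. *)
definition abstract_complex :: "'a set \<Rightarrow> 'a set set \<Rightarrow> bool" where
  "abstract_complex V K \<longleftrightarrow>
     (\<forall>\<sigma>\<in>K. finite \<sigma> \<and> \<sigma> \<noteq> {} \<and> \<sigma> \<subseteq> V) \<and>
     (\<forall>\<sigma>\<in>K. \<forall>\<tau>. \<tau> \<subseteq> \<sigma> \<and> \<tau> \<noteq> {} \<longrightarrow> \<tau> \<in> K)"

definition faces :: "nat \<Rightarrow> 'a set set \<Rightarrow> 'a set set" where
  "faces i K = {\<sigma>\<in>K. card \<sigma> = i + 1}"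

(* Meaningful for finite nonempty complexes. *)
definition complex_dim :: "'a set set \<Rightarrow> nat" where
  "complex_dim K = Max ((\<lambda>\<sigma>. card \<sigma> - 1) ` K)"

subsection \<open>Simplicial homology with integer coefficients\<close>

(* Every simplex is oriented by the increasing order of its vertices, so the
   sign of the facet omitting v is (-1)^k, where k is the position of v. *)
definition simplex_boundary :: "'a::linorder set \<Rightarrow> 'a set \<Rightarrow>\<^sub>0 int" where
  "simplex_boundary \<sigma> =
     (if card \<sigma> \<le> 1 then 0
      else \<Sum>v\<in>\<sigma>. frag_cmul ((-1) ^ card {u\<in>\<sigma>. u < v}) (frag_of (\<sigma> - {v})))"

definition simplicial_cycles :: "nat \<Rightarrow> 'a::linorder set set \<Rightarrow> ('a set \<Rightarrow>\<^sub>0 int) set" where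
  "simplicial_cycles i K =
     {c \<in> carrier (free_Abelian_group (faces i K)). frag_extend simplex_boundary c = 0}"

definition simplicial_boundaries :: "nat \<Rightarrow> 'a::linorder set set \<Rightarrow> ('a set \<Rightarrow>\<^sub>0 int) set" where
  "simplicial_boundaries i K =
     frag_extend simplex_boundary ` carrier (free_Abelian_group (faces (i + 1) K))"

definition simplicial_homology ::
    "nat \<Rightarrow> 'a::linorder set set \<Rightarrow> ('a set \<Rightarrow>\<^sub>0 int) set monoid" where
  "simplicial_homology i K =
     subgroup_generated (free_Abelian_group (faces i K)) (simplicial_cycles i K)
       Mod simplicial_boundaries i K"

subsection \<open>Cohomology over the two-element field and systoles\<close>

(* Cochains are extended by zero outside the i-dimensional faces, so that the
   support of a cochain is where it is nonzero. *)
definition cochains :: "nat \<Rightarrow> 'a set set \<Rightarrow> ('a set \<Rightarrow> bit) set" where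
  "cochains i K = {f. \<forall>\<sigma>. \<sigma> \<notin> faces i K \<longrightarrow> f \<sigma> = 0}"

definition coboundary :: "nat \<Rightarrow> 'a set set \<Rightarrow> ('a set \<Rightarrow> bit) \<Rightarrow> 'a set \<Rightarrow> bit" where
  "coboundary i K f =
     (\<lambda>\<tau>. if \<tau> \<in> faces (i + 1) K then \<Sum>\<sigma> | \<sigma> \<in> faces i K \<and> \<sigma> \<subseteq> \<tau>. f \<sigma> else 0)"

definition cocycles :: "nat \<Rightarrow> 'a set set \<Rightarrow> ('a set \<Rightarrow> bit) set" where
  "cocycles i K = {f \<in> cochains i K. coboundary i K f = (\<lambda>_. 0)}"

definition coboundaries :: "nat \<Rightarrow> 'a set set \<Rightarrow> ('a set \<Rightarrow> bit) set" where
  "coboundaries i K =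
     (if i = 0 then {\<lambda>_. 0} else coboundary (i - 1) K ` cochains (i - 1) K)"

(* An i-dimensional face has i + 1 = card \<sigma> vertices. *)
definition weight :: "'a set set \<Rightarrow> 'a set \<Rightarrow> real" where
  "weight K \<sigma> =
     (let d = complex_dim K in
      1 / (real ((d + 1) choose card \<sigma>) * real (card (faces d K)))
        * real (card {\<tau> \<in> faces d K. \<sigma> \<subseteq> \<tau>}))"

definition cochain_norm :: "'a set set \<Rightarrow> ('a set \<Rightarrow> bit) \<Rightarrow> real" where
  "cochain_norm K f = (\<Sum>\<sigma> | f \<sigma> \<noteq> 0. weight K \<sigma>)"

(* For finite K the infimum ranges over finitely many values, hence it is a
   minimum, and it is \<infinity> if there are none. *)
definition syst :: "nat \<Rightarrow> 'a set set \<Rightarrow> ereal" where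
  "syst i K = (INF f \<in> cocycles i K - coboundaries i K. ereal (cochain_norm K f))"

subsection \<open>Determinantal hypertrees\<close>

definition hypertrees :: "nat \<Rightarrow> nat set set set" where
  "hypertrees n =
     {S. abstract_complex {1..n} S \<and> complex_dim S = 2 \<and>
         (\<forall>\<sigma>. \<sigma> \<subseteq> {1..n} \<and> card \<sigma> \<in> {1, 2} \<longrightarrow> \<sigma> \<in> S) \<and>
         card (faces 2 S) = (n - 1) choose 2 \<and>
         finite (carrier (simplicial_homology 1 S))}"

(* The normalising constant is the sum of the squared homology orders over all
   hypertrees, by Kalai's formula. *)
definition determinantal_hypertree ::
    "nat \<Rightarrow> 'w measure \<Rightarrow> ('w \<Rightarrow> nat set set) \<Rightarrow> bool" where
  "determinantal_hypertree n M T \<longleftrightarrow>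
     prob_space M \<and>
     T \<in> measurable M (count_space (hypertrees n)) \<and>
     (\<forall>S \<in> hypertrees n.
        measure M {\<omega> \<in> space M. T \<omega> = S} =
          real (order (simplicial_homology 1 S)) ^ 2 / real n ^ ((n - 2) choose 2))"

end

theory Submission
  imports Defs "Jordan_Normal_Form.Determinant"
begin

text \<open>Take the vertex \<open>n\<close> as root and restrict the boundary matrix from triangles to edges to the rows of
  edges avoiding the root. For \<open>m = (n - 1) choose 2\<close> triangles, \<open>|H\<^sub>1|\<close> is the index of the
  lattice spanned by their columns, that is the absolute value of an \<open>m \<times> m\<close> minor. By Cauchy-Binet,
  sums of \<open>|H\<^sub>1|\<^sup>2\<close> with weights on the triangles are determinants of weighted Gram matrices, and
  by the matrix determinant lemma increasing the weight of one triangle changes the determinant by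
  a factor governed by an effective resistance, which is bounded by coning.

  The short cocycle comes from a pentagon whose five edges lie in no triangles of \<open>T\<^sub>n\<close> except the
  five triangles of the 5-vertex Moebius strip. The indicator of the pentagon is then a cocycle,
  it is not a coboundary since the pentagon is an odd cycle, and its norm is at most
  \<open>10 / (3 * m) < 7 / n\<^sup>2\<close>. Giving the strip triangles weight \<open>n\<close> shows that a given pentagon
  occurs with probability at least a constant times \<open>n\<^sup>-\<^sup>5\<close>; as \<open>P(A \<subseteq> T\<^sub>n) \<le> (19 / n) ^ |A|\<close>, the
  number of pentagons has bounded second moment, and the second moment method applies.\<close>

section \<open>Determinants of weighted Gram matrices\<close>

no_notation vec_nth (infixl \<open>$\<close> 90)
no_notation inner (infix \<open>\<bullet>\<close> 70)

text \<open>About 5n triangles must be avoided, yet the probability may drop only by a factor of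
  order n^5. Removing one triangle costs a factor of at most 1 + C, where C bounds its resistance in
  the weighted complex without all of them, so C = O(1/n) is required. Once these triangles are
  gone, a core edge lies only in strip triangles; with unit weights on the strip the resistances
  would be of constant order and the total cost exponential in n. Weight n on the strip repairs this
  at a cost of at most n^5, which matches the order n^5 of the number of pentagons.

  Oddness of the cycle is used twice. Over the reals it lets the strip control every single core
  edge: on an even cycle an alternating cochain would have zero coboundary. Over F_2 it keeps the
  core indicator from being a coboundary. Five is the shortest possible odd length, since a 3-cycle
  would be one triangle containing three core edges.

  The alternating real cochain also shows that a hypertree in which the core edges lie in no
  triangles outside the strip contains the whole strip. Avoidance thus turns into containment of few
  triangles, which can be bounded from above in the second moment.\<close>

definition gram :: "nat \<Rightarrow> ('t \<Rightarrow> nat \<Rightarrow> real) \<Rightarrow> 't set \<Rightarrow> ('t \<Rightarrow> real) \<Rightarrow> real mat" where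
  "gram m u K w = mat m m (\<lambda>(i, j). \<Sum>\<tau>\<in>K. w \<tau> * u \<tau> i * u \<tau> j)"

lemma gram_carrier [simp]: "gram m u K w \<in> carrier_mat m m"
  by (simp add: gram_def)

text \<open>Multilinearity in the rows: row i is a sum over \<tau> of multiples of the vector
  \<open>u \<tau>\<close>, so the determinant expands over maps f from rows to K, and a map that
  repeats a value produces two equal rows.\<close>

lemma det_gram_expand:
  assumes "finite K"
  shows "det (gram m u K w) =
    (\<Sum>f\<in>{f \<in> PiE {0..<m} (\<lambda>_. K). inj_on f {0..<m}}.
      (\<Prod>\<tau>\<in>f ` {0..<m}. w \<tau>) *
      ((\<Prod>i\<in>{0..<m}. u (f i) i) * det (mat m m (\<lambda>(i, j). u (f i) j))))"
proof -
  let ?I = "{0..<m}" and ?P = "{p. p permutes {0..<m}}" and ?F = "PiE {0..<m} (\<lambda>_. K)"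
  have fF: "finite ?F" using assms by (intro finite_PiE) auto
  have d: "det (mat m m (\<lambda>(i, j). u (f i) j)) =
      (\<Sum>p\<in>?P. signof p * (\<Prod>i\<in>?I. u (f i) (p i)))" for f
    by (subst det_def'[of _ m]) (auto intro!: sum.cong prod.cong simp: permutes_in_image[THEN iffD2])
  have "det (gram m u K w) = (\<Sum>p\<in>?P. signof p * (\<Prod>i\<in>?I. \<Sum>\<tau>\<in>K. w \<tau> * u \<tau> i * u \<tau> (p i)))"
    by (subst det_def'[of _ m])
      (auto intro!: sum.cong prod.cong simp: gram_def permutes_in_image[THEN iffD2])
  also have "\<dots> = (\<Sum>p\<in>?P. signof p * (\<Sum>f\<in>?F. \<Prod>i\<in>?I. w (f i) * u (f i) i * u (f i) (p i)))"
    using assms by (subst prod_sum_PiE) auto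
  also have "\<dots> = (\<Sum>p\<in>?P. \<Sum>f\<in>?F. (\<Prod>i\<in>?I. w (f i)) * ((\<Prod>i\<in>?I. u (f i) i) *
      (signof p * (\<Prod>i\<in>?I. u (f i) (p i)))))"
    by (simp add: sum_distrib_left prod.distrib mult_ac)
  also have "\<dots> = (\<Sum>f\<in>?F. (\<Prod>i\<in>?I. w (f i)) * ((\<Prod>i\<in>?I. u (f i) i) * det (mat m m (\<lambda>(i, j). u (f i) j))))"
    by (subst sum.swap) (simp add: d sum_distrib_left)
  also have "\<dots> = (\<Sum>f\<in>{f \<in> ?F. inj_on f ?I}. (\<Prod>i\<in>?I. w (f i)) * ((\<Prod>i\<in>?I. u (f i) i) * det (mat m m (\<lambda>(i, j). u (f i) j))))"
  proof (rule sum.mono_neutral_right[OF fF])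
    show "\<forall>f\<in>?F - {f \<in> ?F. inj_on f ?I}.
      (\<Prod>i\<in>?I. w (f i)) * ((\<Prod>i\<in>?I. u (f i) i) * det (mat m m (\<lambda>(i, j). u (f i) j))) = 0"
    proof
      fix f assume "f \<in> ?F - {f \<in> ?F. inj_on f ?I}"
      then obtain i j where ij: "i < m" "j < m" "i \<noteq> j" "f i = f j" by (auto simp: inj_on_def)
      have "det (mat m m (\<lambda>(i, j). u (f i) j)) = 0"
        by (rule det_identical_rows[of _ m i j]) (use ij in \<open>auto intro!: eq_vecI\<close>)
      then show "(\<Prod>i\<in>?I. w (f i)) * ((\<Prod>i\<in>?I. u (f i) i) * det (mat m m (\<lambda>(i, j). u (f i) j))) = 0"
        by simp
    qed
  qed auto
  also have "\<dots> = (\<Sum>f\<in>{f \<in> ?F. inj_on f ?I}. (\<Prod>\<tau>\<in>f ` ?I. w \<tau>) *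
      ((\<Prod>i\<in>?I. u (f i) i) * det (mat m m (\<lambda>(i, j). u (f i) j))))"
    by (intro sum.cong) (auto simp: prod.reindex)
  finally show ?thesis .
qed

text \<open>The injective maps are grouped by their image S. The squared minor of S is written as
  its own unit-weight Gram determinant, which spares an enumeration of S.\<close>

lemma det_gram_Cauchy_Binet:
  assumes K: "finite K"
  shows "det (gram m u K w) =
    (\<Sum>S | S \<subseteq> K \<and> card S = m. (\<Prod>\<tau>\<in>S. w \<tau>) * det (gram m u S (\<lambda>_. 1)))"
proof -
  let ?I = "{0..<m}"
  let ?inj = "\<lambda>X. {f \<in> PiE {0..<m} (\<lambda>_. X). inj_on f {0..<m}}"
  let ?\<phi> = "\<lambda>f. (\<Prod>i\<in>?I. u (f i) i) * det (mat m m (\<lambda>(i, j). u (f i) j))"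
  let ?SS = "{S. S \<subseteq> K \<and> card S = m}"
  have fin: "finite (?inj X)" if "finite X" for X
    using that by (auto intro!: finite_subset[OF _ finite_PiE[of ?I "\<lambda>_. X"]])
  have fS: "finite ?SS" using K by (auto intro!: finite_subset[of _ "Pow K"])
  have im: "f ` ?I = S" if "f \<in> ?inj S" "S \<in> ?SS" for f S
    using that K by (intro card_subset_eq) (auto simp: card_image dest: finite_subset)
  have "det (gram m u K w) = (\<Sum>f\<in>?inj K. (\<Prod>\<tau>\<in>f ` ?I. w \<tau>) * ?\<phi> f)"
    by (rule det_gram_expand[OF K])
  also have "?inj K = (\<Union>S\<in>?SS. ?inj S)"
  proof (intro equalityI subsetI)
    fix f assume f: "f \<in> ?inj K"
    then have "f ` ?I \<in> ?SS" "f \<in> ?inj (f ` ?I)" by (auto simp: card_image PiE_iff)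
    then show "f \<in> (\<Union>S\<in>?SS. ?inj S)" by (rule UN_I)
  qed (auto simp: PiE_iff)
  also have "(\<Sum>f\<in>\<dots>. (\<Prod>\<tau>\<in>f ` ?I. w \<tau>) * ?\<phi> f) = (\<Sum>S\<in>?SS. \<Sum>f\<in>?inj S. (\<Prod>\<tau>\<in>f ` ?I. w \<tau>) * ?\<phi> f)"
  proof (rule sum.UNION_disjoint[OF fS])
    show "\<forall>S\<in>?SS. finite (?inj S)" using K by (auto intro!: fin dest: finite_subset)
    show "\<forall>S\<in>?SS. \<forall>S'\<in>?SS. S \<noteq> S' \<longrightarrow> ?inj S \<inter> ?inj S' = {}"
    proof (intro ballI impI equals0I)
      fix S S' f assume S: "S \<in> ?SS" "S' \<in> ?SS" "S \<noteq> S'" and f: "f \<in> ?inj S \<inter> ?inj S'"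
      show False using im[OF IntD1[OF f] S(1)] im[OF IntD2[OF f] S(2)] S(3) by simp
    qed
  qed
  also have "\<dots> = (\<Sum>S\<in>?SS. (\<Prod>\<tau>\<in>S. w \<tau>) * det (gram m u S (\<lambda>_. 1)))"
  proof (rule sum.cong)
    fix S assume S: "S \<in> ?SS"
    then have "finite S" using K finite_subset by blast
    then have "det (gram m u S (\<lambda>_. 1)) = (\<Sum>f\<in>?inj S. ?\<phi> f)" by (subst det_gram_expand) auto
    moreover have "(\<Sum>f\<in>?inj S. (\<Prod>\<tau>\<in>f ` ?I. w \<tau>) * ?\<phi> f) = (\<Sum>f\<in>?inj S. (\<Prod>\<tau>\<in>S. w \<tau>) * ?\<phi> f)"
      by (intro sum.cong) (use im S in \<open>auto\<close>)
    ultimately show "(\<Sum>f\<in>?inj S. (\<Prod>\<tau>\<in>f ` ?I. w \<tau>) * ?\<phi> f) = (\<Prod>\<tau>\<in>S. w \<tau>) * det (gram m u S (\<lambda>_. 1))"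
      by (simp add: sum_distrib_left)
  qed simp
  finally show ?thesis .
qed

lemma det_gram_eq_square:
  assumes e: "bij_betw e {0..<m} S"
  shows "det (gram m u S (\<lambda>_. 1)) = (det (mat m m (\<lambda>(i, j). u (e j) i)))\<^sup>2"
proof -
  let ?B = "mat m m (\<lambda>(i, j). u (e j) i)"
  have "gram m u S (\<lambda>_. 1) = ?B * transpose_mat ?B"
  proof (rule eq_matI)
    fix i j assume "i < dim_row (?B * transpose_mat ?B)" "j < dim_col (?B * transpose_mat ?B)"
    then show "gram m u S (\<lambda>_. 1) $$ (i, j) = (?B * transpose_mat ?B) $$ (i, j)"
      using sum.reindex_bij_betw[OF e, of "\<lambda>\<tau>. u \<tau> i * u \<tau> j"]
      by (simp add: gram_def scalar_prod_def)
  qed (auto simp: gram_def)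
  then show ?thesis
    using det_mult[of ?B m "transpose_mat ?B"] det_transpose[of ?B m] by (simp add: power2_eq_square)
qed

lemma det_gram_unit_nonneg:
  assumes "finite S" "card S = m"
  shows "det (gram m u S (\<lambda>_. 1)) \<ge> 0"
proof -
  obtain e where "bij_betw e {0..<m} S" using assms ex_bij_betw_nat_finite by blast
  then show ?thesis by (simp add: det_gram_eq_square)
qed

lemma det_gram_nonneg:
  assumes "finite K" "\<And>\<tau>. \<tau> \<in> K \<Longrightarrow> w \<tau> \<ge> 0"
  shows "det (gram m u K w) \<ge> 0"
proof -
  have "0 \<le> (\<Prod>\<tau>\<in>S. w \<tau>) * det (gram m u S (\<lambda>_. 1))" if S: "S \<subseteq> K" "card S = m" for S
  proof (rule mult_nonneg_nonneg)
    show "0 \<le> (\<Prod>\<tau>\<in>S. w \<tau>)" using S(1) assms(2) by (meson prod_nonneg subsetD)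
    show "0 \<le> det (gram m u S (\<lambda>_. 1))"
      by (rule det_gram_unit_nonneg[OF finite_subset[OF S(1) assms(1)] S(2)])
  qed
  then show ?thesis by (subst det_gram_Cauchy_Binet[OF assms(1)]) (rule sum_nonneg, blast)
qed

section \<open>Rank-one updates of Gram determinants\<close>

text \<open>Sylvester's identity: the block matrix \<open>?P\<close> factors into block triangular
  matrices in two ways.\<close>

lemma det_one_add_mult_commute:
  fixes B C :: "'a::idom mat"
  assumes B: "B \<in> carrier_mat n k" and C: "C \<in> carrier_mat k n"
  shows "det (1\<^sub>m n + B * C) = det (1\<^sub>m k + C * B)"
proof -
  let ?P = "four_block_mat (1\<^sub>m n) (- B) C (1\<^sub>m k)"
  have CB: "1\<^sub>m k + C * B \<in> carrier_mat k k" "1\<^sub>m n + B * C \<in> carrier_mat n n" using B C by auto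
  have "?P = four_block_mat (1\<^sub>m n) (0\<^sub>m n k) C (1\<^sub>m k) *
        four_block_mat (1\<^sub>m n) (- B) (0\<^sub>m k n) (1\<^sub>m k + C * B)"
    using B C by (subst mult_four_block_mat) (auto intro!: eq_matI)
  then have "det ?P = det (1\<^sub>m k + C * B)"
    using B C CB
    by (simp add: det_mult[of _ "n + k"] det_four_block_mat_upper_right_zero[of _ n _ k]
        det_four_block_mat_lower_left_zero[of _ n _ k])
  moreover have "?P = four_block_mat (1\<^sub>m n + B * C) (- B) (0\<^sub>m k n) (1\<^sub>m k) *
        four_block_mat (1\<^sub>m n) (0\<^sub>m n k) C (1\<^sub>m k)"
    using B C by (subst mult_four_block_mat) (auto intro!: eq_matI)
  then have "det ?P = det (1\<^sub>m n + B * C)"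
    using B C CB
    by (simp add: det_mult[of _ "n + k"] det_four_block_mat_upper_right_zero[of _ n _ k]
        det_four_block_mat_lower_left_zero[of _ n _ k])
  ultimately show ?thesis by simp
qed

lemma gram_quadratic_form:
  "(\<Sum>i<m. g i * (\<Sum>j<m. gram m u K w $$ (i, j) * g j)) = (\<Sum>\<tau>\<in>K. w \<tau> * (\<Sum>i<m. g i * u \<tau> i)\<^sup>2)"
proof -
  have "(\<Sum>i<m. g i * (\<Sum>j<m. gram m u K w $$ (i, j) * g j)) =
     (\<Sum>i<m. \<Sum>j<m. \<Sum>\<tau>\<in>K. w \<tau> * (g i * u \<tau> i) * (g j * u \<tau> j))"
    by (simp add: gram_def sum_distrib_left sum_distrib_right mult_ac)
  also have "\<dots> = (\<Sum>i<m. \<Sum>\<tau>\<in>K. \<Sum>j<m. w \<tau> * (g i * u \<tau> i) * (g j * u \<tau> j))"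
    by (intro sum.cong refl sum.swap)
  also have "\<dots> = (\<Sum>\<tau>\<in>K. \<Sum>i<m. \<Sum>j<m. w \<tau> * (g i * u \<tau> i) * (g j * u \<tau> j))"
    by (rule sum.swap)
  also have "\<dots> = (\<Sum>\<tau>\<in>K. w \<tau> * (\<Sum>i<m. g i * u \<tau> i)\<^sup>2)"
  proof (intro sum.cong refl)
    fix \<tau>
    have "(\<Sum>i<m. g i * u \<tau> i)\<^sup>2 = (\<Sum>i<m. \<Sum>j<m. (g i * u \<tau> i) * (g j * u \<tau> j))"
      unfolding power2_eq_square sum_product ..
    then show "(\<Sum>i<m. \<Sum>j<m. w \<tau> * (g i * u \<tau> i) * (g j * u \<tau> j)) = w \<tau> * (\<Sum>i<m. g i * u \<tau> i)\<^sup>2"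
      by (simp add: sum_distrib_left mult.assoc)
  qed
  finally show ?thesis .
qed

text \<open>By the matrix determinant lemma, increasing the weight of \<open>\<sigma>\<close> by \<open>t\<close> multiplies the
  determinant by \<open>1 + t * R\<close>, where \<open>R\<close> is an effective resistance; the first assumption is
  the variational bound \<open>R \<le> C\<close>.\<close>

lemma det_gram_add_weight_le:
  assumes K: "finite K" and \<sigma>: "\<sigma> \<in> K" and w: "\<And>\<tau>. \<tau> \<in> K \<Longrightarrow> w \<tau> \<ge> 0" and t: "t \<ge> 0" and C0: "C \<ge> 0"
    and C: "\<And>g. (\<Sum>i<m. g i * u \<sigma> i)\<^sup>2 \<le> C * (\<Sum>\<tau>\<in>K. w \<tau> * (\<Sum>i<m. g i * u \<tau> i)\<^sup>2)"
  shows "det (gram m u K (w(\<sigma> := w \<sigma> + t))) \<le> (1 + t * C) * det (gram m u K w)"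
proof -
  define w' where "w' = w(\<sigma> := w \<sigma> + t)"
  let ?L = "gram m u K w" and ?L' = "gram m u K w'"
  let ?s = "u \<sigma>"
  have L': "?L' $$ (i, j) = ?L $$ (i, j) + t * ?s i * ?s j" if "i < m" "j < m" for i j
  proof -
    have "(\<Sum>\<tau>\<in>K. w' \<tau> * u \<tau> i * u \<tau> j) =
        (\<Sum>\<tau>\<in>K. w \<tau> * u \<tau> i * u \<tau> j + (if \<tau> = \<sigma> then t * ?s i * ?s j else 0))"
      by (intro sum.cong) (auto simp: w'_def algebra_simps)
    then show ?thesis using that K \<sigma> by (simp add: gram_def sum.distrib)
  qed
  have [simp]: "dim_row ?L = m" "dim_col ?L = m" "dim_row ?L' = m" "dim_col ?L' = m" by (simp_all add: gram_def)
  have "det ?L' \<le> (1 + t * C) * det ?L"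
  proof (cases "det ?L = 0")
    case True
    \<comment> \<open>Singular case: a kernel vector has zero energy, so the bound C makes it
      orthogonal to \<open>u \<sigma>\<close>, and it stays in the kernel after the update.\<close>
    then obtain v where v: "v \<in> carrier_vec m" "v \<noteq> 0\<^sub>v m" "?L *\<^sub>v v = 0\<^sub>v m"
      using det_0_iff_vec_prod_zero[of ?L m] by auto
    have Lv: "(\<Sum>j<m. ?L $$ (i, j) * v $ j) = 0" if "i < m" for i
      using arg_cong[OF v(3), of "\<lambda>x. x $ i"] that v(1)
      by (simp add: scalar_prod_def atLeast0LessThan)
    have "(\<Sum>\<tau>\<in>K. w \<tau> * (\<Sum>i<m. v $ i * u \<tau> i)\<^sup>2) = 0"
      unfolding gram_quadratic_form[symmetric] using Lv by simp
    then have sv: "(\<Sum>i<m. v $ i * ?s i) = 0" using C[of "\<lambda>i. v $ i"] by simp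
    have "?L' *\<^sub>v v = 0\<^sub>v m"
    proof (rule eq_vecI)
      fix i assume "i < dim_vec (0\<^sub>v m :: real Matrix.vec)"
      then have i: "i < m" by simp
      have "(?L' *\<^sub>v v) $ i = (\<Sum>j<m. ?L $$ (i, j) * v $ j) + t * ?s i * (\<Sum>j<m. v $ j * ?s j)"
        using i v(1) L' by (simp add: scalar_prod_def atLeast0LessThan sum.distrib[symmetric]
            sum_distrib_left algebra_simps)
      then show "(?L' *\<^sub>v v) $ i = 0\<^sub>v m $ i" using i Lv sv by simp
    qed simp
    then have "det ?L' = 0" using v det_0_iff_vec_prod_zero[of ?L' m] by auto
    then show ?thesis using True by simp
  next
    case False
    define b where "b = vec m ?s"
    \<comment> \<open>The solution of \<open>?L *\<^sub>v y = b\<close>, with the adjugate divided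
      by the determinant as inverse.\<close>
    define y where "y = (1 / det ?L) \<cdot>\<^sub>v (adj_mat ?L *\<^sub>v b)"
    have adj: "adj_mat ?L \<in> carrier_mat m m" "?L * adj_mat ?L = det ?L \<cdot>\<^sub>m 1\<^sub>m m"
      using adj_mat[of ?L m] by auto
    have bc: "b \<in> carrier_vec m" and yc: "y \<in> carrier_vec m" using adj by (auto simp: b_def y_def)
    have "?L *\<^sub>v y = (1 / det ?L) \<cdot>\<^sub>v (?L *\<^sub>v (adj_mat ?L *\<^sub>v b))"
      unfolding y_def using adj bc by (intro mult_mat_vec) auto
    also have "?L *\<^sub>v (adj_mat ?L *\<^sub>v b) = (?L * adj_mat ?L) *\<^sub>v b"
      using adj bc by (subst assoc_mult_mat_vec[of _ m m _ m]) auto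
    also have "(1 / det ?L) \<cdot>\<^sub>v ((?L * adj_mat ?L) *\<^sub>v b) = b"
      using False bc unfolding adj(2) by (intro eq_vecI) auto
    finally have Ly: "?L *\<^sub>v y = b" .
    have Ly': "(\<Sum>j<m. ?L $$ (i, j) * y $ j) = ?s i" if "i < m" for i
      using arg_cong[OF Ly, of "\<lambda>x. x $ i"] that yc
      by (simp add: scalar_prod_def atLeast0LessThan b_def)
    \<comment> \<open>The effective resistance. The energy of y is again \<open>?r\<close>, so the
      bound C tested on y gives r^2 \<le> C r.\<close>
    let ?r = "\<Sum>i<m. y $ i * ?s i"
    have "(\<Sum>\<tau>\<in>K. w \<tau> * (\<Sum>i<m. y $ i * u \<tau> i)\<^sup>2) = ?r"
      unfolding gram_quadratic_form[symmetric] using Ly' by simp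
    moreover from this have r0: "?r \<ge> 0" using w by (metis (no_types, lifting) sum_nonneg zero_le_power2 mult_nonneg_nonneg)
    ultimately have "?r * ?r \<le> C * ?r" using C[of "\<lambda>i. y $ i"] by (simp add: power2_eq_square)
    with r0 C0 have C0: "?r \<le> C" by (cases "?r = 0") (auto simp: mult_le_cancel_right)
    let ?Y = "mat m 1 (\<lambda>(i, j). t * y $ i)" and ?S = "mat 1 m (\<lambda>(i, j). ?s j)"
    have "?L' = ?L * (1\<^sub>m m + ?Y * ?S)"
    proof -
      have "?L * (1\<^sub>m m + ?Y * ?S) = ?L + ?L * (?Y * ?S)"
        by (subst mult_add_distrib_mat[of _ m m _ m]) auto
      also have "?L * (?Y * ?S) = (?L * ?Y) * ?S" by (subst assoc_mult_mat[of _ m m _ 1 _ m]) auto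
      also have "?L * ?Y = mat m 1 (\<lambda>(i, j). t * ?s i)"
        using Ly' by (intro eq_matI)
          (auto simp: scalar_prod_def atLeast0LessThan mult.left_commute sum_distrib_left[symmetric])
      also have "?L + mat m 1 (\<lambda>(i, j). t * ?s i) * ?S = ?L'"
        using L' by (intro eq_matI) (auto simp: scalar_prod_def)
      finally show ?thesis by simp
    qed
    moreover have "1\<^sub>m m + ?Y * ?S \<in> carrier_mat m m" by (auto intro!: add_carrier_mat)
    ultimately have "det ?L' = det ?L * det (1\<^sub>m m + ?Y * ?S)"
      using det_mult[of ?L m "1\<^sub>m m + ?Y * ?S"] by simp
    also have "det (1\<^sub>m m + ?Y * ?S) = det (1\<^sub>m 1 + ?S * ?Y)"
      by (rule det_one_add_mult_commute[of _ _ 1]) auto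
    also have "\<dots> = 1 + t * ?r"
      by (subst det_single) (auto simp: scalar_prod_def atLeast0LessThan sum_distrib_left mult_ac)
    finally have "det ?L' = (1 + t * ?r) * det ?L" by simp
    moreover have "det ?L \<ge> 0" using K w by (rule det_gram_nonneg)
    ultimately show ?thesis using C0 t by (auto intro!: mult_right_mono mult_left_mono)
  qed
  then show ?thesis by (simp only: w'_def)
qed

section \<open>Index of an integer lattice\<close>

text \<open>Congruence modulo the lattice spanned by the columns of M. Vectors are functions read
  only below n, so an induction on n needs no change of type.\<close>

definition lattice_cong :: "nat \<Rightarrow> (nat \<Rightarrow> nat \<Rightarrow> int) \<Rightarrow> (nat \<Rightarrow> int) \<Rightarrow> (nat \<Rightarrow> int) \<Rightarrow> bool" where
  "lattice_cong n M x y \<longleftrightarrow> (\<exists>z. \<forall>i<n. x i - y i = (\<Sum>j<n. M i j * z j))"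

text \<open>The index is counted by representatives rather than classes, because representatives can
  be assembled one coordinate at a time.\<close>

definition transversal :: "('a \<Rightarrow> 'a \<Rightarrow> bool) \<Rightarrow> 'a set \<Rightarrow> bool" where
  "transversal E R \<longleftrightarrow> (\<forall>x. \<exists>r\<in>R. E x r) \<and> (\<forall>r\<in>R. \<forall>s\<in>R. E r s \<longrightarrow> r = s)"

definition add_column :: "int \<Rightarrow> nat \<Rightarrow> nat \<Rightarrow> (nat \<Rightarrow> nat \<Rightarrow> int) \<Rightarrow> nat \<Rightarrow> nat \<Rightarrow> int" where
  "add_column a l k M = (\<lambda>i j. if j = k then M i j + a * M i l else M i j)"

lemma lattice_cong_refl: "lattice_cong n M x x"
  unfolding lattice_cong_def by (intro exI[of _ "\<lambda>_. 0"]) simp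

lemma lattice_cong_sym: "lattice_cong n M x y \<Longrightarrow> lattice_cong n M y x"
proof -
  assume "lattice_cong n M x y"
  then obtain z where z: "\<forall>i<n. x i - y i = (\<Sum>j<n. M i j * z j)" by (auto simp: lattice_cong_def)
  then have "\<forall>i<n. y i - x i = (\<Sum>j<n. M i j * (- z j))" by (simp add: sum_negf) (metis minus_diff_eq)
  then show ?thesis unfolding lattice_cong_def by (intro exI[of _ "\<lambda>j. - z j"])
qed

lemma lattice_cong_trans: "lattice_cong n M x y \<Longrightarrow> lattice_cong n M y w \<Longrightarrow> lattice_cong n M x w"
proof -
  assume "lattice_cong n M x y" "lattice_cong n M y w"
  then obtain z z' where z: "\<forall>i<n. x i - y i = (\<Sum>j<n. M i j * z j)"
    and z': "\<forall>i<n. y i - w i = (\<Sum>j<n. M i j * z' j)" by (auto simp: lattice_cong_def)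
  have "\<forall>i<n. x i - w i = (\<Sum>j<n. M i j * (z j + z' j))"
    using z z' by (simp add: distrib_left sum.distrib) (metis diff_add_cancel add_diff_eq)
  then show ?thesis unfolding lattice_cong_def by (intro exI[of _ "\<lambda>j. z j + z' j"])
qed

lemma lattice_cong_add_column_le:
  assumes "l < n" "k < n" "k \<noteq> l" "lattice_cong n M x y"
  shows "lattice_cong n (add_column a l k M) x y"
proof -
  obtain z where z: "\<forall>i<n. x i - y i = (\<Sum>j<n. M i j * z j)"
    using assms(4) by (auto simp: lattice_cong_def)
  \<comment> \<open>The coefficient of column l absorbs the multiple of that column now carried by
    column k.\<close>
  let ?z = "z(l := z l - a * z k)"
  have "(\<Sum>j<n. add_column a l k M i j * ?z j) = (\<Sum>j<n. M i j * z j)" for i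
  proof -
    have "(\<Sum>j<n. add_column a l k M i j * ?z j) =
      (\<Sum>j<n. M i j * z j + (if j = k then a * M i l * z k else 0) - (if j = l then a * M i l * z k else 0))"
      using assms(3) by (intro sum.cong) (auto simp: add_column_def algebra_simps)
    also have "\<dots> = (\<Sum>j<n. M i j * z j)"
      using assms(1,2) by (simp add: sum.distrib sum_subtractf)
    finally show ?thesis .
  qed
  then show ?thesis using z unfolding lattice_cong_def by (intro exI[of _ ?z]) simp
qed

lemma lattice_cong_add_column:
  assumes "l < n" "k < n" "k \<noteq> l"
  shows "lattice_cong n (add_column a l k M) = lattice_cong n M"
proof (intro ext iffI)
  fix x y assume "lattice_cong n (add_column a l k M) x y"
  then have "lattice_cong n (add_column (- a) l k (add_column a l k M)) x y"
    by (rule lattice_cong_add_column_le[OF assms])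
  moreover have "add_column (- a) l k (add_column a l k M) = M"
    using assms by (intro ext) (auto simp: add_column_def)
  ultimately show "lattice_cong n M x y" by simp
qed (use assms lattice_cong_add_column_le in auto)

lemma det_add_column:
  assumes "l < n" "k < n" "k \<noteq> l"
  shows "det (mat n n (\<lambda>(i, j). add_column a l k M i j)) = det (mat n n (\<lambda>(i, j). M i j))"
proof -
  have "mat n n (\<lambda>(i, j). add_column a l k M i j) = addcol a k l (mat n n (\<lambda>(i, j). M i j))"
    using assms by (intro eq_matI) (auto simp: add_column_def)
  then show ?thesis using assms by simp
qed

text \<open>Euclid's algorithm by subtraction, run on the first row; each step lowers the sum of the
  absolute values of its entries.\<close>

lemma ex_clear_first_row:
  assumes n: "0 < n"
  shows "\<exists>M'. lattice_cong n M' = lattice_cong n M \<and>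
    det (mat n n (\<lambda>(i, j). M' i j)) = det (mat n n (\<lambda>(i, j). M i j)) \<and> (\<forall>j. 0 < j \<and> j < n \<longrightarrow> M' 0 j = 0)"
proof (induction "nat (\<Sum>j<n. \<bar>M 0 j\<bar>)" arbitrary: M rule: less_induct)
  case less
  show ?case
  proof (cases "\<exists>i j. i < n \<and> j < n \<and> i \<noteq> j \<and> M 0 i \<noteq> 0 \<and> M 0 j \<noteq> 0")
    case True
    then obtain i j where ij: "i < n" "j < n" "i \<noteq> j" "M 0 i \<noteq> 0" "M 0 j \<noteq> 0" "\<bar>M 0 i\<bar> \<le> \<bar>M 0 j\<bar>"
      by (metis linorder_le_cases)
    \<comment> \<open>With these signs the new entry is
      \<open>sgn (M 0 j) * (\<bar>M 0 j\<bar> - \<bar>M 0 i\<bar>)\<close>.\<close>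
    define a where "a = - (sgn (M 0 i) * sgn (M 0 j))"
    let ?M = "add_column a i j M"
    have dec: "\<bar>?M 0 j\<bar> < \<bar>M 0 j\<bar>"
      using ij by (auto simp: add_column_def a_def sgn_if split: if_splits)
    have "(\<Sum>j<n. \<bar>?M 0 j\<bar>) < (\<Sum>j<n. \<bar>M 0 j\<bar>)"
      by (rule sum_strict_mono_ex1) (use dec ij in \<open>auto simp: add_column_def\<close>)
    moreover have "0 \<le> (\<Sum>j<n. \<bar>?M 0 j\<bar>)" by (rule sum_nonneg) simp
    ultimately have "nat (\<Sum>j<n. \<bar>?M 0 j\<bar>) < nat (\<Sum>j<n. \<bar>M 0 j\<bar>)" by linarith
    from less[of ?M, OF this] show ?thesis
      using lattice_cong_add_column[of i n j a M] det_add_column[of i n j a M] ij by auto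
  next
    case False
    show ?thesis
    proof (cases "\<exists>j. 0 < j \<and> j < n \<and> M 0 j \<noteq> 0")
      case True
      then obtain j where j: "0 < j" "j < n" "M 0 j \<noteq> 0" by blast
      \<comment> \<open>A lone nonzero entry moves to column 0 by two column additions; a swap would
        change the sign of the determinant.\<close>
      let ?M1 = "add_column 1 j 0 M"
      let ?M2 = "add_column (-1) 0 j ?M1"
      have z: "M 0 k = 0" if "k < n" "k \<noteq> j" for k using False j that by blast
      have "\<forall>k. 0 < k \<and> k < n \<longrightarrow> ?M2 0 k = 0" using j z n by (auto simp: add_column_def)
      moreover have "lattice_cong n ?M2 = lattice_cong n M"
        using j n lattice_cong_add_column[of 0 n j "-1" ?M1] lattice_cong_add_column[of j n 0 1 M] by simp
      moreover have "det (mat n n (\<lambda>(i, j). ?M2 i j)) = det (mat n n (\<lambda>(i, j). M i j))"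
        using j n det_add_column[of 0 n j "-1" ?M1] det_add_column[of j n 0 1 M] by simp
      ultimately show ?thesis by blast
    qed blast
  qed
qed

lemma ex_transversal:
  assumes "\<And>x. E x x" "\<And>x y. E x y \<Longrightarrow> E y x" "\<And>x y z. E x y \<Longrightarrow> E y z \<Longrightarrow> E x z"
  shows "\<exists>R. transversal E R"
proof -
  define r where "r x = (SOME y. E x y)" for x
  have r: "E x (r x)" for x unfolding r_def using assms(1) by (rule someI)
  have eq: "r x = r y" if "E x y" for x y
  proof -
    have "E x = E y" using that assms(2,3) by blast
    then show ?thesis by (simp add: r_def)
  qed
  have "transversal E (range r)"
    unfolding transversal_def using r eq by (metis assms(2,3) rangeE rangeI)
  then show ?thesis by blast
qed

lemma card_range_eq_card_transversal:
  assumes R: "transversal E R" and q: "\<And>x y. q x = q y \<longleftrightarrow> E x y"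
  shows "card (range q) = card R"
proof -
  have "inj_on q R" using R q by (auto simp: inj_on_def transversal_def)
  moreover have "q ` R = range q" using R q by (fastforce simp: transversal_def)
  ultimately show ?thesis by (metis card_image)
qed

text \<open>With the convention \<open>card R = 0\<close> for infinite \<open>R\<close>, this includes singular matrices.\<close>

lemma ex_lattice_transversal:
  "\<exists>R. transversal (lattice_cong n M) R \<and> int (card R) = \<bar>det (mat n n (\<lambda>(i, j). M i j))\<bar>"
proof (induction n arbitrary: M)
  case 0
  have "transversal (lattice_cong 0 M) {undefined}"
    by (auto simp: transversal_def lattice_cong_def)
  moreover have "det (mat 0 0 (\<lambda>(i, j). M i j)) = 1" by (rule det_dim_zero) simp
  ultimately show ?case by (intro exI[of _ "{undefined}"]) auto
next
  case (Suc n)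
  obtain M' where M': "lattice_cong (Suc n) M' = lattice_cong (Suc n) M"
    "det (mat (Suc n) (Suc n) (\<lambda>(i, j). M' i j)) = det (mat (Suc n) (Suc n) (\<lambda>(i, j). M i j))"
    "\<And>j. 0 < j \<Longrightarrow> j < Suc n \<Longrightarrow> M' 0 j = 0"
    using ex_clear_first_row[of "Suc n" M] by auto
  let ?E = "lattice_cong (Suc n) M'"
  define D where "D i j = M' (Suc i) (Suc j)" for i j
  define g where "g = M' 0 0"
  have row0: "(\<Sum>j<Suc n. M' 0 j * z j) = g * z 0" for z
    using M'(3) by (subst sum.lessThan_Suc_shift) (simp add: g_def)
  have rowS: "(\<Sum>j<Suc n. M' (Suc i) j * z j) = M' (Suc i) 0 * z 0 + (\<Sum>j<n. D i j * z (Suc j))" for i z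
    by (subst sum.lessThan_Suc_shift) (simp add: D_def)
  have E: "?E x y \<longleftrightarrow> (\<exists>z. x 0 - y 0 = g * z 0 \<and>
      (\<forall>i<n. x (Suc i) - y (Suc i) = M' (Suc i) 0 * z 0 + (\<Sum>j<n. D i j * z (Suc j))))" for x y
    unfolding lattice_cong_def All_less_Suc2 row0 rowS ..
  have detM': "det (mat (Suc n) (Suc n) (\<lambda>(i, j). M' i j)) = g * det (mat n n (\<lambda>(i, j). D i j))"
  proof -
    have "mat (Suc n) (Suc n) (\<lambda>(i, j). M' i j) =
        four_block_mat (mat 1 1 (\<lambda>_. g)) (0\<^sub>m 1 n) (mat n 1 (\<lambda>(i, j). M' (Suc i) 0)) (mat n n (\<lambda>(i, j). D i j))"
      using M'(3) by (intro eq_matI) (auto simp: D_def g_def)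
    then show ?thesis
      by (simp only:) (subst det_four_block_mat_upper_right_zero[of _ 1 _ n], auto simp: det_single)
  qed
  have "\<exists>R. transversal ?E R \<and> int (card R) = \<bar>g * det (mat n n (\<lambda>(i, j). D i j))\<bar>"
  proof (cases "g = 0")
    case True
    obtain R where R: "transversal ?E R"
      using ex_transversal[of ?E] lattice_cong_refl lattice_cong_sym lattice_cong_trans by metis
    \<comment> \<open>For g = 0 congruent vectors agree in the first coordinate, so there are
      infinitely many classes, and \<open>card R = 0\<close> agrees with the vanishing
      determinant.\<close>
    have "infinite R"
    proof
      assume "finite R"
      have "\<forall>k::int. \<exists>r\<in>R. ?E (\<lambda>_. k) r" using R by (auto simp: transversal_def)
      then obtain f where f: "\<And>k::int. f k \<in> R" "\<And>k. ?E (\<lambda>_. k) (f k)" by metis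
      have "f k 0 = k" for k using f(2)[of k] True by (auto simp: E)
      then have "inj f" by (metis injI)
      moreover have "range f \<subseteq> R" using f(1) by auto
      ultimately show False using \<open>finite R\<close> infinite_UNIV_int finite_subset finite_imageD by metis
    qed
    then show ?thesis using R True by auto
  next
    case False
    obtain R where R: "transversal (lattice_cong n D) R" "int (card R) = \<bar>det (mat n n (\<lambda>(i, j). D i j))\<bar>"
      using Suc.IH by blast
    \<comment> \<open>A representative is a residue modulo \<bar>g\<bar> followed by a
      representative for the lattice of the minor D.\<close>
    let ?R = "(\<lambda>(a, r). case_nat a r) ` ({0..<\<bar>g\<bar>} \<times> R)"
    have "inj_on (\<lambda>(a, r). case_nat a r) ({0..<\<bar>g\<bar>} \<times> R)"
    proof (intro inj_onI, clarify)
      fix a b :: int and r s :: "nat \<Rightarrow> int" assume "case_nat a r = case_nat b s"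
      then have "case_nat a r i = case_nat b s i" for i by simp
      from this[of 0] this[of "Suc _"] show "a = b \<and> r = s" by auto
    qed
    then have "card ?R = card ({0..<\<bar>g\<bar>} \<times> R)" by (rule card_image)
    then have "int (card ?R) = \<bar>g * det (mat n n (\<lambda>(i, j). D i j))\<bar>"
      using R(2) by (simp add: abs_mult card_cartesian_product)
    moreover have "transversal ?E ?R"
      unfolding transversal_def
    proof (intro conjI allI ballI impI)
      fix x :: "nat \<Rightarrow> int"
      \<comment> \<open>The quotient by \<bar>g\<bar>, corrected by the sign of g: removing z0
        copies of column 0 reduces the first coordinate to its residue. The effect on the other
        coordinates is subtracted before r is chosen.\<close>
      define z0 where "z0 = sgn g * (x 0 div \<bar>g\<bar>)"
      let ?a = "x 0 mod \<bar>g\<bar>"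
      have a: "x 0 - ?a = g * z0"
      proof -
        have "g * z0 = \<bar>g\<bar> * (x 0 div \<bar>g\<bar>)" by (simp add: z0_def abs_sgn mult.assoc mult.left_commute)
        then show ?thesis by (simp add: minus_mod_eq_mult_div)
      qed
      obtain r z where r: "r \<in> R" "\<forall>i<n. (x (Suc i) - M' (Suc i) 0 * z0) - r i = (\<Sum>j<n. D i j * z j)"
        using R(1)[unfolded transversal_def lattice_cong_def, THEN conjunct1, rule_format,
            of "\<lambda>i. x (Suc i) - M' (Suc i) 0 * z0"] by blast
      have "?E x (case_nat ?a r)"
        unfolding E using a r(2) by (intro exI[of _ "case_nat z0 z"]) (auto simp: algebra_simps)
      moreover have "case_nat ?a r \<in> ?R" using r(1) False by (intro image_eqI[of _ _ "(?a, r)"]) auto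
      ultimately show "\<exists>r\<in>?R. ?E x r" by blast
    next
      fix r s :: "nat \<Rightarrow> int" assume "r \<in> ?R" "s \<in> ?R" "?E r s"
      then obtain a b r' s' where rs: "r = case_nat a r'" "s = case_nat b s'" "r' \<in> R" "s' \<in> R"
        "a \<in> {0..<\<bar>g\<bar>}" "b \<in> {0..<\<bar>g\<bar>}"
        by auto
      obtain z where z: "a - b = g * z 0"
        "\<forall>i<n. r' i - s' i = M' (Suc i) 0 * z 0 + (\<Sum>j<n. D i j * z (Suc j))"
        using \<open>?E r s\<close> unfolding E rs(1,2) by auto
      \<comment> \<open>Two residues differ by less than \<bar>g\<bar>, so column 0 has coefficient
        0 and the congruence descends to D.\<close>
      have "\<bar>g * z 0\<bar> < \<bar>g\<bar>" using rs(5,6) unfolding z(1)[symmetric] by auto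
      then have "\<bar>g\<bar> * \<bar>z 0\<bar> < \<bar>g\<bar> * 1" by (simp add: abs_mult)
      then have z0: "z 0 = 0" using False by (simp add: mult_less_cancel_left_disj)
      then have "lattice_cong n D r' s'" using z(2) by (auto simp: lattice_cong_def)
      then show "r = s" using R(1) rs z(1) z0 by (auto simp: transversal_def)
    qed
    ultimately show ?thesis by blast
  qed
  then show ?case using M' detM' by simp
qed

lemma card_lattice_quotient:
  assumes "\<And>x y. q x = q y \<longleftrightarrow> lattice_cong n M x y"
  shows "int (card (range q)) = \<bar>det (mat n n (\<lambda>(i, j). M i j))\<bar>"
proof -
  obtain R where R: "transversal (lattice_cong n M) R" "int (card R) = \<bar>det (mat n n (\<lambda>(i, j). M i j))\<bar>"
    using ex_lattice_transversal by blast
  have "card (range q) = card R" by (rule card_range_eq_card_transversal[OF R(1) assms])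
  then show ?thesis using R(2) by simp
qed

section \<open>The order of the first homology group\<close>

lemma simplex_boundary_edge:
  fixes a b :: "'a::linorder"
  assumes "a < b"
  shows "simplex_boundary {a, b} = frag_of {b} - frag_of {a}"
proof -
  have *: "{u. (u = a \<or> u = b) \<and> u < a} = {}" "{u. (u = a \<or> u = b) \<and> u < b} = {a}"
    "{a, b} - {a} = {b}" "{a, b} - {b} = {a}"
    and "a \<noteq> b" using assms by auto
  then show ?thesis by (simp add: simplex_boundary_def *)
qed

lemma simplex_boundary_triangle:
  fixes a b c :: "'a::linorder"
  assumes "a < b" "b < c"
  shows "simplex_boundary {a, b, c} = frag_of {b, c} - frag_of {a, c} + frag_of {a, b}"
proof -
  have *: "{u. (u = a \<or> u = b \<or> u = c) \<and> u < a} = {}" "{u. (u = a \<or> u = b \<or> u = c) \<and> u < b} = {a}"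
    "{u. (u = a \<or> u = b \<or> u = c) \<and> u < c} = {a, b}"
    "{a, b, c} - {a} = {b, c}" "{a, b, c} - {b} = {a, c}" "{a, b, c} - {c} = {a, b}"
    and "a \<noteq> b" "b \<noteq> c" "a \<noteq> c" using assms by auto
  then show ?thesis by (simp add: simplex_boundary_def *)
qed

lemma card_2_sorted_obtain:
  fixes e :: "'a::linorder set"
  assumes "card e = 2" obtains a b where "a < b" "e = {a, b}"
proof -
  from assms obtain a b where "e = {a, b}" "a \<noteq> b" by (meson card_2_iff)
  then show ?thesis using that[of a b] that[of b a] by (cases "a < b") (auto simp: insert_commute)
qed

lemma card_3_sorted_obtain:
  fixes e :: "'a::linorder set"
  assumes "card e = 3" obtains a b c where "a < b" "b < c" "e = {a, b, c}"
proof -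
  have e: "finite e" "e \<noteq> {}" using assms by (auto intro: card_ge_0_finite)
  have "card (e - {Max e}) = 2" using assms e by simp
  then obtain a b where ab: "a < b" "e - {Max e} = {a, b}" by (rule card_2_sorted_obtain)
  have "b \<in> e - {Max e}" using ab by simp
  then have "b < Max e" using e by (metis DiffE Max_ge insertI1 order_le_neq_trans)
  moreover have "e = {a, b, Max e}" using ab e Max_in[OF e] by blast
  ultimately show ?thesis using that ab(1) by blast
qed

lemma boundary_boundary_triangle:
  fixes \<tau> :: "'a::linorder set"
  assumes "card \<tau> = 3"
  shows "frag_extend simplex_boundary (simplex_boundary \<tau>) = 0"
proof -
  from assms obtain a b c where t: "a < b" "b < c" "\<tau> = {a, b, c}" by (rule card_3_sorted_obtain)
  then show ?thesis
    by (simp add: simplex_boundary_triangle simplex_boundary_edge frag_extend_add frag_extend_diff)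
qed

lemma lookup_frag_extend:
  assumes "finite X" "Poly_Mapping.keys c \<subseteq> X"
  shows "Poly_Mapping.lookup (frag_extend f c) x = (\<Sum>k\<in>X. Poly_Mapping.lookup c k * Poly_Mapping.lookup (f k) x)"
proof -
  have "Poly_Mapping.lookup (frag_extend f c) x =
      (\<Sum>k\<in>Poly_Mapping.keys c. Poly_Mapping.lookup c k * Poly_Mapping.lookup (f k) x)"
    by (simp add: frag_extend_def Poly_Mapping.lookup_sum)
  also have "\<dots> = (\<Sum>k\<in>X. Poly_Mapping.lookup c k * Poly_Mapping.lookup (f k) x)"
    using assms by (intro sum.mono_neutral_left) (auto simp: in_keys_iff)
  finally show ?thesis .
qed

section \<open>Cycles, boundaries and their cosets\<close>

lemma subgroup_simplicial_cycles:
  "subgroup (simplicial_cycles i K) (free_Abelian_group (faces i K))"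
proof (rule group.subgroupI)
  show "simplicial_cycles i K \<noteq> {}"
    by (auto simp: simplicial_cycles_def intro!: exI[of _ 0])
  fix a b assume a: "a \<in> simplicial_cycles i K"
  then show "inv\<^bsub>free_Abelian_group (faces i K)\<^esub> a \<in> simplicial_cycles i K"
    by (auto simp: simplicial_cycles_def frag_extend_minus)
  assume "b \<in> simplicial_cycles i K"
  with a show "a \<otimes>\<^bsub>free_Abelian_group (faces i K)\<^esub> b \<in> simplicial_cycles i K"
    using Poly_Mapping.keys_add[of a b] by (auto simp: simplicial_cycles_def frag_extend_add)
qed (auto simp: simplicial_cycles_def)

lemma simplicial_homology_carrier:
  "carrier (simplicial_homology i K) =
    (\<lambda>a. (\<lambda>h. h + a) ` simplicial_boundaries i K) ` simplicial_cycles i K"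
  using subgroup.carrier_subgroup_generated_subgroup[OF subgroup_simplicial_cycles[of i K]]
  by (simp add: simplicial_homology_def FactGroup_def RCOSETS_def r_coset_def UNION_singleton_eq_range
      setcompr_eq_image image_image)

lemma translate_boundaries_eq_iff:
  "(\<lambda>h. h + a) ` simplicial_boundaries i K = (\<lambda>h. h + b) ` simplicial_boundaries i K \<longleftrightarrow>
    a - b \<in> simplicial_boundaries i K"
proof -
  let ?B = "simplicial_boundaries i K"
  have z: "0 \<in> ?B" unfolding simplicial_boundaries_def by (rule image_eqI[of _ _ 0]) auto
  have minus: "x - y \<in> ?B" if xy: "x \<in> ?B" "y \<in> ?B" for x y
  proof -
    obtain p q where pq: "x = frag_extend simplex_boundary p" "y = frag_extend simplex_boundary q"
      "Poly_Mapping.keys p \<subseteq> faces (i + 1) K" "Poly_Mapping.keys q \<subseteq> faces (i + 1) K"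
      using xy by (auto simp: simplicial_boundaries_def)
    then have "x - y = frag_extend simplex_boundary (p - q)" by (simp add: frag_extend_diff)
    then show ?thesis using pq keys_diff[of p q] unfolding simplicial_boundaries_def
      by (intro image_eqI[of _ _ "p - q"]) auto
  qed
  show ?thesis
  proof
    assume "(\<lambda>h. h + a) ` ?B = (\<lambda>h. h + b) ` ?B"
    moreover have "0 + a \<in> (\<lambda>h. h + a) ` ?B" using z by (rule imageI)
    ultimately show "a - b \<in> ?B" by auto
  next
    assume ab: "a - b \<in> ?B"
    have ba: "b - a \<in> ?B" using minus[OF z ab] by simp
    show "(\<lambda>h. h + a) ` ?B = (\<lambda>h. h + b) ` ?B"
    proof (intro equalityI subsetI)
      fix x assume "x \<in> (\<lambda>h. h + a) ` ?B"
      then obtain h where "h \<in> ?B" "x = h + a" by blast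
      then show "x \<in> (\<lambda>h. h + b) ` ?B" using minus[of h "b - a"] ba by (intro image_eqI[of _ _ "h - (b - a)"]) auto
    next
      fix x assume "x \<in> (\<lambda>h. h + b) ` ?B"
      then obtain h where "h \<in> ?B" "x = h + b" by blast
      then show "x \<in> (\<lambda>h. h + a) ` ?B" using minus[of h "a - b"] ab by (intro image_eqI[of _ _ "h - (a - b)"]) auto
    qed
  qed
qed

section \<open>Free edges as coordinates on the group of 1-cycles\<close>

text \<open>The edges outside the star of n, a spanning tree of the complete graph: the coefficients
  of a 1-cycle on them are arbitrary and determine the cycle.\<close>

definition free_edges :: "nat \<Rightarrow> nat set set" where
  "free_edges n = {e. e \<subseteq> {1..<n} \<and> card e = 2}"

definition full_skeleton :: "nat \<Rightarrow> nat set set" where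
  "full_skeleton n = {\<sigma>. \<sigma> \<subseteq> {1..n} \<and> card \<sigma> \<in> {1, 2}}"

definition triangles :: "nat \<Rightarrow> nat set set" where
  "triangles n = {\<sigma>. \<sigma> \<subseteq> {1..n} \<and> card \<sigma> = 3}"

lemma finite_free_edges [simp]: "finite (free_edges n)"
  by (rule finite_subset[of _ "Pow {1..<n}"]) (auto simp: free_edges_def)

lemma card_free_edges: "card (free_edges n) = (n - 1) choose 2"
  using n_subsets[of "{1..<n}" 2] by (simp add: free_edges_def)

lemma finite_triangles [simp]: "finite (triangles n)"
  by (rule finite_subset[of _ "Pow {1..n}"]) (auto simp: triangles_def)

definition incidence :: "nat set \<Rightarrow> nat set \<Rightarrow> int" where
  "incidence \<tau> e = Poly_Mapping.lookup (simplex_boundary \<tau>) e"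

text \<open>The cones from n over the free edges are dual to the coordinates, so their boundaries
  realise any prescribed free coefficients.\<close>

lemma incidence_cone:
  assumes "e \<in> free_edges n" "e' \<in> free_edges n"
  shows "incidence (insert n e) e' = (if e = e' then 1 else 0)"
proof -
  from assms obtain a b where e: "a < b" "b < n" "e = {a, b}"
    by (auto simp: free_edges_def elim!: card_2_sorted_obtain)
  have "insert n e = {a, b, n}" using e by auto
  moreover have "n \<notin> e'" using assms by (auto simp: free_edges_def)
  ultimately show ?thesis using e
    by (auto simp: incidence_def simplex_boundary_triangle lookup_add lookup_minus)
qed

text \<open>What remains is supported on the star of n, and there each leaf x lies on a single edge,
  which forces its coefficient to vanish.\<close>

lemma edge_chain_cycle_unique:
  assumes keys: "Poly_Mapping.keys c \<subseteq> {e. e \<subseteq> {1..n} \<and> card e = 2}"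
    and cyc: "frag_extend simplex_boundary c = 0"
    and z: "\<And>e. e \<in> free_edges n \<Longrightarrow> Poly_Mapping.lookup c e = 0"
  shows "c = (0 :: nat set \<Rightarrow>\<^sub>0 int)"
proof (rule poly_mapping_eqI)
  fix e
  show "Poly_Mapping.lookup c e = Poly_Mapping.lookup 0 e"
  proof (cases "e \<in> Poly_Mapping.keys c")
    case True
    then have e: "e \<subseteq> {1..n}" "card e = 2" "e \<notin> free_edges n" using keys z by (auto simp: in_keys_iff)
    then obtain x where x: "x < n" "e = {x, n}" "x \<ge> 1"
      by (auto simp: free_edges_def elim!: card_2_sorted_obtain)
         (metis atLeastLessThan_iff le_neq_implies_less)
    \<comment> \<open>The boundary at the vertex x sees only e, with sign -1 because x < n.\<close>
    have "0 = Poly_Mapping.lookup (frag_extend simplex_boundary c) {x}" using cyc by simp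
    also have "\<dots> = (\<Sum>k\<in>Poly_Mapping.keys c. Poly_Mapping.lookup c k * Poly_Mapping.lookup (simplex_boundary k) {x})"
      by (rule lookup_frag_extend) auto
    also have "\<dots> = (\<Sum>k\<in>Poly_Mapping.keys c. if k = e then - Poly_Mapping.lookup c e else 0)"
    proof (rule sum.cong)
      fix k assume "k \<in> Poly_Mapping.keys c"
      then have k: "k \<subseteq> {1..n}" "card k = 2" "k \<notin> free_edges n" using keys z by (auto simp: in_keys_iff)
      then obtain y where y: "y < n" "k = {y, n}"
        by (auto simp: free_edges_def elim!: card_2_sorted_obtain)
           (metis atLeastLessThan_iff le_neq_implies_less)
      then show "Poly_Mapping.lookup c k * Poly_Mapping.lookup (simplex_boundary k) {x} =
          (if k = e then - Poly_Mapping.lookup c e else 0)"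
        using x by (auto simp: simplex_boundary_edge lookup_minus doubleton_eq_iff)
    qed simp
    also have "\<dots> = - Poly_Mapping.lookup c e" using True by simp
    finally show ?thesis by simp
  qed (simp add: in_keys_iff)
qed

text \<open>Free coordinates identify the cycles with Z^m and the boundaries with the lattice
  spanned by the incidence columns, so H_1 is the lattice quotient. An infinite H_1 has
  \<open>order\<close> 0, in agreement with a singular matrix.\<close>

lemma order_simplicial_homology_1:
  assumes f1: "faces 1 K = {e. e \<subseteq> {1..n} \<and> card e = 2}"
    and f2: "faces 2 K \<subseteq> triangles n" and n: "n \<ge> 1"
    and e: "bij_betw e {..<m} (free_edges n)" and t: "bij_betw t {..<m} (faces 2 K)"
  shows "int (order (simplicial_homology 1 K)) =
    \<bar>det (mat m m (\<lambda>(i, j). incidence (t j) (e i)))\<bar>"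
proof -
  let ?D = "frag_extend simplex_boundary"
  \<comment> \<open>The boundary of a combination of cones: the unique cycle with free coordinates
    x.\<close>
  define c where "c x = (\<Sum>i<m. frag_cmul (x i) (simplex_boundary (insert n (e i))))" for x :: "nat \<Rightarrow> int"
  define q where "q x = (\<lambda>h. h + c x) ` simplicial_boundaries 1 K" for x
  have eE: "e i \<in> free_edges n" if "i < m" for i using e that by (auto simp: bij_betw_def)
  have einj: "e i = e j \<longleftrightarrow> i = j" if "i < m" "j < m" for i j
    using e that by (auto simp: bij_betw_def inj_on_def)
  have f2c: "card \<tau> = 3" if "\<tau> \<in> faces 2 K" for \<tau> using that f2 by (auto simp: triangles_def)
  have keys3: "Poly_Mapping.keys (simplex_boundary \<tau>) \<subseteq> faces 1 K" if "\<tau> \<in> triangles n" for \<tau>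
  proof -
    from that have \<tau>: "card \<tau> = 3" and sub: "\<tau> \<subseteq> {1..n}" by (auto simp: triangles_def)
    from \<tau> obtain x y w where xyw: "x < y" "y < w" "\<tau> = {x, y, w}" by (rule card_3_sorted_obtain)
    have "Poly_Mapping.keys (simplex_boundary \<tau>) \<subseteq> {{y, w}, {x, w}, {x, y}}"
    proof (rule subsetI, rule ccontr)
      fix k assume "k \<in> Poly_Mapping.keys (simplex_boundary \<tau>)" "k \<notin> {{y, w}, {x, w}, {x, y}}"
      then show False
        unfolding xyw(3) simplex_boundary_triangle[OF xyw(1,2)] by (simp add: in_keys_iff lookup_add lookup_minus)
    qed
    then show ?thesis using xyw sub by (auto simp: f1[unfolded One_nat_def])
  qed
  have cone: "insert n (e i) \<in> triangles n" if "i < m" for i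
    using eE[OF that] n by (auto simp: free_edges_def triangles_def card_insert_if finite_subset[of _ "{1..<n}"])
  have ccyc: "c x \<in> simplicial_cycles 1 K" for x
  proof -
    have "?D (c x) = 0"
      using cone by (simp add: c_def frag_extend_sum frag_extend_cmul boundary_boundary_triangle triangles_def)
    moreover have "Poly_Mapping.keys (c x) \<subseteq> faces 1 K"
      unfolding c_def using keys3[OF cone]
      by (intro order_trans[OF keys_sum]) (auto dest!: subsetD[OF keys_cmul])
    ultimately show ?thesis by (simp add: simplicial_cycles_def)
  qed
  have clook: "Poly_Mapping.lookup (c x) (e i) = x i" if i: "i < m" for x i
  proof -
    have "Poly_Mapping.lookup (c x) (e i) = (\<Sum>j<m. x j * incidence (insert n (e j)) (e i))"
      by (simp add: c_def Poly_Mapping.lookup_sum incidence_def)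
    also have "\<dots> = (\<Sum>j<m. if j = i then x i else 0)"
      by (intro sum.cong) (auto simp: incidence_cone[OF eE eE] i einj)
    also have "\<dots> = x i" using i by simp
    finally show ?thesis .
  qed
  have bcyc: "?D b \<in> simplicial_cycles 1 K" if b: "Poly_Mapping.keys b \<subseteq> faces 2 K" for b
  proof -
    have "?D (?D b) = 0"
      unfolding frag_extend_def[of _ b] using b f2c
      by (simp add: frag_extend_sum frag_extend_cmul boundary_boundary_triangle subset_iff)
    moreover have "Poly_Mapping.keys (?D b) \<subseteq> faces 1 K"
      using keys_frag_extend[of simplex_boundary b] b keys3 f2 by blast
    ultimately show ?thesis by (simp add: simplicial_cycles_def)
  qed
  have uniq: "a = b" if "a \<in> simplicial_cycles 1 K" "b \<in> simplicial_cycles 1 K"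
    "\<And>i. i < m \<Longrightarrow> Poly_Mapping.lookup a (e i) = Poly_Mapping.lookup b (e i)" for a b
  proof -
    have "a - b = 0"
    proof (rule edge_chain_cycle_unique)
      show "Poly_Mapping.keys (a - b) \<subseteq> {e. e \<subseteq> {1..n} \<and> card e = 2}"
        using that(1,2) keys_diff[of a b] by (auto simp: simplicial_cycles_def f1[unfolded One_nat_def])
      show "?D (a - b) = 0" using that(1,2) by (simp add: simplicial_cycles_def frag_extend_diff)
      fix e' assume "e' \<in> free_edges n"
      then obtain i where "i < m" "e' = e i" using e by (auto simp: bij_betw_def)
      then show "Poly_Mapping.lookup (a - b) e' = 0" using that(3) by (simp add: lookup_minus)
    qed
    then show ?thesis by simp
  qed
  have fin: "finite (faces 2 K)" by (rule finite_subset[OF f2 finite_triangles])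
  have Dlook: "Poly_Mapping.lookup (?D b) e' = (\<Sum>j<m. incidence (t j) e' * Poly_Mapping.lookup b (t j))"
    if b: "Poly_Mapping.keys b \<subseteq> faces 2 K" for b e'
    using lookup_frag_extend[OF fin b, of simplex_boundary e']
      sum.reindex_bij_betw[OF t, of "\<lambda>k. Poly_Mapping.lookup b k * Poly_Mapping.lookup (simplex_boundary k) e'"]
    by (simp add: incidence_def mult.commute)
  have "q x = q y \<longleftrightarrow> lattice_cong m (\<lambda>i j. incidence (t j) (e i)) x y" for x y
  proof
    assume "q x = q y"
    then have "c x - c y \<in> simplicial_boundaries 1 K"
      unfolding q_def translate_boundaries_eq_iff .
    then obtain b where "b \<in> carrier (free_Abelian_group (faces (1 + 1) K))" "c x - c y = ?D b"
      unfolding simplicial_boundaries_def by (elim imageE)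
    then have b: "Poly_Mapping.keys b \<subseteq> faces 2 K" "c x - c y = ?D b" by (simp_all add: numeral_2_eq_2)
    have "x i - y i = (\<Sum>j<m. incidence (t j) (e i) * Poly_Mapping.lookup b (t j))" if i: "i < m" for i
      using arg_cong[OF b(2), of "\<lambda>p. Poly_Mapping.lookup p (e i)"] i
      by (simp add: lookup_minus clook Dlook[OF b(1)])
    then show "lattice_cong m (\<lambda>i j. incidence (t j) (e i)) x y"
      unfolding lattice_cong_def by (intro exI[of _ "\<lambda>j. Poly_Mapping.lookup b (t j)"] allI impI)
  next
    assume "lattice_cong m (\<lambda>i j. incidence (t j) (e i)) x y"
    then obtain z where z: "\<And>i. i < m \<Longrightarrow> x i - y i = (\<Sum>j<m. incidence (t j) (e i) * z j)"
      unfolding lattice_cong_def by blast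
    define b where "b = (\<Sum>j<m. frag_cmul (z j) (frag_of (t j)))"
    have tf: "t j \<in> faces 2 K" if "j < m" for j using t that by (auto simp: bij_betw_def)
    have b: "Poly_Mapping.keys b \<subseteq> faces 2 K"
      unfolding b_def using tf
      by (intro order_trans[OF keys_sum]) (auto dest!: subsetD[OF keys_cmul])
    have blook: "Poly_Mapping.lookup b (t j) = z j" if j: "j < m" for j
    proof -
      have "Poly_Mapping.lookup b (t j) = (\<Sum>k<m. if k = j then z j else 0)"
        unfolding b_def Poly_Mapping.lookup_sum using t j
        by (intro sum.cong) (auto simp: bij_betw_def inj_on_def)
      then show ?thesis using j by simp
    qed
    \<comment> \<open>Both sides are cycles, so it is enough to compare free coordinates.\<close>
    have "c x - c y = ?D b"
    proof (rule uniq)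
      show "c x - c y \<in> simplicial_cycles 1 K"
        using ccyc[of x] ccyc[of y] keys_diff[of "c x" "c y"] by (auto simp: simplicial_cycles_def frag_extend_diff)
      show "?D b \<in> simplicial_cycles 1 K" by (rule bcyc[OF b])
      fix i assume i: "i < m"
      show "Poly_Mapping.lookup (c x - c y) (e i) = Poly_Mapping.lookup (?D b) (e i)"
        using z[OF i] by (simp add: lookup_minus clook[OF i] Dlook[OF b] blook)
    qed
    moreover have "b \<in> carrier (free_Abelian_group (faces (1 + 1) K))"
      using b by (simp add: numeral_2_eq_2)
    ultimately have "c x - c y \<in> simplicial_boundaries 1 K"
      unfolding simplicial_boundaries_def by (rule image_eqI)
    then show "q x = q y" unfolding q_def translate_boundaries_eq_iff .
  qed
  from card_lattice_quotient[OF this]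
  have "int (card (range q)) = \<bar>det (mat m m (\<lambda>(i, j). incidence (t j) (e i)))\<bar>" .
  moreover have "range q = carrier (simplicial_homology 1 K)"
  proof -
    have "simplicial_cycles 1 K = range c"
    proof (intro equalityI subsetI)
      fix a assume a: "a \<in> simplicial_cycles 1 K"
      have "a = c (\<lambda>i. Poly_Mapping.lookup a (e i))" using a ccyc clook by (intro uniq) auto
      then show "a \<in> range c" by blast
    qed (use ccyc in auto)
    then show ?thesis by (auto simp: simplicial_homology_carrier q_def)
  qed
  ultimately show ?thesis by (simp add: order_def)
qed

section \<open>Tree weights, and hypertrees as sets of triangles\<close>

definition edge_at :: "nat \<Rightarrow> nat \<Rightarrow> nat set" where
  "edge_at n = (SOME e. bij_betw e {..<(n - 1) choose 2} (free_edges n))"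

lemma bij_betw_edge_at: "bij_betw (edge_at n) {..<(n - 1) choose 2} (free_edges n)"
proof -
  have "\<exists>e. bij_betw e {..<(n - 1) choose 2} (free_edges n)"
    using ex_bij_betw_nat_finite[OF finite_free_edges[of n]] by (simp add: card_free_edges atLeast0LessThan)
  then show ?thesis unfolding edge_at_def by (rule someI_ex)
qed

definition tri_gram :: "nat \<Rightarrow> nat set set \<Rightarrow> (nat set \<Rightarrow> real) \<Rightarrow> real mat" where
  "tri_gram n = gram ((n - 1) choose 2) (\<lambda>\<tau> i. real_of_int (incidence \<tau> (edge_at n i)))"

text \<open>For a set S of \<open>(n - 1) choose 2\<close> triangles this is |H_1|^2 if H_1 is
  finite and 0 otherwise. Sums may therefore run over all such S, and those that are no hypertrees
  drop out.\<close>

definition tree_weight :: "nat \<Rightarrow> nat set set \<Rightarrow> real" where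
  "tree_weight n S = det (tri_gram n S (\<lambda>_. 1))"

lemma order_homology_square:
  assumes f1: "faces 1 K = {e. e \<subseteq> {1..n} \<and> card e = 2}"
    and f2: "faces 2 K \<subseteq> triangles n" and n: "n \<ge> 1" and c: "card (faces 2 K) = (n - 1) choose 2"
  shows "(real (order (simplicial_homology 1 K)))\<^sup>2 = tree_weight n (faces 2 K)"
proof -
  let ?m = "(n - 1) choose 2"
  have "finite (faces 2 K)" by (rule finite_subset[OF f2 finite_triangles])
  then obtain t where t: "bij_betw t {..<?m} (faces 2 K)"
    using ex_bij_betw_nat_finite[of "faces 2 K"] c by (auto simp: atLeast0LessThan)
  let ?M = "mat ?m ?m (\<lambda>(i, j). incidence (t j) (edge_at n i))"
  have "tree_weight n (faces 2 K) = (det (mat ?m ?m (\<lambda>(i, j). real_of_int (incidence (t j) (edge_at n i)))))\<^sup>2"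
    unfolding tree_weight_def tri_gram_def
    by (rule det_gram_eq_square) (use t in \<open>simp add: atLeast0LessThan\<close>)
  also have "mat ?m ?m (\<lambda>(i, j). real_of_int (incidence (t j) (edge_at n i))) = map_mat real_of_int ?M"
    by (intro eq_matI) auto
  also have "det \<dots> = real_of_int (det ?M)" by simp
  also have "(real_of_int (det ?M))\<^sup>2 = (real_of_int \<bar>det ?M\<bar>)\<^sup>2" by simp
  also have "\<dots> = (real_of_int (int (order (simplicial_homology 1 K))))\<^sup>2"
    unfolding order_simplicial_homology_1[OF f1 f2 n bij_betw_edge_at t] ..
  finally show ?thesis by simp
qed

text \<open>Finiteness of H_1 means that \<open>order\<close> is nonzero, because the carrier is
  nonempty and an infinite set has \<open>card\<close> 0. As the skeleton is complete and the
  dimension is 2, only the choice of triangles remains.\<close>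

lemma hypertrees_eq:
  assumes n: "n \<ge> 3"
  shows "hypertrees n = (\<lambda>S. full_skeleton n \<union> S) `
    {S. S \<subseteq> triangles n \<and> card S = (n - 1) choose 2 \<and> tree_weight n S \<noteq> 0}"
    and "\<And>S. S \<subseteq> triangles n \<Longrightarrow> faces 2 (full_skeleton n \<union> S) = S"
    and "\<And>S. S \<subseteq> triangles n \<Longrightarrow> card S = (n - 1) choose 2 \<Longrightarrow>
      (real (order (simplicial_homology 1 (full_skeleton n \<union> S))))\<^sup>2 = tree_weight n S"
    and "\<And>S. S \<subseteq> triangles n \<Longrightarrow> S \<noteq> {} \<Longrightarrow> complex_dim (full_skeleton n \<union> S) = 2"
proof -
  let ?K = "\<lambda>S. full_skeleton n \<union> S"
  have tri: "\<sigma> \<in> S \<Longrightarrow> \<sigma> \<subseteq> {1..n} \<and> card \<sigma> = 3" if "S \<subseteq> triangles n" for S \<sigma>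
    using that unfolding triangles_def by blast
  show f2: "faces 2 (?K S) = S" if "S \<subseteq> triangles n" for S
  proof (rule Set.set_eqI)
    fix \<sigma> show "\<sigma> \<in> faces 2 (?K S) \<longleftrightarrow> \<sigma> \<in> S"
      using tri[OF that, of \<sigma>] by (cases "\<sigma> \<in> S") (auto simp add: faces_def full_skeleton_def)
  qed
  have f1: "faces 1 (?K S) = {e. e \<subseteq> {1..n} \<and> card e = 2}" if "S \<subseteq> triangles n" for S
  proof (rule Set.set_eqI)
    fix \<sigma> show "\<sigma> \<in> faces 1 (?K S) \<longleftrightarrow> \<sigma> \<in> {e. e \<subseteq> {1..n} \<and> card e = 2}"
      using tri[OF that, of \<sigma>] by (cases "\<sigma> \<in> S") (auto simp add: faces_def full_skeleton_def)
  qed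
  show w: "(real (order (simplicial_homology 1 (?K S))))\<^sup>2 = tree_weight n S"
    if "S \<subseteq> triangles n" "card S = (n - 1) choose 2" for S
    using order_homology_square[of "?K S" n] f1 f2 that n by simp
  have fin: "finite (?K S)" if "S \<subseteq> triangles n" for S
  proof (rule finite_subset)
    show "?K S \<subseteq> Pow {1..n}" using tri[OF that] by (auto simp: full_skeleton_def)
  qed simp
  have carrier_ne: "carrier (simplicial_homology 1 K) \<noteq> {}" for K :: "nat set set"
  proof -
    have "0 \<in> simplicial_cycles 1 K" by (simp add: simplicial_cycles_def)
    then show ?thesis unfolding simplicial_homology_carrier by blast
  qed
  have fin_iff: "finite (carrier (simplicial_homology 1 K)) \<longleftrightarrow> (real (order (simplicial_homology 1 K)))\<^sup>2 \<noteq> 0"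
    for K :: "nat set set"
    using carrier_ne[of K] by (auto simp: order_def card_eq_0_iff)
  show dim: "complex_dim (?K S) = 2" if S: "S \<subseteq> triangles n" "S \<noteq> {}" for S
    unfolding complex_dim_def
  proof (rule Max_eqI)
    show "finite ((\<lambda>\<sigma>. card \<sigma> - 1) ` ?K S)" using fin S by simp
    show "\<And>y. y \<in> (\<lambda>\<sigma>. card \<sigma> - 1) ` ?K S \<Longrightarrow> y \<le> 2"
      using tri[OF S(1)] by (auto simp: full_skeleton_def)
    obtain \<tau> where "\<tau> \<in> S" using S by blast
    then show "2 \<in> (\<lambda>\<sigma>. card \<sigma> - 1) ` ?K S"
      using tri[OF S(1)] by (intro image_eqI[of _ _ \<tau>]) auto
  qed
  show "hypertrees n = ?K ` {S. S \<subseteq> triangles n \<and> card S = (n - 1) choose 2 \<and> tree_weight n S \<noteq> 0}"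
  proof (intro equalityI subsetI)
    fix K assume "K \<in> hypertrees n"
    then have K: "abstract_complex {1..n} K" "complex_dim K = 2"
      "\<And>\<sigma>. \<sigma> \<subseteq> {1..n} \<Longrightarrow> card \<sigma> \<in> {1, 2} \<Longrightarrow> \<sigma> \<in> K"
      "card (faces 2 K) = (n - 1) choose 2" "finite (carrier (simplicial_homology 1 K))"
      by (auto simp: hypertrees_def)
    have sub: "\<sigma> \<subseteq> {1..n}" "finite \<sigma>" "card \<sigma> > 0" if "\<sigma> \<in> K" for \<sigma>
      using K(1) that by (auto simp: abstract_complex_def card_gt_0_iff)
    have "finite K" using sub(1) by (intro finite_subset[of K "Pow {1..n}"]) auto
    then have "card \<sigma> - 1 \<le> 2" if "\<sigma> \<in> K" for \<sigma>
      using that unfolding K(2)[symmetric] complex_dim_def by (intro Max_ge) auto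
    then have c: "card \<sigma> = 1 \<or> card \<sigma> = 2 \<or> card \<sigma> = 3" if "\<sigma> \<in> K" for \<sigma>
      using sub(3)[OF that] that by fastforce
    have tri': "faces 2 K \<subseteq> triangles n" using sub by (auto simp: faces_def triangles_def)
    have "K = ?K (faces 2 K)"
    proof (intro equalityI subsetI)
      fix \<sigma> assume "\<sigma> \<in> K"
      then show "\<sigma> \<in> ?K (faces 2 K)" using c[of \<sigma>] sub(1)[of \<sigma>] by (auto simp: full_skeleton_def faces_def)
    qed (use K(3) in \<open>auto simp: full_skeleton_def faces_def\<close>)
    moreover have "tree_weight n (faces 2 K) \<noteq> 0"
      using w[OF tri' K(4)] fin_iff[of K] K(5) calculation by simp
    ultimately show "K \<in> ?K ` {S. S \<subseteq> triangles n \<and> card S = (n - 1) choose 2 \<and> tree_weight n S \<noteq> 0}"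
      using tri' K(4) by blast
  next
    fix K assume "K \<in> ?K ` {S. S \<subseteq> triangles n \<and> card S = (n - 1) choose 2 \<and> tree_weight n S \<noteq> 0}"
    then obtain S where S: "K = ?K S" "S \<subseteq> triangles n" "card S = (n - 1) choose 2" "tree_weight n S \<noteq> 0"
      by blast
    \<comment> \<open>For n \<ge> 3 there is at least one triangle, which makes the dimension equal
      to 2.\<close>
    have "(n - 1) choose 2 > 0" using n by (intro zero_less_binomial) auto
    then have "S \<noteq> {}" using S(3) by auto
    have "abstract_complex {1..n} K"
      unfolding abstract_complex_def
    proof (intro conjI ballI allI impI)
      fix \<sigma> :: "nat set" assume \<sigma>: "\<sigma> \<in> K"
      then show "finite \<sigma>" "\<sigma> \<noteq> {}" "\<sigma> \<subseteq> {1..n}"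
        using S(1) tri[OF S(2), of \<sigma>] finite_subset[of \<sigma> "{1..n}"] by (auto simp: full_skeleton_def)
      fix \<rho> :: "nat set" assume \<rho>: "\<rho> \<subseteq> \<sigma> \<and> \<rho> \<noteq> {}"
      show "\<rho> \<in> K"
      proof (cases "\<rho> = \<sigma>")
        case False
        then have "card \<rho> < card \<sigma>" using \<rho> \<open>finite \<sigma>\<close> by (intro psubset_card_mono) auto
        moreover have "card \<sigma> \<le> 3" using \<sigma> S(1) tri[OF S(2), of \<sigma>] by (auto simp: full_skeleton_def)
        moreover have "card \<rho> > 0" using \<rho> \<open>finite \<sigma>\<close> finite_subset by (auto simp: card_gt_0_iff)
        ultimately have "card \<rho> = 1 \<or> card \<rho> = 2" by linarith
        then show ?thesis using \<rho> \<open>\<sigma> \<subseteq> {1..n}\<close> S(1) by (auto simp: full_skeleton_def)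
      qed (use \<sigma> in simp)
    qed
    moreover have "finite (carrier (simplicial_homology 1 K))"
      unfolding fin_iff S(1) w[OF S(2,3)] by (rule S(4))
    ultimately show "K \<in> hypertrees n"
      using S dim[OF S(2) \<open>S \<noteq> {}\<close>] f2[OF S(2)] by (auto simp: hypertrees_def full_skeleton_def)
  qed
qed

section \<open>Effective resistances of triangles\<close>

text \<open>g is orthogonal to every vector that enters the matrix, hence a nonzero kernel
  vector.\<close>

lemma det_gram_zero:
  assumes "\<And>\<tau>. \<tau> \<in> K \<Longrightarrow> (\<Sum>i<m. g i * u \<tau> i) = 0" "k < m" "g k \<noteq> 0"
  shows "det (gram m u K w) = 0"
proof -
  let ?v = "vec m g"
  have "gram m u K w *\<^sub>v ?v = 0\<^sub>v m"
  proof (rule eq_vecI)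
    fix i assume "i < dim_vec (0\<^sub>v m :: real Matrix.vec)"
    then have i: "i < m" by simp
    have "(gram m u K w *\<^sub>v ?v) $ i = (\<Sum>j<m. (\<Sum>\<tau>\<in>K. w \<tau> * u \<tau> i * u \<tau> j) * g j)"
      using i by (simp add: gram_def scalar_prod_def atLeast0LessThan)
    also have "\<dots> = (\<Sum>j<m. \<Sum>\<tau>\<in>K. w \<tau> * u \<tau> i * (g j * u \<tau> j))"
      by (intro sum.cong refl) (simp add: sum_distrib_right, simp add: mult_ac)
    also have "\<dots> = (\<Sum>\<tau>\<in>K. \<Sum>j<m. w \<tau> * u \<tau> i * (g j * u \<tau> j))" by (rule sum.swap)
    also have "\<dots> = (\<Sum>\<tau>\<in>K. w \<tau> * u \<tau> i * (\<Sum>j<m. g j * u \<tau> j))" by (simp add: sum_distrib_left)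
    also have "\<dots> = 0" using assms(1) by simp
    finally show "(gram m u K w *\<^sub>v ?v) $ i = 0\<^sub>v m $ i" using i by simp
  qed (simp add: gram_def)
  moreover have "?v \<noteq> 0\<^sub>v m" using assms(2,3) by (metis index_vec index_zero_vec(1))
  ultimately show ?thesis
    by (intro iffD2[OF det_0_iff_vec_prod_zero[OF gram_carrier]] exI[of _ ?v] conjI) simp_all
qed

text \<open>The weights are raised one at a time. Raising a weight only increases the energy, so the
  resistance bound for w stays valid throughout.\<close>

lemma det_gram_add_weights_le:
  assumes K: "finite K" and B: "finite B" "B \<subseteq> K" and t: "t \<ge> 0" and C: "C \<ge> 0"
    and w: "\<And>\<tau>. \<tau> \<in> K \<Longrightarrow> w \<tau> \<ge> 0"
    and R: "\<And>\<sigma> g. \<sigma> \<in> B \<Longrightarrow> (\<Sum>i<m. g i * u \<sigma> i)\<^sup>2 \<le> C * (\<Sum>\<tau>\<in>K. w \<tau> * (\<Sum>i<m. g i * u \<tau> i)\<^sup>2)"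
  shows "det (gram m u K (\<lambda>\<tau>. w \<tau> + (if \<tau> \<in> B then t else 0))) \<le> (1 + t * C) ^ card B * det (gram m u K w)"
  using B R
proof (induction B rule: finite_induct)
  case (insert \<sigma> B)
  let ?w = "\<lambda>\<tau>. w \<tau> + (if \<tau> \<in> B then t else 0)"
  have IH: "det (gram m u K ?w) \<le> (1 + t * C) ^ card B * det (gram m u K w)"
    using insert.prems by (intro insert.IH) auto
  have eq: "(\<lambda>\<tau>. w \<tau> + (if \<tau> \<in> insert \<sigma> B then t else 0)) = ?w(\<sigma> := ?w \<sigma> + t)"
    using insert.hyps by auto
  have "det (gram m u K (?w(\<sigma> := ?w \<sigma> + t))) \<le> (1 + t * C) * det (gram m u K ?w)"
  proof (rule det_gram_add_weight_le[OF K _ _ t C])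
    show "\<sigma> \<in> K" using insert.prems by auto
    show "?w \<tau> \<ge> 0" if "\<tau> \<in> K" for \<tau> using w[OF that] t by auto
    fix g
    have "(\<Sum>\<tau>\<in>K. w \<tau> * (\<Sum>i<m. g i * u \<tau> i)\<^sup>2) \<le> (\<Sum>\<tau>\<in>K. ?w \<tau> * (\<Sum>i<m. g i * u \<tau> i)\<^sup>2)"
      using t by (intro sum_mono mult_right_mono) auto
    then have "C * (\<Sum>\<tau>\<in>K. w \<tau> * (\<Sum>i<m. g i * u \<tau> i)\<^sup>2) \<le> C * (\<Sum>\<tau>\<in>K. ?w \<tau> * (\<Sum>i<m. g i * u \<tau> i)\<^sup>2)"
      using C by (rule mult_left_mono)
    moreover have "(\<Sum>i<m. g i * u \<sigma> i)\<^sup>2 \<le> C * (\<Sum>\<tau>\<in>K. w \<tau> * (\<Sum>i<m. g i * u \<tau> i)\<^sup>2)"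
      by (rule insert.prems(2)) simp
    ultimately show "(\<Sum>i<m. g i * u \<sigma> i)\<^sup>2 \<le> C * (\<Sum>\<tau>\<in>K. ?w \<tau> * (\<Sum>i<m. g i * u \<tau> i)\<^sup>2)" by linarith
  qed
  also have "\<dots> \<le> (1 + t * C) * ((1 + t * C) ^ card B * det (gram m u K w))"
    using IH t C by (intro mult_left_mono) auto
  finally show ?case unfolding eq card_insert_disjoint[OF insert.hyps(1,2)] by (simp only: power_Suc mult.assoc)
qed simp

section \<open>Real 1-cochains, their coboundaries and their energy\<close>

text \<open>g stands for a real 1-cochain that vanishes on the edges at n; this is its coboundary on
  \<tau>.\<close>

definition pairing :: "nat \<Rightarrow> (nat \<Rightarrow> real) \<Rightarrow> nat set \<Rightarrow> real" where
  "pairing n g \<tau> = (\<Sum>i<(n - 1) choose 2. g i * real_of_int (incidence \<tau> (edge_at n i)))"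

definition edge_value :: "nat \<Rightarrow> (nat \<Rightarrow> real) \<Rightarrow> nat set \<Rightarrow> real" where
  "edge_value n g e = (\<Sum>i<(n - 1) choose 2. g i * (if e = edge_at n i then 1 else 0))"

text \<open>Antisymmetric extension to ordered pairs, so that triangles can be treated without
  sorting their vertices.\<close>

definition arc_value :: "nat \<Rightarrow> (nat \<Rightarrow> real) \<Rightarrow> nat \<Rightarrow> nat \<Rightarrow> real" where
  "arc_value n g a b = (if a < b then edge_value n g {a, b} else if b < a then - edge_value n g {a, b} else 0)"

definition curl :: "nat \<Rightarrow> (nat \<Rightarrow> real) \<Rightarrow> nat \<Rightarrow> nat \<Rightarrow> nat \<Rightarrow> real" where
  "curl n g a b c = arc_value n g b c - arc_value n g a c + arc_value n g a b"

lemma arc_value_swap: "arc_value n g b a = - arc_value n g a b"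
  by (auto simp: arc_value_def insert_commute)

lemma edge_at_in: "i < (n - 1) choose 2 \<Longrightarrow> edge_at n i \<in> free_edges n"
  by (meson bij_betwE bij_betw_edge_at lessThan_iff)

lemma arc_value_root [simp]: "arc_value n g a n = 0" "arc_value n g n a = 0"
proof -
  have "edge_value n g {a, n} = 0" for a
  proof -
    have "n \<notin> edge_at n i" if "i < (n - 1) choose 2" for i
      using edge_at_in[OF that] by (auto simp: free_edges_def)
    then have "{a, n} \<noteq> edge_at n i" if "i < (n - 1) choose 2" for i using that by blast
    then show ?thesis by (simp add: edge_value_def)
  qed
  then show "arc_value n g a n = 0" by (simp add: arc_value_def)
  then show "arc_value n g n a = 0" by (simp add: arc_value_swap[of n g n a])
qed

lemma edge_value_edge_at:
  assumes "e \<in> free_edges n"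
  shows "edge_value n (\<lambda>i. v (edge_at n i)) e = v e"
proof -
  have "e \<in> edge_at n ` {..<(n - 1) choose 2}" using bij_betw_edge_at[of n] assms by (simp add: bij_betw_def)
  then obtain k where k: "k < (n - 1) choose 2" "edge_at n k = e" by blast
  have "edge_value n (\<lambda>i. v (edge_at n i)) e = (\<Sum>i<(n - 1) choose 2. if i = k then v e else 0)"
    unfolding edge_value_def
    using k bij_betw_edge_at[of n] by (intro sum.cong) (auto simp: bij_betw_def inj_on_def)
  then show ?thesis using k by simp
qed

lemma pairing_sorted:
  assumes "a < b" "b < c"
  shows "pairing n g {a, b, c} = curl n g a b c"
proof -
  have inc: "incidence {a, b, c} e = (if {b, c} = e then 1 else 0) - (if {a, c} = e then 1 else 0) + (if {a, b} = e then 1 else 0)" for e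
    by (simp add: incidence_def simplex_boundary_triangle[OF assms] lookup_add lookup_minus)
  have "pairing n g {a, b, c} = edge_value n g {b, c} - edge_value n g {a, c} + edge_value n g {a, b}"
    unfolding pairing_def edge_value_def sum.distrib[symmetric] sum_subtractf[symmetric]
    by (intro sum.cong refl) (simp add: inc)
  then show ?thesis using assms by (simp add: curl_def arc_value_def)
qed

lemma curl_swap: "curl n g b a c = - curl n g a b c" "curl n g a c b = - curl n g a b c"
  using arc_value_swap[of n g a b] arc_value_swap[of n g b c] by (simp_all add: curl_def)

text \<open>Reordering the vertices changes the coboundary only by a sign, which squaring
  removes.\<close>

lemma pairing_square:
  assumes "a \<noteq> b" "b \<noteq> c" "a \<noteq> c"
  shows "(pairing n g {a, b, c})\<^sup>2 = (curl n g a b c)\<^sup>2"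
proof -
  have *: "(pairing n g {a, b, c})\<^sup>2 = (curl n g a b c)\<^sup>2" if "a < b" "a \<noteq> c" "b \<noteq> c" for a b c
  proof -
    have "b < c \<or> a < c \<and> c < b \<or> c < a" using that by linarith
    then consider "b < c" | "a < c" "c < b" | "c < a" by blast
    then show ?thesis
    proof cases
      case 1 then show ?thesis using that by (simp add: pairing_sorted)
    next
      case 2
      then show ?thesis using pairing_sorted[of a c b n g] curl_swap(2)[of n g a c b]
        by (simp add: insert_commute)
    next
      case 3
      then show ?thesis using that pairing_sorted[of c a b n g] curl_swap[of n g a c b] curl_swap[of n g a b c]
        by (simp add: insert_commute)
    qed
  qed
  show ?thesis
  proof (cases "a < b")
    case False
    then show ?thesis using *[of b a c] assms curl_swap(1)[of n g a b c] by (simp add: insert_commute)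
  qed (use * assms in simp)
qed

definition energy :: "nat \<Rightarrow> (nat set \<Rightarrow> real) \<Rightarrow> (nat \<Rightarrow> real) \<Rightarrow> real" where
  "energy n w g = (\<Sum>\<tau>\<in>triangles n. w \<tau> * (pairing n g \<tau>)\<^sup>2)"

lemma sum_pairing_le_energy:
  assumes w: "\<And>\<tau>. w \<tau> \<ge> 0" and f: "inj_on f Y" "\<And>y. y \<in> Y \<Longrightarrow> f y \<in> triangles n \<and> w (f y) \<ge> (1::real)"
  shows "(\<Sum>y\<in>Y. (pairing n g (f y))\<^sup>2) \<le> energy n w g"
proof -
  have "(\<Sum>y\<in>Y. (pairing n g (f y))\<^sup>2) \<le> (\<Sum>y\<in>Y. w (f y) * (pairing n g (f y))\<^sup>2)"
  proof (rule sum_mono)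
    fix y assume "y \<in> Y"
    then have "1 * (pairing n g (f y))\<^sup>2 \<le> w (f y) * (pairing n g (f y))\<^sup>2"
      using f(2) by (intro mult_right_mono) auto
    then show "(pairing n g (f y))\<^sup>2 \<le> w (f y) * (pairing n g (f y))\<^sup>2" by simp
  qed
  also have "\<dots> = (\<Sum>\<tau>\<in>f ` Y. w \<tau> * (pairing n g \<tau>)\<^sup>2)" using f(1) by (simp add: sum.reindex)
  also have "\<dots> \<le> energy n w g"
    unfolding energy_def using f(2) w by (intro sum_mono2) auto
  finally show ?thesis .
qed

lemma sum_curl_le_energy:
  assumes w: "\<And>\<tau>. w \<tau> \<ge> 0" and ab: "a \<noteq> b" "a \<notin> Y" "b \<notin> Y" "{a, b} \<union> Y \<subseteq> {1..n}"
    and wY: "\<And>y. y \<in> Y \<Longrightarrow> w {y, a, b} \<ge> 1"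
  shows "(\<Sum>y\<in>Y. (curl n g y a b)\<^sup>2) \<le> energy n w g"
proof -
  have "(\<Sum>y\<in>Y. (curl n g y a b)\<^sup>2) = (\<Sum>y\<in>Y. (pairing n g {y, a, b})\<^sup>2)"
    using ab by (intro sum.cong refl pairing_square[symmetric]) auto
  also have "\<dots> \<le> energy n w g"
  proof (rule sum_pairing_le_energy[OF w])
    show "inj_on (\<lambda>y. {y, a, b}) Y" using ab by (auto simp: inj_on_def insert_eq_iff)
    show "{y, a, b} \<in> triangles n \<and> w {y, a, b} \<ge> 1" if "y \<in> Y" for y
      using ab wY that by (auto simp: triangles_def card_insert_if)
  qed
  finally show ?thesis .
qed

lemma square_sum3_le: "(x + y + z)\<^sup>2 \<le> 3 * (x\<^sup>2 + y\<^sup>2 + (z::real)\<^sup>2)"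
  using zero_le_power2[of "x - y"] zero_le_power2[of "x - z"] zero_le_power2[of "y - z"]
  by (simp add: power2_eq_square algebra_simps)

lemma square_sum4_le: "(x + y + z + t)\<^sup>2 \<le> 4 * (x\<^sup>2 + y\<^sup>2 + z\<^sup>2 + (t::real)\<^sup>2)"
  using zero_le_power2[of "x - y"] zero_le_power2[of "x - z"] zero_le_power2[of "y - z"]
    zero_le_power2[of "x - t"] zero_le_power2[of "y - t"] zero_le_power2[of "z - t"]
  by (simp add: power2_eq_square algebra_simps)

text \<open>Replacing a triangle by the other three faces of a tetrahedron over it, averaged over the apex.\<close>

lemma curl_cone_bound:
  assumes w: "\<And>\<tau>. w \<tau> \<ge> 0" and abc: "a \<noteq> b" "b \<noteq> c" "a \<noteq> c" "{a, b, c} \<inter> Y = {}" "{a, b, c} \<union> Y \<subseteq> {1..n}"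
    and wY: "\<And>y. y \<in> Y \<Longrightarrow> w {y, b, c} \<ge> 1 \<and> w {y, a, c} \<ge> 1 \<and> w {y, a, b} \<ge> 1"
  shows "card Y * (curl n g a b c)\<^sup>2 \<le> 9 * energy n w g"
proof -
  have "card Y * (curl n g a b c)\<^sup>2 = (\<Sum>y\<in>Y. (curl n g a b c)\<^sup>2)" by simp
  also have "\<dots> \<le> (\<Sum>y\<in>Y. 3 * ((curl n g y b c)\<^sup>2 + (curl n g y a c)\<^sup>2 + (curl n g y a b)\<^sup>2))"
  proof (rule sum_mono)
    fix y
    have "curl n g a b c = curl n g y b c + (- curl n g y a c) + curl n g y a b" by (simp add: curl_def)
    then show "(curl n g a b c)\<^sup>2 \<le> 3 * ((curl n g y b c)\<^sup>2 + (curl n g y a c)\<^sup>2 + (curl n g y a b)\<^sup>2)"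
      using square_sum3_le[of "curl n g y b c" "- curl n g y a c" "curl n g y a b"] by simp
  qed
  also have "\<dots> = 3 * ((\<Sum>y\<in>Y. (curl n g y b c)\<^sup>2) + (\<Sum>y\<in>Y. (curl n g y a c)\<^sup>2) + (\<Sum>y\<in>Y. (curl n g y a b)\<^sup>2))"
    by (simp add: sum_distrib_left[symmetric] sum.distrib)
  also have "\<dots> \<le> 3 * (energy n w g + energy n w g + energy n w g)"
    using abc wY by (intro mult_left_mono add_mono sum_curl_le_energy w) auto
  finally show ?thesis by simp
qed

text \<open>The quadrilateral a, x, b, n is filled by its cone from y, and the arcs at n vanish. No
  triangle used contains both a and b, so the bound survives when the triangles on that edge have
  weight 0.\<close>

lemma arc_difference_bound:
  assumes w: "\<And>\<tau>. w \<tau> \<ge> 0" and ab: "a \<noteq> b" "x \<noteq> a" "x \<noteq> b" "{a, b, x, n} \<inter> Y = {}" "{a, b, x} \<union> Y \<subseteq> {1..n}"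
    and an: "a \<noteq> n" "b \<noteq> n"
    and wY: "\<And>y. y \<in> Y \<Longrightarrow> w {y, b, x} \<ge> 1 \<and> w {y, a, x} \<ge> 1 \<and> w {y, b, n} \<ge> 1 \<and> w {y, a, n} \<ge> 1"
  shows "card Y * (arc_value n g b x - arc_value n g a x)\<^sup>2 \<le> 16 * energy n w g"
proof -
  let ?h = "arc_value n g b x - arc_value n g a x"
  have n: "n \<in> {1..n}" using ab by auto
  have "card Y * ?h\<^sup>2 = (\<Sum>y\<in>Y. ?h\<^sup>2)" by simp
  also have "\<dots> \<le> (\<Sum>y\<in>Y. 4 * ((curl n g y b x)\<^sup>2 + (curl n g y a x)\<^sup>2 + (curl n g y b n)\<^sup>2 + (curl n g y a n)\<^sup>2))"
  proof (rule sum_mono)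
    fix y
    have "?h = curl n g y b x + (- curl n g y a x) + (- curl n g y b n) + curl n g y a n"
      by (simp add: curl_def)
    then show "?h\<^sup>2 \<le> 4 * ((curl n g y b x)\<^sup>2 + (curl n g y a x)\<^sup>2 + (curl n g y b n)\<^sup>2 + (curl n g y a n)\<^sup>2)"
      using square_sum4_le[of "curl n g y b x" "- curl n g y a x" "- curl n g y b n" "curl n g y a n"] by simp
  qed
  also have "\<dots> = 4 * ((\<Sum>y\<in>Y. (curl n g y b x)\<^sup>2) + (\<Sum>y\<in>Y. (curl n g y a x)\<^sup>2)
      + (\<Sum>y\<in>Y. (curl n g y b n)\<^sup>2) + (\<Sum>y\<in>Y. (curl n g y a n)\<^sup>2))"
    by (simp add: sum_distrib_left[symmetric] sum.distrib)
  also have "\<dots> \<le> 4 * (energy n w g + energy n w g + energy n w g + energy n w g)"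
    using ab wY an n by (intro mult_left_mono add_mono sum_curl_le_energy w) auto
  finally show ?thesis by simp
qed

section \<open>Pentagons and Moebius strips\<close>

definition total_weight :: "nat \<Rightarrow> real" where
  "total_weight n = det (tri_gram n (triangles n) (\<lambda>_. 1))"

lemma det_tri_gram_Cauchy_Binet:
  "det (tri_gram n (triangles n) w) =
    (\<Sum>S | S \<subseteq> triangles n \<and> card S = (n - 1) choose 2. (\<Prod>\<tau>\<in>S. w \<tau>) * tree_weight n S)"
  unfolding tri_gram_def tree_weight_def by (rule det_gram_Cauchy_Binet) simp

lemma finite_triangle_sets [simp]:
  "finite {S. S \<subseteq> triangles n \<and> P S}"
  by (rule finite_subset[of _ "Pow (triangles n)"]) auto

lemma tree_weight_nonneg:
  "S \<subseteq> triangles n \<Longrightarrow> card S = (n - 1) choose 2 \<Longrightarrow> tree_weight n S \<ge> 0"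
  unfolding tri_gram_def tree_weight_def
  by (rule det_gram_unit_nonneg) (auto intro: finite_subset[OF _ finite_triangles])

lemma total_weight_eq:
  "total_weight n = (\<Sum>S | S \<subseteq> triangles n \<and> card S = (n - 1) choose 2. tree_weight n S)"
  unfolding total_weight_def det_tri_gram_Cauchy_Binet by simp

lemma tri_gram_add_weights_le:
  assumes "B \<subseteq> triangles n" "t \<ge> 0" "C \<ge> 0" "\<And>\<tau>. w \<tau> \<ge> 0"
    and "\<And>\<sigma> g. \<sigma> \<in> B \<Longrightarrow> (pairing n g \<sigma>)\<^sup>2 \<le> C * energy n w g"
  shows "det (tri_gram n (triangles n) (\<lambda>\<tau>. w \<tau> + (if \<tau> \<in> B then t else 0)))
    \<le> (1 + t * C) ^ card B * det (tri_gram n (triangles n) w)"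
  unfolding tri_gram_def
  by (rule det_gram_add_weights_le)
    (use assms finite_subset[OF assms(1)] in \<open>auto simp: pairing_def energy_def\<close>)

text \<open>All n - 3 remaining vertices serve as apex, and n - 3 \<ge> n / 2 turns the 9 of
  \<open>curl_cone_bound\<close> into 18.\<close>

lemma pairing_square_le_energy:
  assumes n: "n \<ge> 6" and \<tau>: "\<tau> \<in> triangles n"
  shows "(pairing n g \<tau>)\<^sup>2 \<le> 18 / n * energy n (\<lambda>_. 1) g"
proof -
  from \<tau> have c: "card \<tau> = 3" and sub: "\<tau> \<subseteq> {1..n}" by (auto simp: triangles_def)
  from c obtain a b d where abd: "a < b" "b < d" "\<tau> = {a, b, d}" by (rule card_3_sorted_obtain)
  let ?Y = "{1..n} - \<tau>"
  have "card ?Y = n - 3" using c sub by (simp add: card_Diff_subset finite_subset[OF sub])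
  moreover have "card ?Y * (curl n g a b d)\<^sup>2 \<le> 9 * energy n (\<lambda>_. 1) g"
    by (rule curl_cone_bound) (use abd sub in auto)
  ultimately have "(real n - 3) * (pairing n g \<tau>)\<^sup>2 \<le> 9 * energy n (\<lambda>_. 1) g"
    using n abd by (simp add: pairing_sorted of_nat_diff)
  moreover have "real n / 2 * (pairing n g \<tau>)\<^sup>2 \<le> (real n - 3) * (pairing n g \<tau>)\<^sup>2"
    using n by (intro mult_right_mono) auto
  ultimately have "real n * (pairing n g \<tau>)\<^sup>2 \<le> 18 * energy n (\<lambda>_. 1) g" by simp
  then show ?thesis using n by (simp add: field_simps)
qed

text \<open>With weight 1 + n on A, every S containing A gains a factor of at least n^|A|, while the
  determinant grows by at most 1 + n * (18 / n) = 19 per triangle.\<close>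

lemma tree_weight_superset_le:
  assumes n: "n \<ge> 6" and A: "A \<subseteq> triangles n"
  shows "(\<Sum>S | S \<subseteq> triangles n \<and> card S = (n - 1) choose 2 \<and> A \<subseteq> S. tree_weight n S)
    \<le> (19 / n) ^ card A * total_weight n"
proof -
  let ?w = "\<lambda>\<tau>. 1 + (if \<tau> \<in> A then real n else 0)"
  let ?S = "{S. S \<subseteq> triangles n \<and> card S = (n - 1) choose 2}"
  have fA: "finite A" using A finite_subset finite_triangles by blast
  have "det (tri_gram n (triangles n) ?w) \<le> (1 + real n * (18 / n)) ^ card A * total_weight n"
    unfolding total_weight_def
    by (rule tri_gram_add_weights_le[OF A, of "real n" "18 / n" "\<lambda>_. 1"])
      (use pairing_square_le_energy[OF n] A in auto)
  also have "1 + real n * (18 / n) = 19" using n by simp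
  finally have up: "det (tri_gram n (triangles n) ?w) \<le> 19 ^ card A * total_weight n" .
  have "real n ^ card A * (\<Sum>S | S \<subseteq> triangles n \<and> card S = (n - 1) choose 2 \<and> A \<subseteq> S. tree_weight n S)
      = (\<Sum>S | S \<subseteq> triangles n \<and> card S = (n - 1) choose 2 \<and> A \<subseteq> S. real n ^ card A * tree_weight n S)"
    by (rule sum_distrib_left)
  also have "\<dots> \<le> (\<Sum>S | S \<subseteq> triangles n \<and> card S = (n - 1) choose 2 \<and> A \<subseteq> S. (\<Prod>\<tau>\<in>S. ?w \<tau>) * tree_weight n S)"
  proof (rule sum_mono)
    fix S assume S: "S \<in> {S. S \<subseteq> triangles n \<and> card S = (n - 1) choose 2 \<and> A \<subseteq> S}"
    then have fS: "finite S" using finite_subset finite_triangles by blast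
    have "real n ^ card A = (\<Prod>\<tau>\<in>A. real n)" by simp
    also have "\<dots> \<le> (\<Prod>\<tau>\<in>A. ?w \<tau>)" by (intro prod_mono) auto
    also have "\<dots> \<le> (\<Prod>\<tau>\<in>S. ?w \<tau>)" using S fS by (intro prod_mono2) auto
    finally show "real n ^ card A * tree_weight n S \<le> (\<Prod>\<tau>\<in>S. ?w \<tau>) * tree_weight n S"
      using S tree_weight_nonneg by (intro mult_right_mono) auto
  qed
  also have "\<dots> \<le> det (tri_gram n (triangles n) ?w)"
    unfolding det_tri_gram_Cauchy_Binet
    by (rule sum_mono2) (auto intro!: mult_nonneg_nonneg prod_nonneg tree_weight_nonneg)
  finally have "real n ^ card A * (\<Sum>S | S \<subseteq> triangles n \<and> card S = (n - 1) choose 2 \<and> A \<subseteq> S. tree_weight n S)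
      \<le> 19 ^ card A * total_weight n" using up by linarith
  then show ?thesis using n by (simp add: power_divide field_simps)
qed

section \<open>Incidences of core edges, diagonals and strip triangles\<close>

lemma mod5_in: "i mod 5 \<in> {0, 1, 2, 3, 4::nat}"
proof -
  have "k \<in> {0, 1, 2, 3, 4}" if "k < 5" for k :: nat using that by (simp, arith)
  then show ?thesis by simp
qed

lemma mod5_shift: "(i + 1) mod 5 = (i mod 5 + 1) mod (5::nat)" "(i + 2) mod 5 = (i mod 5 + 2) mod (5::nat)"
  by (simp_all only: mod_add_left_eq)

text \<open>The vertices are indexed periodically by all naturals, so neighbours need no
  wrap-around. Keeping them away from n makes the core edges free edges.\<close>

locale pentagon =
  fixes n :: nat and p :: "nat \<Rightarrow> nat"
  assumes n16: "n \<ge> 16"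
    and p_range: "p i \<in> {1..<n}"
    and p_eq_iff: "p i = p j \<longleftrightarrow> i mod 5 = j mod 5"
begin

definition core :: "nat set set" where "core = range (\<lambda>i. {p i, p (i + 1)})"

text \<open>The five-vertex Moebius strip: its interior edges are the core edges, its boundary edges
  the diagonals \<open>{p i, p (i + 2)}\<close>.\<close>

definition strip :: "nat set set" where "strip = range (\<lambda>i. {p i, p (i + 1), p (i + 2)})"

text \<open>The forbidden triangles: if S misses them, a core edge lies only in strip
  triangles.\<close>

definition others :: "nat set set" where
  "others = {\<tau> \<in> triangles n. \<exists>e\<in>core. e \<subseteq> \<tau>} - strip"

text \<open>Weight 0 deletes every S that meets \<open>others\<close> from the Cauchy-Binet sum;
  weight n makes the strip stiff enough to control the core edges.\<close>

definition strip_weight :: "nat set \<Rightarrow> real" where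
  "strip_weight \<tau> = (if \<tau> \<in> strip then n else if \<tau> \<in> others then 0 else 1)"

lemma p_periodic: "p (i + 5) = p i" "p (i + 5 + 1) = p (i + 1)" "p (i + 5 + 2) = p (i + 2)"
  by (simp_all only: p_eq_iff add.assoc add.commute[of 5] mod_add_self2 add.left_commute[of _ 5])
    (simp_all only: add.assoc[symmetric] mod_add_self2)

lemma p_neq: "p i \<noteq> p (i + 1)" "p i \<noteq> p (i + 2)" "p (i + 1) \<noteq> p (i + 2)"
  unfolding p_eq_iff mod5_shift[of i] using mod5_in[of i] by auto

lemma p_neq_root: "p i \<noteq> n" using p_range[of i] by auto

lemma range_mod5: "range f = f ` {..<5}" if "\<And>i. f (i + 5) = f i" for f :: "nat \<Rightarrow> 'b"
proof -
  have "f i = f (i mod 5)" for i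
  proof (induction i rule: less_induct)
    case (less i)
    show ?case
    proof (cases "i < 5")
      case False
      then have "f i = f (i - 5)" using that[of "i - 5"] by simp
      also have "\<dots> = f ((i - 5) mod 5)" by (rule less) (use False in simp)
      also have "(i - 5) mod 5 = i mod 5" using False by (simp add: le_mod_geq)
      finally show ?thesis .
    qed simp
  qed
  note * = this
  show ?thesis
  proof (intro equalityI subsetI)
    fix x assume "x \<in> range f"
    then obtain i where "x = f i" by blast
    then show "x \<in> f ` {..<5}" using *[of i] by (intro image_eqI[of _ _ "i mod 5"]) auto
  qed auto
qed

lemma core_finite: "core = (\<lambda>i. {p i, p (i + 1)}) ` {..<5}"
  unfolding core_def by (intro range_mod5) (simp only: p_periodic)

lemma strip_finite: "strip = (\<lambda>i. {p i, p (i + 1), p (i + 2)}) ` {..<5}"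
  unfolding strip_def by (intro range_mod5) (simp only: p_periodic)

lemma strip_triangles: "strip \<subseteq> triangles n"
proof -
  have "{p i, p (i + 1), p (i + 2)} \<in> triangles n" for i
    using p_neq[of i] p_range[of i] p_range[of "i + 1"] p_range[of "i + 2"]
    by (simp add: triangles_def)
  then show ?thesis unfolding strip_def by blast
qed

lemma card_strip_le: "card strip \<le> 5"
  unfolding strip_finite by (rule order_trans[OF card_image_le]) simp_all

lemma core_in_strip_iff: "{p j, p (j + 1)} \<subseteq> {p i, p (i + 1), p (i + 2)} \<longleftrightarrow> j mod 5 = i mod 5 \<or> j mod 5 = (i + 1) mod 5"
proof -
  have "{p j, p (j + 1)} \<subseteq> {p i, p (i + 1), p (i + 2)} \<longleftrightarrow>
    (j mod 5 = i mod 5 \<or> j mod 5 = (i + 1) mod 5 \<or> j mod 5 = (i + 2) mod 5) \<and>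
    ((j + 1) mod 5 = i mod 5 \<or> (j + 1) mod 5 = (i + 1) mod 5 \<or> (j + 1) mod 5 = (i + 2) mod 5)"
    by (simp only: insert_subset insert_iff empty_iff empty_subsetI p_eq_iff simp_thms)
  also have "\<dots> \<longleftrightarrow> j mod 5 = i mod 5 \<or> j mod 5 = (i + 1) mod 5"
    unfolding mod5_shift[of i] mod5_shift[of j] using mod5_in[of i] mod5_in[of j] by (elim insertE emptyE) simp_all
  finally show ?thesis .
qed

lemma core_free: "core \<subseteq> free_edges n"
proof -
  have "{p i, p (i + 1)} \<in> free_edges n" for i
    using p_neq(1)[of i] p_range[of i] p_range[of "i + 1"] by (auto simp: free_edges_def)
  then show ?thesis unfolding core_def by blast
qed

lemma diagonal_not_core: "{p i, p (i + 2)} \<notin> core"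
proof
  assume "{p i, p (i + 2)} \<in> core"
  then obtain j where "{p i, p (i + 2)} = {p j, p (j + 1)}" by (auto simp: core_def)
  then have "i mod 5 = j mod 5 \<and> (i + 2) mod 5 = (j + 1) mod 5 \<or> i mod 5 = (j + 1) mod 5 \<and> (i + 2) mod 5 = j mod 5"
    unfolding doubleton_eq_iff p_eq_iff .
  then show False
    unfolding mod5_shift[of i] mod5_shift[of j] using mod5_in[of i] mod5_in[of j] by (elim insertE emptyE) simp_all
qed

text \<open>A core edge has two distinct ends on the pentagon. This and \<open>no_core_pair\<close>
  certify weight at least 1 for the triangles of the cones below.\<close>

lemma no_core_single:
  assumes "x \<notin> range p" "y \<notin> range p"
  shows "{x, z, y} \<notin> others"
proof -
  have "\<not> e \<subseteq> {x, z, y}" if e: "e \<in> core" for e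
  proof
    assume sub: "e \<subseteq> {x, z, y}"
    obtain i where i: "e = {p i, p (i + 1)}" using e unfolding core_def by (rule rangeE)
    have "p i \<in> range p" "p (i + 1) \<in> range p" by simp_all
    then have "p i = z" "p (i + 1) = z" using sub assms unfolding i by auto
    then show False using p_neq(1)[of i] by simp
  qed
  then show ?thesis by (auto simp: others_def)
qed

lemma no_core_pair:
  assumes "x \<notin> range p" "{y, z} \<notin> core" "y \<noteq> z"
  shows "{x, y, z} \<notin> others"
proof -
  have "\<not> e \<subseteq> {x, y, z}" if e: "e \<in> core" for e
  proof
    assume sub: "e \<subseteq> {x, y, z}"
    obtain i where i: "e = {p i, p (i + 1)}" using e unfolding core_def by (rule rangeE)
    have "{p i, p (i + 1)} = {y, z}" using sub assms(1) p_neq(1)[of i] unfolding i by auto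
    then show False using assms(2) e i by simp
  qed
  then show ?thesis by (auto simp: others_def)
qed

end

lemma square_sum5_le: "(a + b + c + d + e)\<^sup>2 \<le> 5 * (a\<^sup>2 + b\<^sup>2 + c\<^sup>2 + d\<^sup>2 + (e::real)\<^sup>2)"
  using zero_le_power2[of "a - b"] zero_le_power2[of "a - c"] zero_le_power2[of "a - d"] zero_le_power2[of "a - e"]
    zero_le_power2[of "b - c"] zero_le_power2[of "b - d"] zero_le_power2[of "b - e"] zero_le_power2[of "c - d"]
    zero_le_power2[of "c - e"] zero_le_power2[of "d - e"]
  by (simp add: power2_eq_square algebra_simps)

lemma square_sum2_le: "(a + b)\<^sup>2 \<le> 2 * (a\<^sup>2 + (b::real)\<^sup>2)"
  using zero_le_power2[of "a - b"] by (simp add: power2_eq_square algebra_simps)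

section \<open>Resistances of the forbidden triangles under the strip weights\<close>

context pentagon
begin

abbreviation (input) "E \<equiv> energy n strip_weight"

lemma strip_weight_nonneg: "strip_weight \<tau> \<ge> 0"
  by (simp add: strip_weight_def)

lemma strip_weight_ge_1: "\<tau> \<notin> others \<Longrightarrow> strip_weight \<tau> \<ge> 1"
  using n16 by (simp add: strip_weight_def)

lemma energy_nonneg: "E g \<ge> 0"
  unfolding energy_def by (intro sum_nonneg mult_nonneg_nonneg strip_weight_nonneg) simp

lemma range_p: "range p = p ` {..<5}"
  by (rule range_mod5) (simp only: p_periodic)

text \<open>At most six of n - 1 vertices are excluded, and n - 7 \<ge> n / 2 because n \<ge>
  16.\<close>

lemma card_fresh: "real n / 2 \<le> real (card ({1..<n} - range p - {x}))"
proof -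
  have "card (range p) \<le> 5" unfolding range_p by (rule order_trans[OF card_image_le]) simp_all
  then have "card (insert x (range p)) \<le> 6" using card_insert_le_m1[of 6 "range p" x] by simp
  moreover have "card {1..<n} - card (insert x (range p)) \<le> card ({1..<n} - insert x (range p))"
    by (rule diff_card_le_card_Diff) (simp add: range_p)
  moreover have "{1..<n} - range p - {x} = {1..<n} - insert x (range p)" by auto
  ultimately have "n - 7 \<le> card ({1..<n} - range p - {x})" by simp
  then show ?thesis using n16 by linarith
qed

lemma root_fresh: "n \<notin> range p" using p_neq_root by auto

lemma scaled_bound:
  assumes "real (card ({1..<n} - range p - {x})) * q \<le> C * E g" "q \<ge> 0"
  shows "q \<le> 2 * C * E g / n"
proof -
  have "real n / 2 * q \<le> C * E g"
    using mult_right_mono[OF card_fresh[of x] assms(2)] assms(1) by linarith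
  then show ?thesis using n16 by (simp add: field_simps)
qed

text \<open>The triangle on a diagonal and the root is coned from vertices off the pentagon; since a
  diagonal is no core edge, none of the side triangles is forbidden.\<close>

lemma curl_diagonal_bound: "(curl n g (p i) (p (i + 2)) n)\<^sup>2 \<le> 18 * E g / n"
proof -
  let ?Y = "{1..<n} - range p - {n}"
  have Y: "y \<notin> range p" if "y \<in> ?Y" for y using that by blast
  have "card ?Y * (curl n g (p i) (p (i + 2)) n)\<^sup>2 \<le> 9 * E g"
  proof (rule curl_cone_bound[OF strip_weight_nonneg])
    show "p i \<noteq> p (i + 2)" "p (i + 2) \<noteq> n" "p i \<noteq> n" using p_neq p_neq_root by auto
    show "{p i, p (i + 2), n} \<inter> ?Y = {}" by auto
    show "{p i, p (i + 2), n} \<union> ?Y \<subseteq> {1..n}"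
      using p_range[of i] p_range[of "i + 2"] n16 by auto
    fix y assume "y \<in> ?Y"
    then show "strip_weight {y, p (i + 2), n} \<ge> 1 \<and> strip_weight {y, p i, n} \<ge> 1 \<and> strip_weight {y, p i, p (i + 2)} \<ge> 1"
      by (intro conjI strip_weight_ge_1 no_core_single[OF Y root_fresh]
          no_core_pair[OF Y diagonal_not_core p_neq(2)])
  qed
  from scaled_bound[OF this] show ?thesis by simp
qed

lemma curl_strip_bound: "(curl n g (p i) (p (i + 1)) (p (i + 2)))\<^sup>2 \<le> E g / n"
proof -
  let ?t = "{p i, p (i + 1), p (i + 2)}"
  have t: "?t \<in> strip" "?t \<in> triangles n" using strip_triangles by (auto simp: strip_def)
  have "strip_weight ?t * (pairing n g ?t)\<^sup>2 \<le> E g"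
    unfolding energy_def using t(2) by (intro member_le_sum) (auto simp: strip_weight_nonneg)
  moreover have "(pairing n g ?t)\<^sup>2 = (curl n g (p i) (p (i + 1)) (p (i + 2)))\<^sup>2"
    by (rule pairing_square[OF p_neq(1,3,2)])
  ultimately show ?thesis using t(1) n16 by (simp add: strip_weight_def field_simps)
qed

text \<open>The diagonal cancels between the strip triangle and the triangle that joins it to n,
  whose arcs at n vanish. The constant is 2 * (1 + 18).\<close>

lemma core_arc_pair_bound:
  "(arc_value n g (p i) (p (i + 1)) + arc_value n g (p (i + 1)) (p (i + 2)))\<^sup>2 \<le> 38 * E g / n"
proof -
  have "arc_value n g (p i) (p (i + 1)) + arc_value n g (p (i + 1)) (p (i + 2)) =
      curl n g (p i) (p (i + 1)) (p (i + 2)) + curl n g (p i) (p (i + 2)) n"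
    by (simp add: curl_def)
  then have "(arc_value n g (p i) (p (i + 1)) + arc_value n g (p (i + 1)) (p (i + 2)))\<^sup>2 \<le>
      2 * (E g / n + 18 * E g / n)"
    using square_sum2_le[of "curl n g (p i) (p (i + 1)) (p (i + 2))" "curl n g (p i) (p (i + 2)) n"]
      curl_strip_bound[of g i] curl_diagonal_bound[of g i] by simp
  then show ?thesis by (simp add: field_simps)
qed

text \<open>The pentagon is an odd cycle, so an edge value is half the alternating sum of the values
  of consecutive edge pairs.\<close>

lemma core_arc_bound: "(arc_value n g (p i) (p (i + 1)))\<^sup>2 \<le> 238 * E g / n"
proof -
  define s where "s k = arc_value n g (p k) (p (k + 1)) + arc_value n g (p (k + 1)) (p (k + 2))" for k
  define G where "G k = arc_value n g (p k) (p (k + 1))" for k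
  have s: "(s k)\<^sup>2 \<le> 38 * E g / n" for k unfolding s_def by (rule core_arc_pair_bound)
  have "s i = G i + G (i + 1)" "s (i + 1) = G (i + 1) + G (i + 2)" "s (i + 2) = G (i + 2) + G (i + 3)"
    "s (i + 3) = G (i + 3) + G (i + 4)" "s (i + 4) = G (i + 4) + G (i + 5)"
    by (simp_all add: s_def G_def eval_nat_numeral)
  moreover have "G (i + 5) = G i" by (simp only: G_def p_periodic)
  ultimately have "2 * G i = s i + - s (i + 1) + s (i + 2) + - s (i + 3) + s (i + 4)" by simp
  then have "(2 * G i)\<^sup>2 \<le>
      5 * ((s i)\<^sup>2 + (s (i + 1))\<^sup>2 + (s (i + 2))\<^sup>2 + (s (i + 3))\<^sup>2 + (s (i + 4))\<^sup>2)"
    using square_sum5_le[of "s i" "- s (i + 1)" "s (i + 2)" "- s (i + 3)" "s (i + 4)"] by simp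
  also have "\<dots> \<le> 5 * (38 * E g / n + 38 * E g / n + 38 * E g / n + 38 * E g / n + 38 * E g / n)"
    using s by (intro mult_left_mono add_mono) auto
  \<comment> \<open>The constants are 5 * 5 * 38 = 950 and 950 / 4 < 238.\<close>
  finally have "4 * (G i)\<^sup>2 \<le> 950 * (E g / n)" by (simp add: power_mult_distrib)
  moreover have "0 \<le> E g / n" using energy_nonneg by simp
  ultimately have "(G i)\<^sup>2 \<le> 238 * E g / n" by simp
  then show ?thesis by (simp only: G_def)
qed

text \<open>A forbidden triangle is a core edge with a further vertex x. Its coboundary is the core
  arc plus the difference of the two arcs to x, and both have square of order E / n; the constants
  add up to 2 * (32 + 238) = 540.\<close>

lemma others_pairing_bound:
  assumes "\<tau> \<in> others"
  shows "(pairing n g \<tau>)\<^sup>2 \<le> 600 / n * E g"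
proof -
  obtain e where e: "e \<in> core" "e \<subseteq> \<tau>" and \<tau>: "\<tau> \<in> triangles n" "\<tau> \<notin> strip"
    using assms by (auto simp: others_def)
  obtain i where i: "e = {p i, p (i + 1)}" using e(1) unfolding core_def by (rule rangeE)
  have ne: "p i \<noteq> p (i + 1)" by (rule p_neq)
  have c3: "card \<tau> = 3" "\<tau> \<subseteq> {1..n}" using \<tau> by (auto simp: triangles_def)
  have "card (\<tau> - e) = 1" using c3 e(2) ne finite_subset[OF c3(2)] by (simp add: card_Diff_subset i)
  then obtain x where x: "\<tau> - e = {x}" by (rule card_1_singletonE)
  have t: "\<tau> = {p i, p (i + 1), x}" and x_ne: "x \<noteq> p i" "x \<noteq> p (i + 1)" and xn: "x \<in> {1..n}"
    using x e(2) c3(2) i by auto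
  let ?h = "arc_value n g (p (i + 1)) x - arc_value n g (p i) x"
  have h: "?h\<^sup>2 \<le> 32 * E g / n"
  proof (cases "x = n")
    case True
    then show ?thesis using energy_nonneg by simp
  next
    case False
    \<comment> \<open>A pentagon vertex x joined by a core edge to an end of e would make \<tau> a
      strip triangle. Hence no triangle of the cones below contains a core edge.\<close>
    have edges: "x \<notin> range p \<or> {p i, x} \<notin> core \<and> {p (i + 1), x} \<notin> core"
    proof (rule disjCI)
      assume "\<not> ({p i, x} \<notin> core \<and> {p (i + 1), x} \<notin> core)"
      then obtain j where j: "{p i, x} = {p j, p (j + 1)} \<or> {p (i + 1), x} = {p j, p (j + 1)}"
        unfolding core_def by blast
      show "x \<notin> range p"
      proof
        assume "x \<in> range p"
        then obtain k where k: "x = p k" by blast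
        have "{p i, p (i + 1), p k} \<in> strip"
        proof -
          have "k mod 5 = (i + 2) mod 5 \<or> (k + 1) mod 5 = i mod 5"
            using j x_ne unfolding k doubleton_eq_iff p_eq_iff mod5_shift[of i] mod5_shift[of j] mod5_shift[of k]
            using mod5_in[of i] mod5_in[of j] mod5_in[of k] by (elim insertE emptyE) simp_all
          then show ?thesis
          proof
            assume "k mod 5 = (i + 2) mod 5"
            then have "p k = p (i + 2)" by (simp only: p_eq_iff)
            then show ?thesis unfolding strip_def by auto
          next
            assume a: "(k + 1) mod 5 = i mod 5"
            then have "p i = p (k + 1)" by (simp only: p_eq_iff)
            moreover have "p (i + 1) = p (k + 2)"
              using a unfolding p_eq_iff mod5_shift[of i] mod5_shift[of k]
              using mod5_in[of i] mod5_in[of k] by (elim insertE emptyE) simp_all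
            ultimately have "{p i, p (i + 1), p k} = {p k, p (k + 1), p (k + 2)}" by auto
            then show ?thesis unfolding strip_def by (rule range_eqI)
          qed
        qed
        then show False using \<tau>(2) by (simp add: t k)
      qed
    qed
    let ?Y = "{1..<n} - range p - {x}"
    have Y: "y \<notin> range p" "y \<noteq> x" if "y \<in> ?Y" for y using that by blast+
    have "card ?Y * ?h\<^sup>2 \<le> 16 * E g"
    proof (rule arc_difference_bound[OF strip_weight_nonneg])
      show "p i \<noteq> p (i + 1)" "x \<noteq> p i" "x \<noteq> p (i + 1)" "p i \<noteq> n" "p (i + 1) \<noteq> n"
        using ne x_ne p_neq_root by auto
      show "{p i, p (i + 1), x, n} \<inter> ?Y = {}" by auto
      show "{p i, p (i + 1), x} \<union> ?Y \<subseteq> {1..n}" using xn p_range[of i] p_range[of "i + 1"] by auto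
      fix y assume y: "y \<in> ?Y"
      have "strip_weight {y, p (i + 1), n} \<ge> 1" "strip_weight {y, p i, n} \<ge> 1"
        by (intro strip_weight_ge_1 no_core_single[OF Y(1)[OF y] root_fresh])+
      moreover have "strip_weight {y, p (i + 1), x} \<ge> 1" "strip_weight {y, p i, x} \<ge> 1"
        using edges no_core_single[OF Y(1)[OF y], of x] no_core_pair[OF Y(1)[OF y] _ x_ne(1)[symmetric]]
          no_core_pair[OF Y(1)[OF y] _ x_ne(2)[symmetric]]
        by (blast intro: strip_weight_ge_1)+
      ultimately show "strip_weight {y, p (i + 1), x} \<ge> 1 \<and> strip_weight {y, p i, x} \<ge> 1 \<and>
          strip_weight {y, p (i + 1), n} \<ge> 1 \<and> strip_weight {y, p i, n} \<ge> 1" by simp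
    qed
    from scaled_bound[OF this] show ?thesis by simp
  qed
  have "(pairing n g \<tau>)\<^sup>2 = (curl n g (p i) (p (i + 1)) x)\<^sup>2"
    unfolding t using ne x_ne by (intro pairing_square) auto
  also have "curl n g (p i) (p (i + 1)) x = ?h + arc_value n g (p i) (p (i + 1))" by (simp add: curl_def)
  also have "\<dots>\<^sup>2 \<le> 2 * (?h\<^sup>2 + (arc_value n g (p i) (p (i + 1)))\<^sup>2)" by (rule square_sum2_le)
  also have "\<dots> \<le> 2 * (32 * E g / n + 238 * E g / n)"
    using h core_arc_bound[of g i] by (intro mult_left_mono add_mono) auto
  also have "\<dots> = 540 * (E g / n)" by simp
  also have "\<dots> \<le> 600 * (E g / n)" using energy_nonneg by (intro mult_right_mono) auto
  finally show ?thesis by simp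
qed

lemma card_others_le: "card others \<le> 5 * n"
proof -
  let ?F = "(\<lambda>(i, x). {p i, p (i + 1), x}) ` ({..<5} \<times> {1..n})"
  have "others \<subseteq> ?F"
  proof
    fix \<tau> assume "\<tau> \<in> others"
    then obtain e where e: "e \<in> core" "e \<subseteq> \<tau>" and \<tau>: "card \<tau> = 3" "\<tau> \<subseteq> {1..n}"
      by (auto simp: others_def triangles_def)
    obtain i where i: "i < 5" "e = {p i, p (i + 1)}" using e(1) unfolding core_finite by blast
    have "card (\<tau> - e) = 1" using \<tau> e(2) p_neq(1)[of i] finite_subset[OF \<tau>(2)] by (simp add: card_Diff_subset i)
    then obtain x where x: "\<tau> - e = {x}" by (rule card_1_singletonE)
    then have "\<tau> = {p i, p (i + 1), x}" "x \<in> {1..n}" using e(2) \<tau>(2) i by auto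
    then show "\<tau> \<in> ?F" using i(1) by (intro image_eqI[of _ _ "(i, x)"]) auto
  qed
  then have "card others \<le> card ?F" by (intro card_mono) auto
  also have "\<dots> \<le> card ({..<5::nat} \<times> {1..n})" by (rule card_image_le) simp
  finally show ?thesis by (simp add: card_cartesian_product)
qed

text \<open>The strip weights plus 1 on \<open>others\<close> dominate the unit weights. Removing
  that 1 costs a bounded factor in all, and what is left charges only the sets S that avoid
  \<open>others\<close>, each with a product of weights at most n^5.\<close>

lemma tree_weight_avoiding_ge:
  "exp (- 3000) / n ^ 5 * total_weight n \<le>
    (\<Sum>S | S \<subseteq> triangles n \<and> card S = (n - 1) choose 2 \<and> S \<inter> others = {}. tree_weight n S)"
proof -
  let ?w = "\<lambda>\<tau>. strip_weight \<tau> + (if \<tau> \<in> others then 1 else 0)"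
  let ?SS = "{S. S \<subseteq> triangles n \<and> card S = (n - 1) choose 2}"
  let ?A = "{S. S \<subseteq> triangles n \<and> card S = (n - 1) choose 2 \<and> S \<inter> others = {}}"
  have w1: "?w \<tau> \<ge> 1" for \<tau> using strip_weight_ge_1[of \<tau>] strip_weight_nonneg[of \<tau>] by auto
  have fS: "finite S" if "S \<subseteq> triangles n" for S using that finite_subset finite_triangles by blast
  have "total_weight n \<le> det (tri_gram n (triangles n) ?w)"
    unfolding total_weight_eq det_tri_gram_Cauchy_Binet
  proof (rule sum_mono)
    fix S assume S: "S \<in> ?SS"
    have "1 \<le> (\<Prod>\<tau>\<in>S. ?w \<tau>)" by (rule prod_ge_1) (rule w1)
    then have "1 * tree_weight n S \<le> (\<Prod>\<tau>\<in>S. ?w \<tau>) * tree_weight n S"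
      using S tree_weight_nonneg by (intro mult_right_mono) auto
    then show "tree_weight n S \<le> (\<Prod>\<tau>\<in>S. ?w \<tau>) * tree_weight n S" by simp
  qed
  also have "\<dots> \<le> (1 + 1 * (600 / n)) ^ card others * det (tri_gram n (triangles n) strip_weight)"
    by (rule tri_gram_add_weights_le)
      (use others_pairing_bound strip_weight_nonneg in \<open>auto simp: others_def\<close>)
  also have "det (tri_gram n (triangles n) strip_weight) \<le> n ^ 5 * (\<Sum>S\<in>?A. tree_weight n S)"
  proof -
    have "det (tri_gram n (triangles n) strip_weight) = (\<Sum>S\<in>?SS. (\<Prod>\<tau>\<in>S. strip_weight \<tau>) * tree_weight n S)"
      by (rule det_tri_gram_Cauchy_Binet)
    also have "\<dots> = (\<Sum>S\<in>?A. (\<Prod>\<tau>\<in>S. strip_weight \<tau>) * tree_weight n S)"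
    proof (rule sum.mono_neutral_right)
      show "\<forall>S\<in>?SS - ?A. (\<Prod>\<tau>\<in>S. strip_weight \<tau>) * tree_weight n S = 0"
      proof
        fix S assume S: "S \<in> ?SS - ?A"
        then obtain \<tau> where "\<tau> \<in> S" "\<tau> \<in> others" by blast
        then have "strip_weight \<tau> = 0" by (simp add: strip_weight_def others_def)
        then show "(\<Prod>\<tau>\<in>S. strip_weight \<tau>) * tree_weight n S = 0"
          using \<open>\<tau> \<in> S\<close> S fS by (auto intro!: prod_zero)
      qed
    qed auto
    also have "\<dots> \<le> (\<Sum>S\<in>?A. n ^ 5 * tree_weight n S)"
    proof (rule sum_mono)
      fix S assume S: "S \<in> ?A"
      have "(\<Prod>\<tau>\<in>S. strip_weight \<tau>) = (\<Prod>\<tau>\<in>S \<inter> strip. real n)"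
      proof -
        have "(\<Prod>\<tau>\<in>S \<inter> strip. real n) = (\<Prod>\<tau>\<in>S. if \<tau> \<in> strip then real n else 1)"
          using S fS by (subst prod.inter_restrict) auto
        also have "\<dots> = (\<Prod>\<tau>\<in>S. strip_weight \<tau>)"
          using S by (intro prod.cong) (auto simp: strip_weight_def)
        finally show ?thesis ..
      qed
      also have "\<dots> = real n ^ card (S \<inter> strip)" by simp
      also have "\<dots> \<le> real n ^ 5"
      proof (rule power_increasing)
        have "finite strip" by (simp add: strip_finite)
        then have "card (S \<inter> strip) \<le> card strip" by (intro card_mono) auto
        then show "card (S \<inter> strip) \<le> 5" using card_strip_le by linarith
      qed (use n16 in auto)
      finally show "(\<Prod>\<tau>\<in>S. strip_weight \<tau>) * tree_weight n S \<le> n ^ 5 * tree_weight n S"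
        using S tree_weight_nonneg by (intro mult_right_mono) auto
    qed
    also have "\<dots> = n ^ 5 * (\<Sum>S\<in>?A. tree_weight n S)" by (simp add: sum_distrib_left)
    finally show ?thesis .
  qed
  finally have Z: "total_weight n \<le> (1 + 1 * (600 / n)) ^ card others * (n ^ 5 * (\<Sum>S\<in>?A. tree_weight n S))"
    by (simp add: mult_left_mono)
  have "(1 + 1 * (600 / n)) ^ card others \<le> (1 + 600 / real n) ^ (5 * n)"
    using card_others_le by (simp add: power_increasing)
  \<comment> \<open>1 + x \<le> exp x, and 5n factors exp (600 / n) multiply to exp 3000.\<close>
  also have "\<dots> \<le> exp (600 / real n) ^ (5 * n)"
    by (intro power_mono) (auto simp: add_nonneg_nonneg)
  also have "\<dots> = exp 3000" using n16 by (simp add: exp_of_nat_mult[symmetric])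
  finally have *: "(1 + 1 * (600 / n)) ^ card others \<le> exp 3000" .
  have "0 \<le> real n ^ 5 * (\<Sum>S\<in>?A. tree_weight n S)"
    using tree_weight_nonneg by (intro mult_nonneg_nonneg sum_nonneg) auto
  then have "total_weight n \<le> exp 3000 * (n ^ 5 * (\<Sum>S\<in>?A. tree_weight n S))"
    using Z mult_right_mono[OF *] by fastforce
  then show ?thesis using n16 by (simp add: exp_minus field_simps)
qed

end

section \<open>The pentagon cocycle\<close>

lemma mod5_add_cancel:
  assumes "(a + k) mod 5 = (a + l) mod 5" "k < 5" "l < (5::nat)"
  shows "k = l"
proof -
  define r where "r = a mod 5"
  have "(r + k) mod 5 = (r + l) mod 5" using assms(1) by (simp add: r_def mod_add_left_eq)
  moreover have "r \<in> {0, 1, 2, 3, 4}" "k \<in> {0, 1, 2, 3, 4}" "l \<in> {0, 1, 2, 3, 4}"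
    using mod5_in[of a] mod5_in[of k] mod5_in[of l] assms(2,3) by (simp_all only: r_def mod_less)
  ultimately show ?thesis by (elim insertE emptyE) simp_all
qed

lemma real_choose_two: "real (k choose 2) = real k * (real k - 1) / 2"
proof -
  have "even (k * (k - 1))" by (cases k) auto
  then have "real (k choose 2) = real (k * (k - 1)) / 2"
    unfolding choose_two using real_of_nat_div[of 2 "k * (k - 1)"] by simp
  then show ?thesis by (cases k) (simp_all add: algebra_simps)
qed

context pentagon
begin

lemma core_inj: "{p a, p (a + 1)} = {p b, p (b + 1)} \<Longrightarrow> a mod 5 = b mod 5"
  unfolding doubleton_eq_iff p_eq_iff mod5_shift[of a] mod5_shift[of b]
  using mod5_in[of a] mod5_in[of b] by (elim insertE emptyE) simp_all

lemma p_cong: "a mod 5 = b mod 5 \<Longrightarrow> p (a + c) = p (b + c)"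
  unfolding p_eq_iff by (rule mod_add_cong) simp_all

lemma strip_cong: "a mod 5 = b mod 5 \<Longrightarrow> {p a, p (a + 1), p (a + 2)} = {p b, p (b + 1), p (b + 2)}"
  using p_cong[of a b 0] p_cong[of a b 1] p_cong[of a b 2] by simp

text \<open>If a strip triangle is missing, the strip unfolds to a disc and the core carries a
  nonzero real cocycle of \<open>S\<close>.\<close>

lemma strip_subset:
  assumes S: "S \<subseteq> triangles n" "S \<inter> others = {}" and tw: "tree_weight n S \<noteq> 0"
  shows "strip \<subseteq> S"
proof (rule ccontr)
  assume "\<not> strip \<subseteq> S"
  then obtain j where j: "{p j, p (j + 1), p (j + 2)} \<notin> S" unfolding strip_def by blast
  \<comment> \<open>Core edges are numbered from j + 1, so that the passage from k = 4 back to k =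
    0, where the signs fail to alternate, falls on the missing triangle.\<close>
  let ?e = "\<lambda>k. {p (j + 1 + k), p (j + 1 + k + 1)}"
  \<comment> \<open>Alternating values along the cycle; the second sign converts to the increasing
    orientation of each edge.\<close>
  define val :: "nat set \<Rightarrow> real" where "val e = (\<Sum>k<5. if e = ?e k then (-1) ^ k * (if p (j + 1 + k) < p (j + 1 + k + 1) then 1 else -1) else 0)"
    for e :: "nat set"
  define g :: "nat \<Rightarrow> real" where "g i = val (edge_at n i)" for i :: nat
  have inj: "?e k = ?e l \<longleftrightarrow> k = l" if "k < 5" "l < 5" for k l
    using core_inj[of "j + 1 + k" "j + 1 + l"] mod5_add_cancel[of "j + 1" k l] that by blast
  have val_core: "val (?e k) = (-1) ^ k * (if p (j + 1 + k) < p (j + 1 + k + 1) then 1 else -1)" if k: "k < 5" for k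
  proof -
    have "val (?e k) = (\<Sum>l<5. if l = k then (-1) ^ k * (if p (j + 1 + k) < p (j + 1 + k + 1) then 1 else -1) else 0)"
      unfolding val_def by (intro sum.cong refl) (use inj[OF k] in auto)
    then show ?thesis using k by simp
  qed
  have val_0: "val e = 0" if "e \<notin> core" for e
  proof -
    have "e \<noteq> ?e k" for k using that unfolding core_def by blast
    then show ?thesis by (simp add: val_def)
  qed
  have ev: "edge_value n g e = (if e \<in> free_edges n then val e else 0)" for e
  proof (cases "e \<in> free_edges n")
    case True
    then show ?thesis using edge_value_edge_at[OF True, of val] by (simp add: g_def[abs_def])
  next
    case False
    then have "e \<noteq> edge_at n i" if "i < (n - 1) choose 2" for i using edge_at_in[OF that] by blast
    then show ?thesis using False by (simp add: edge_value_def)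
  qed
  have ev_0: "edge_value n g e = 0" if "e \<notin> core" for e using val_0[OF that] ev by simp
  have ev_core: "edge_value n g (?e k) = val (?e k)" for k
  proof -
    have "?e k \<in> free_edges n" using core_free unfolding core_def by blast
    then show ?thesis by (simp only: ev if_True)
  qed
  have arc: "arc_value n g (p (j + 1 + k)) (p (j + 1 + k + 1)) = (-1) ^ k" if k: "k < 5" for k
    using ev_core[of k] val_core[OF k] p_neq(1)[of "j + 1 + k"] unfolding arc_value_def
    by (simp add: insert_commute)
  have arc_0: "arc_value n g a b = 0" if "{a, b} \<notin> core" for a b
    using ev_0[OF that] by (simp add: arc_value_def)
  have zero: "pairing n g \<tau> = 0" if \<tau>: "\<tau> \<in> S" for \<tau>
  proof (cases "\<tau> \<in> strip")
    case True
    then obtain i where i: "\<tau> = {p i, p (i + 1), p (i + 2)}" unfolding strip_def by (rule rangeE)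
    \<comment> \<open>The position counted from j + 1: adding 4 * (j + 1) subtracts j + 1 modulo
      5.\<close>
    define k where "k = (i + 4 * (j + 1)) mod 5"
    have "(j + 1 + k) mod 5 = (i + 5 * (j + 1)) mod 5"
      unfolding k_def mod_add_right_eq by (rule arg_cong[of _ _ "\<lambda>x. x mod 5"]) simp
    also have "\<dots> = i mod 5" by (rule mod_mult_self2)
    finally have k: "k < 5" "i mod 5 = (j + 1 + k) mod 5" by (simp_all add: k_def)
    have t: "\<tau> = {p (j + 1 + k), p (j + 1 + k + 1), p (j + 1 + k + 2)}"
      unfolding i by (rule strip_cong[OF k(2)])
    have "k \<noteq> 4"
    proof
      assume "k = 4"
      then have "i mod 5 = j mod 5" using k(2) by simp
      then show False using strip_cong[of i j] i j \<tau> by simp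
    qed
    then have k4: "k < 5" "k + 1 < 5" using k(1) by auto
    have "(pairing n g \<tau>)\<^sup>2 = (curl n g (p (j + 1 + k)) (p (j + 1 + k + 1)) (p (j + 1 + k + 2)))\<^sup>2"
      unfolding t by (rule pairing_square[OF p_neq(1,3,2)])
    \<comment> \<open>The two core arcs are (-1)^k and (-1)^(k + 1), and the diagonal has value
      0.\<close>
    also have "curl n g (p (j + 1 + k)) (p (j + 1 + k + 1)) (p (j + 1 + k + 2)) = 0"
      using arc[OF k4(1)] arc[OF k4(2)] arc_0[OF diagonal_not_core[of "j + 1 + k"]]
      by (simp add: curl_def eval_nat_numeral)
    finally show ?thesis by simp
  next
    case False
    have tt: "\<tau> \<in> triangles n" using \<tau> S(1) by blast
    then have no: "\<not> e \<subseteq> \<tau>" if "e \<in> core" for e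
      using False \<tau> S(2) that unfolding others_def by blast
    from tt have "card \<tau> = 3" by (simp add: triangles_def)
    then obtain a b c where abc: "a < b" "b < c" "\<tau> = {a, b, c}" by (rule card_3_sorted_obtain)
    have "{b, c} \<notin> core" "{a, c} \<notin> core" "{a, b} \<notin> core" using no abc(3) by blast+
    then show ?thesis using pairing_sorted[OF abc(1,2), of n g] by (simp add: abc(3) curl_def arc_0)
  qed
  have "?e 0 \<in> free_edges n" using core_free unfolding core_def by blast
  then have "?e 0 \<in> edge_at n ` {..<(n - 1) choose 2}" using bij_betw_edge_at[of n] by (simp add: bij_betw_def)
  then obtain i where i: "i < (n - 1) choose 2" "?e 0 = edge_at n i" by blast
  have "g i \<noteq> 0" using val_core[of 0] i(2) by (simp add: g_def split: if_splits)
  then have "tree_weight n S = 0"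
    unfolding tree_weight_def tri_gram_def
    using zero by (intro det_gram_zero[OF _ i(1)]) (auto simp: pairing_def)
  then show False using tw by simp
qed

text \<open>The third side of a strip triangle is a diagonal. That two is even makes the core
  indicator a cocycle over F_2.\<close>

lemma core_subset_strip:
  "{e \<in> core. e \<subseteq> {p i, p (i + 1), p (i + 2)}} = {{p i, p (i + 1)}, {p (i + 1), p (i + 2)}}"
proof (intro equalityI subsetI)
  fix e assume "e \<in> {e \<in> core. e \<subseteq> {p i, p (i + 1), p (i + 2)}}"
  then obtain j where j: "e = {p j, p (j + 1)}" "{p j, p (j + 1)} \<subseteq> {p i, p (i + 1), p (i + 2)}"
    unfolding core_def by blast
  then have "j mod 5 = i mod 5 \<or> j mod 5 = (i + 1) mod 5" by (simp only: core_in_strip_iff)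
  then show "e \<in> {{p i, p (i + 1)}, {p (i + 1), p (i + 2)}}"
    using p_cong[of j i 0] p_cong[of j i 1] p_cong[of j "i + 1" 0] p_cong[of j "i + 1" 1] j(1)
    by (auto simp: add.assoc)
next
  fix e assume "e \<in> {{p i, p (i + 1)}, {p (i + 1), p (i + 2)}}"
  moreover have "{p i, p (i + 1)} \<in> core" unfolding core_def by blast
  moreover have "{p (i + 1), p (i + 2)} \<in> core" unfolding core_def by (rule range_eqI[of _ _ "i + 1"]) simp
  ultimately show "e \<in> {e \<in> core. e \<subseteq> {p i, p (i + 1), p (i + 2)}}" by auto
qed

lemma core_edges_distinct: "{p i, p (i + 1)} \<noteq> {p (i + 1), p (i + 2)}"
  using p_neq[of i] by (auto simp: doubleton_eq_iff)

definition core_cochain :: "nat set \<Rightarrow> bit" where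
  "core_cochain \<sigma> = (if \<sigma> \<in> core then 1 else 0)"

context
  fixes S assumes S: "S \<subseteq> triangles n" "S \<inter> others = {}" "card S = (n - 1) choose 2"
begin

abbreviation (input) "K \<equiv> full_skeleton n \<union> S"

lemma faces_K: "faces 2 K = S" "faces 1 K = {e. e \<subseteq> {1..n} \<and> card e = 2}" "faces 0 K = {e. e \<subseteq> {1..n} \<and> card e = 1}"
proof -
  have tri: "\<sigma> \<in> S \<Longrightarrow> \<sigma> \<subseteq> {1..n} \<and> card \<sigma> = 3" for \<sigma> using S(1) unfolding triangles_def by blast
  show "faces 2 K = S" using hypertrees_eq(2) S(1) n16 by simp
  show "faces 1 K = {e. e \<subseteq> {1..n} \<and> card e = 2}"
  proof (rule Set.set_eqI)
    fix \<sigma> show "\<sigma> \<in> faces 1 K \<longleftrightarrow> \<sigma> \<in> {e. e \<subseteq> {1..n} \<and> card e = 2}"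
      using tri[of \<sigma>] by (cases "\<sigma> \<in> S") (auto simp add: faces_def full_skeleton_def)
  qed
  show "faces 0 K = {e. e \<subseteq> {1..n} \<and> card e = 1}"
  proof (rule Set.set_eqI)
    fix \<sigma> show "\<sigma> \<in> faces 0 K \<longleftrightarrow> \<sigma> \<in> {e. e \<subseteq> {1..n} \<and> card e = 1}"
      using tri[of \<sigma>] by (cases "\<sigma> \<in> S") (auto simp add: faces_def full_skeleton_def)
  qed
qed

lemma core_edges: "core \<subseteq> {e. e \<subseteq> {1..n} \<and> card e = 2}"
proof
  fix e assume "e \<in> core"
  then have "e \<in> free_edges n" using core_free by blast
  then show "e \<in> {e. e \<subseteq> {1..n} \<and> card e = 2}" by (auto simp: free_edges_def)
qed

lemma core_cochain_cocycle: "core_cochain \<in> cocycles 1 K"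
proof -
  have "coboundary 1 K core_cochain \<tau> = 0" for \<tau>
  proof (cases "\<tau> \<in> S")
    case True
    let ?X = "{\<sigma>. \<sigma> \<in> faces 1 K \<and> \<sigma> \<subseteq> \<tau>}"
    have "?X \<subseteq> Pow {1..n}" unfolding faces_K by blast
    then have fX: "finite ?X" by (rule finite_subset) simp
    have "coboundary 1 K core_cochain \<tau> = (\<Sum>\<sigma>\<in>?X. core_cochain \<sigma>)"
      using True faces_K(1) by (simp add: coboundary_def numeral_2_eq_2)
    also have "\<dots> = (\<Sum>\<sigma>\<in>?X \<inter> core. 1)"
      unfolding core_cochain_def by (rule sum.inter_restrict[OF fX, symmetric])
    also have "?X \<inter> core = {e \<in> core. e \<subseteq> \<tau>}" using core_edges unfolding faces_K by blast
    also have "(\<Sum>\<sigma>\<in>{e \<in> core. e \<subseteq> \<tau>}. 1) = (0::bit)"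
    proof (cases "\<tau> \<in> strip")
      case True
      then obtain i where i: "\<tau> = {p i, p (i + 1), p (i + 2)}" unfolding strip_def by (rule rangeE)
      show ?thesis unfolding i core_subset_strip using core_edges_distinct[of i] by simp
    next
      case False
      then have *: "{e \<in> core. e \<subseteq> \<tau>} = {}" using True S(1,2) unfolding others_def by blast
      show ?thesis unfolding * by (rule sum.empty)
    qed
    finally show ?thesis .
  next
    case False
    then show ?thesis using faces_K(1) by (simp add: coboundary_def numeral_2_eq_2)
  qed
  moreover have "core_cochain \<in> cochains 1 K"
    using core_edges unfolding cochains_def faces_K core_cochain_def by auto
  ultimately show ?thesis unfolding cocycles_def by (simp add: fun_eq_iff)
qed

text \<open>The vertex values of a primitive h would have to flip at each of the five steps around
  the pentagon, impossible for odd length.\<close>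

lemma core_cochain_not_coboundary: "core_cochain \<notin> coboundaries 1 K"
proof
  assume "core_cochain \<in> coboundaries 1 K"
  then have "core_cochain \<in> coboundary 0 K ` cochains 0 K" by (simp add: coboundaries_def)
  then obtain h where h: "core_cochain = coboundary 0 K h" by (rule imageE)
  have "h {p i} + h {p (i + 1)} = 1" for i
  proof -
    have e: "{p i, p (i + 1)} \<in> core" unfolding core_def by blast
    then have "{p i, p (i + 1)} \<in> faces (0 + 1) K" using core_edges faces_K(2) by auto
    then have "coboundary 0 K h {p i, p (i + 1)} = (\<Sum>\<sigma> | \<sigma> \<in> faces 0 K \<and> \<sigma> \<subseteq> {p i, p (i + 1)}. h \<sigma>)"
      by (simp only: coboundary_def if_True)
    also have "{\<sigma>. \<sigma> \<in> faces 0 K \<and> \<sigma> \<subseteq> {p i, p (i + 1)}} = {{p i}, {p (i + 1)}}"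
    proof (intro equalityI subsetI)
      fix \<sigma> assume "\<sigma> \<in> {\<sigma>. \<sigma> \<in> faces 0 K \<and> \<sigma> \<subseteq> {p i, p (i + 1)}}"
      then have "card \<sigma> = 1" "\<sigma> \<subseteq> {p i, p (i + 1)}" unfolding faces_K by auto
      then obtain v where "\<sigma> = {v}" by (meson card_1_singletonE)
      then show "\<sigma> \<in> {{p i}, {p (i + 1)}}" using \<open>\<sigma> \<subseteq> {p i, p (i + 1)}\<close> by auto
    next
      fix \<sigma> assume "\<sigma> \<in> {{p i}, {p (i + 1)}}"
      then show "\<sigma> \<in> {\<sigma>. \<sigma> \<in> faces 0 K \<and> \<sigma> \<subseteq> {p i, p (i + 1)}}"
        using p_range[of i] p_range[of "i + 1"] unfolding faces_K by auto
    qed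
    also have "(\<Sum>\<sigma>\<in>{{p i}, {p (i + 1)}}. h \<sigma>) = h {p i} + h {p (i + 1)}" using p_neq(1)[of i] by simp
    finally have "coboundary 0 K h {p i, p (i + 1)} = h {p i} + h {p (i + 1)}" .
    moreover have "coboundary 0 K h {p i, p (i + 1)} = 1"
      unfolding h[symmetric] core_cochain_def using e by (rule if_P)
    ultimately show ?thesis by (simp only:)
  qed
  note hh = this
  define H where "H i = h {p i}" for i
  have HH: "H i + H (i + 1) = 1" for i unfolding H_def by (rule hh)
  have num: "0 + 1 = (1::nat)" "1 + 1 = (2::nat)" "2 + 1 = (3::nat)" "3 + 1 = (4::nat)" "4 + 1 = (5::nat)" by simp_all
  have "H 5 = H 0" using p_periodic(1)[of 0] by (simp add: H_def)
  then have "H 4 + H 0 = 1" using HH[of 4, unfolded num] by (simp only:)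
  with HH[of 0, unfolded num] HH[of 1, unfolded num] HH[of 2, unfolded num] HH[of 3, unfolded num]
  show False
    by (cases "H 0"; cases "H 1"; cases "H 2"; cases "H 3"; cases "H 4") simp_all
qed

text \<open>Each of the five core edges lies in at most two triangles of S and so has weight at most
  2 / (3 * m), where m = |S|.\<close>

lemma core_cochain_norm_le: "cochain_norm K core_cochain \<le> 10 / (3 * real ((n - 1) choose 2))"
proof -
  let ?m = "(n - 1) choose 2"
  have ne: "S \<noteq> {}" using S(3) n16 by (auto simp: binomial_eq_0_iff)
  have dim: "complex_dim K = 2" using hypertrees_eq(4) n16 S(1) ne by simp
  have w: "weight K e \<le> 2 / (3 * real ?m)" if e: "e \<in> core" for e
  proof -
    obtain i where i: "e = {p i, p (i + 1)}" using e unfolding core_def by (rule rangeE)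
    \<comment> \<open>Strip triangles on the i-th core edge start at i or at i - 1, the latter
      written i + 4.\<close>
    have "{\<tau> \<in> S. e \<subseteq> \<tau>} \<subseteq> {{p i, p (i + 1), p (i + 2)}, {p (i + 4), p (i + 4 + 1), p (i + 4 + 2)}}"
    proof
      fix \<tau> assume \<tau>: "\<tau> \<in> {\<tau> \<in> S. e \<subseteq> \<tau>}"
      then have "\<tau> \<in> strip" using e S(1,2) unfolding others_def by blast
      then obtain k where k: "\<tau> = {p k, p (k + 1), p (k + 2)}" unfolding strip_def by (rule rangeE)
      have "e \<subseteq> \<tau>" using \<tau> by blast
      then have "i mod 5 = k mod 5 \<or> i mod 5 = (k + 1) mod 5" unfolding k i core_in_strip_iff .
      then show "\<tau> \<in> {{p i, p (i + 1), p (i + 2)}, {p (i + 4), p (i + 4 + 1), p (i + 4 + 2)}}"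
      proof
        assume "i mod 5 = k mod 5"
        then have "\<tau> = {p i, p (i + 1), p (i + 2)}" unfolding k by (intro strip_cong) (rule sym)
        then show ?thesis by (rule ssubst) (rule insertI1)
      next
        assume "i mod 5 = (k + 1) mod 5"
        then have "k mod 5 = (i + 4) mod 5" using mod_add_cong[OF _ refl, of i 5 "k + 1" 4] by simp
        then have "\<tau> = {p (i + 4), p (i + 4 + 1), p (i + 4 + 2)}" unfolding k by (rule strip_cong)
        then show ?thesis by (rule ssubst) (intro insertI2 insertI1)
      qed
    qed
    then have "card {\<tau> \<in> S. e \<subseteq> \<tau>} \<le>
        card {{p i, p (i + 1), p (i + 2)}, {p (i + 4), p (i + 4 + 1), p (i + 4 + 2)}}"
      by (rule card_mono[rotated]) simp
    also have "\<dots> \<le> 2" by (simp add: card_insert_if)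
    finally have "card {\<tau> \<in> S. e \<subseteq> \<tau>} \<le> 2" .
    moreover have "card e = 2" using e core_edges by blast
    moreover have "(3::nat) choose 2 = 3" by (simp add: choose_two)
    ultimately show ?thesis
      by (simp add: weight_def dim faces_K(1) S(3) divide_right_mono)
  qed
  have "cochain_norm K core_cochain = (\<Sum>e\<in>core. weight K e)"
    unfolding cochain_norm_def by (intro sum.cong) (auto simp: core_cochain_def)
  also have "\<dots> \<le> real (card core) * (2 / (3 * real ?m))" using w by (rule sum_bounded_above)
  also have "\<dots> \<le> 5 * (2 / (3 * real ?m))"
  proof (rule mult_right_mono)
    have "card core \<le> 5" unfolding core_finite by (rule order_trans[OF card_image_le]) simp_all
    then show "real (card core) \<le> 5" by simp
  qed simp
  finally show ?thesis by simp
qed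

lemma syst_le:
  assumes n: "n \<ge> 63"
  shows "syst 1 K \<le> ereal (7 / real n ^ 2)"
proof -
  have "syst 1 K \<le> ereal (cochain_norm K core_cochain)"
    unfolding syst_def using core_cochain_cocycle core_cochain_not_coboundary by (intro INF_lower) blast
  also have "cochain_norm K core_cochain \<le> 7 / real n ^ 2"
  proof -
    have "real ((n - 1) choose 2) = (real n - 1) * (real n - 2) / 2"
      using n by (simp add: real_choose_two of_nat_diff)
    moreover have "10 / (3 * ((real n - 1) * (real n - 2) / 2)) \<le> 7 / real n ^ 2"
    proof -
      \<comment> \<open>The sides of the next inequality differ by n * (n - 63) + 42, whence the
        threshold 63.\<close>
      have "0 \<le> real n * (real n - 63)" using n by simp
      then have "20 * real n ^ 2 \<le> 21 * ((real n - 1) * (real n - 2))"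
        by (simp add: power2_eq_square algebra_simps)
      moreover have "(real n - 1) * (real n - 2) > 0" using n by simp
      ultimately show ?thesis using n by (simp add: field_simps)
    qed
    ultimately have "10 / (3 * real ((n - 1) choose 2)) \<le> 7 / real n ^ 2" by (simp only:)
    with core_cochain_norm_le show ?thesis by (rule order_trans)
  qed
  finally show ?thesis by simp
qed

end

end

section \<open>The second moment method\<close>

context pentagon
begin

lemma strip_inj: "{p i, p (i + 1), p (i + 2)} = {p j, p (j + 1), p (j + 2)} \<Longrightarrow> i mod 5 = j mod 5"
proof -
  assume eq: "{p i, p (i + 1), p (i + 2)} = {p j, p (j + 1), p (j + 2)}"
  have "{p i, p (i + 1)} \<subseteq> {p j, p (j + 1), p (j + 2)}" unfolding eq[symmetric] by blast
  then have 1: "i mod 5 = j mod 5 \<or> i mod 5 = (j + 1) mod 5" unfolding core_in_strip_iff .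
  have "{p (i + 1), p (i + 2)} \<subseteq> {p j, p (j + 1), p (j + 2)}" unfolding eq[symmetric] by blast
  then have "{p (i + 1), p (i + 1 + 1)} \<subseteq> {p j, p (j + 1), p (j + 2)}" by simp
  then have 2: "(i + 1) mod 5 = j mod 5 \<or> (i + 1) mod 5 = (j + 1) mod 5" unfolding core_in_strip_iff .
  show ?thesis using 1 2 unfolding mod5_shift[of i] mod5_shift[of j]
    using mod5_in[of i] mod5_in[of j] by (elim insertE emptyE) simp_all
qed

lemma inj_on_strip: "inj_on (\<lambda>i. {p i, p (i + 1), p (i + 2)}) {..<5}"
proof (rule inj_onI)
  fix i j :: nat assume "i \<in> {..<5}" "j \<in> {..<5}" "{p i, p (i + 1), p (i + 2)} = {p j, p (j + 1), p (j + 2)}"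
  then show "i = j" using strip_inj[of i j] by simp
qed

lemma card_strip: "card strip = 5"
  unfolding strip_finite by (subst card_image[OF inj_on_strip]) simp

end

section \<open>Pentagons with one vertex in each of five blocks\<close>

text \<open>The i-th vertex lies in the block numbered i mod 5, so block and offset can be read
  back. Distinct choices give distinct pentagons, and two pentagons share a vertex only at the same
  position. Vertices start at 1, hence the final + 1.\<close>

definition block_pentagon :: "nat \<Rightarrow> (nat \<Rightarrow> nat) \<Rightarrow> nat \<Rightarrow> nat" where
  "block_pentagon q x i = (i mod 5) * q + x (i mod 5) + 1"

definition block_size :: "nat \<Rightarrow> nat" where
  "block_size n = (n - 1) div 5"

lemma block_size_le: "5 * block_size n \<le> n - 1" "real (block_size n) \<le> real n / 5"
  unfolding block_size_def by linarith+

lemma block_size_ge: "n \<ge> 10 \<Longrightarrow> real n / 10 \<le> real (block_size n)"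
  unfolding block_size_def by linarith

abbreviation block_choices :: "nat \<Rightarrow> (nat \<Rightarrow> nat) set" where
  "block_choices n \<equiv> PiE {..<5} (\<lambda>_. {..<block_size n})"

lemma block_pentagon_div:
  assumes "x \<in> PiE {..<5} (\<lambda>_. {..<q})"
  shows "(block_pentagon q x i - 1) div q = i mod 5" "(block_pentagon q x i - 1) mod q = x (i mod 5)"
proof -
  have "x (i mod 5) < q" using PiE_mem[OF assms, of "i mod 5"] by simp
  then show "(block_pentagon q x i - 1) div q = i mod 5" "(block_pentagon q x i - 1) mod q = x (i mod 5)"
    by (simp_all add: block_pentagon_def)
qed

lemma pentagon_block:
  assumes n: "n \<ge> 16" and x: "x \<in> block_choices n"
  shows "pentagon n (block_pentagon (block_size n) x)"
proof
  let ?q = "block_size n"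
  show "n \<ge> 16" by fact
  show "block_pentagon ?q x i \<in> {1..<n}" for i
  proof -
    have "x (i mod 5) < ?q" using PiE_mem[OF x, of "i mod 5"] by simp
    moreover have "(i mod 5) * ?q \<le> 4 * ?q" by (intro mult_right_mono) auto
    moreover have "5 * ?q \<le> n - 1" by (rule block_size_le)
    ultimately show ?thesis using n unfolding block_pentagon_def atLeastLessThan_iff by linarith
  qed
  show "block_pentagon ?q x i = block_pentagon ?q x j \<longleftrightarrow> i mod 5 = j mod 5" for i j
  proof
    assume "block_pentagon ?q x i = block_pentagon ?q x j"
    then show "i mod 5 = j mod 5"
      using block_pentagon_div(1)[OF x, of i] block_pentagon_div(1)[OF x, of j] by (simp only:)
  qed (simp only: block_pentagon_def)
qed

abbreviation block_strip :: "nat \<Rightarrow> (nat \<Rightarrow> nat) \<Rightarrow> nat set set" where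
  "block_strip n x \<equiv> pentagon.strip (block_pentagon (block_size n) x)"

abbreviation block_others :: "nat \<Rightarrow> (nat \<Rightarrow> nat) \<Rightarrow> nat set set" where
  "block_others n x \<equiv> pentagon.others n (block_pentagon (block_size n) x)"

text \<open>If x and y differ at i, the i-th vertex of the second pentagon is no vertex of the
  first, so the strip triangle starting there is new.\<close>

lemma card_strip_union_ge:
  assumes n: "n \<ge> 16" and x: "x \<in> block_choices n" and y: "y \<in> block_choices n"
  shows "5 + card {i \<in> {..<5}. x i \<noteq> y i} \<le> card (block_strip n x \<union> block_strip n y)"
proof -
  let ?q = "block_size n"
  let ?D = "{i \<in> {..<5}. x i \<noteq> y i}"
  let ?px = "block_pentagon ?q x" and ?py = "block_pentagon ?q y"
  interpret X: pentagon n ?px by (rule pentagon_block[OF n x])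
  interpret Y: pentagon n ?py by (rule pentagon_block[OF n y])
  let ?A = "(\<lambda>i. {?py i, ?py (i + 1), ?py (i + 2)}) ` ?D"
  have "{?py i, ?py (i + 1), ?py (i + 2)} \<notin> X.strip" if i: "i \<in> ?D" for i
  proof
    assume "{?py i, ?py (i + 1), ?py (i + 2)} \<in> X.strip"
    then obtain j where "{?py i, ?py (i + 1), ?py (i + 2)} = {?px j, ?px (j + 1), ?px (j + 2)}"
      unfolding X.strip_def by (rule rangeE)
    then have "?py i \<in> {?px j, ?px (j + 1), ?px (j + 2)}" by blast
    then obtain k where k: "?py i = ?px k" by blast
    have "i mod 5 = k mod 5" "y (i mod 5) = x (k mod 5)"
      using block_pentagon_div[OF x, of k] block_pentagon_div[OF y, of i] unfolding k by simp_all
    then show False using i by simp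
  qed
  then have disj: "X.strip \<inter> ?A = {}" by blast
  have sub: "?A \<subseteq> Y.strip" unfolding Y.strip_def by blast
  have cA: "card ?A = card ?D" by (rule card_image) (rule inj_on_subset[OF Y.inj_on_strip], blast)
  have fin: "finite X.strip" "finite Y.strip" by (simp_all add: X.strip_finite Y.strip_finite)
  have "card (X.strip \<union> ?A) = card X.strip + card ?A"
    using disj fin by (intro card_Un_disjoint) auto
  then have "5 + card ?D = card (X.strip \<union> ?A)" by (simp only: X.card_strip cA)
  also have "\<dots> \<le> card (X.strip \<union> Y.strip)" using sub fin by (intro card_mono) auto
  finally show ?thesis .
qed

text \<open>The sum factors over the five coordinates: with r = 19 / n, the entry equal to that of x
  contributes r, every other entry r^2.\<close>

lemma sum_over_choices_le:
  assumes n: "n \<ge> 19" and x: "x \<in> block_choices n"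
  shows "(\<Sum>y\<in>block_choices n. (19 / real n) ^ (5 + card {i \<in> {..<5}. x i \<noteq> y i})) \<le> (95 / real n) ^ 5"
proof -
  let ?q = "block_size n"
  define r where "r = 19 / real n"
  have r: "r \<ge> 0" by (simp add: r_def)
  let ?h = "\<lambda>a b. r * (if a \<noteq> b then r else 1)"
  have "r ^ (5 + card {i \<in> {..<5}. x i \<noteq> y i}) = (\<Prod>i\<in>{..<5}. ?h (x i) (y i))" for y
  proof -
    have "(\<Prod>i\<in>{..<5}. ?h (x i) (y i)) = r ^ 5 * (\<Prod>i\<in>{..<5::nat}. if x i \<noteq> y i then r else 1)"
      by (simp add: prod.distrib)
    also have "(\<Prod>i\<in>{..<5::nat}. if x i \<noteq> y i then r else 1) = (\<Prod>i\<in>{i \<in> {..<5}. x i \<noteq> y i}. r)"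
      by (rule prod.inter_filter[symmetric]) simp
    finally show ?thesis by (simp add: power_add)
  qed
  then have "(\<Sum>y\<in>block_choices n. r ^ (5 + card {i \<in> {..<5}. x i \<noteq> y i}))
      = (\<Sum>y\<in>block_choices n. \<Prod>i\<in>{..<5}. ?h (x i) (y i))" by simp
  also have "\<dots> = (\<Prod>i\<in>{..<5}. \<Sum>b\<in>{..<?q}. ?h (x i) b)"
    by (rule prod_sum_PiE[symmetric]) auto
  also have "\<dots> \<le> (\<Prod>i\<in>{..<5::nat}. 95 / real n)"
  proof (rule prod_mono)
    fix i :: nat assume i: "i \<in> {..<5}"
    have "(\<Sum>b\<in>{..<?q}. ?h (x i) b) \<le> (\<Sum>b\<in>{..<?q}. r * r + (if b = x i then r else 0))"
      using r by (intro sum_mono) auto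
    also have "\<dots> \<le> r * (real ?q * r) + r"
      using r by (simp add: sum.distrib)
    \<comment> \<open>q \<le> n / 5 gives q * r \<le> 19 / 5 < 4, and 5 * 19 = 95.\<close>
    also have "\<dots> \<le> r * 4 + r"
    proof -
      have "real ?q \<le> real n / 5" by (rule block_size_le)
      then have "real ?q * r \<le> real n / 5 * r" using r by (rule mult_right_mono)
      then have "real ?q * r \<le> 4" using n by (simp add: r_def)
      then show ?thesis using r by (intro add_right_mono mult_left_mono)
    qed
    also have "\<dots> = 95 / real n" by (simp add: r_def)
    finally show "0 \<le> (\<Sum>b\<in>{..<?q}. ?h (x i) b) \<and> (\<Sum>b\<in>{..<?q}. ?h (x i) b) \<le> 95 / real n"
      using r by (auto intro!: sum_nonneg)
  qed
  finally show ?thesis by (simp add: r_def)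
qed

text \<open>The bound (E X)^2 / E X^2 for the number X of good pentagons, with E X \<ge> exp (-3000)
  / 10^5 and E X^2 \<le> 19^5.\<close>

definition success_bound :: real where
  "success_bound = (exp (- 3000) / 10 ^ 5) ^ 2 / 19 ^ 5"

lemma success_bound_pos: "success_bound > 0"
  by (simp add: success_bound_def)

text \<open>The tree weights act as unnormalised probabilities, and X counts the block pentagons
  whose forbidden triangles S avoids.\<close>

lemma tree_weight_success_ge:
  assumes n: "n \<ge> 19"
  shows "success_bound * total_weight n \<le>
    (\<Sum>S | S \<subseteq> triangles n \<and> card S = (n - 1) choose 2 \<and>
       (\<exists>x\<in>block_choices n. S \<inter> block_others n x = {}). tree_weight n S)"
proof -
  let ?q = "block_size n"
  let ?F = "block_choices n"
  let ?SS = "{S. S \<subseteq> triangles n \<and> card S = (n - 1) choose 2}"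
  let ?Z = "total_weight n"
  let ?av = "\<lambda>S x. if S \<inter> block_others n x = {} then 1 else 0 :: real"
  define X where "X S = (\<Sum>x\<in>?F. ?av S x)" for S
  define \<alpha> where "\<alpha> = exp (- 3000) / 10 ^ 5 * ?Z"
  have n16: "n \<ge> 16" using n by simp
  have fF: "finite ?F" by (intro finite_PiE) auto
  have cF: "card ?F = ?q ^ 5" by (simp add: card_PiE)
  have Z0: "?Z \<ge> 0" unfolding total_weight_eq by (intro sum_nonneg) (use tree_weight_nonneg in auto)
  have nz: "real n > 0" using n by simp
  \<comment> \<open>There are q^5 \<ge> (n / 10)^5 choices, each with share at least exp (-3000) /
    n^5 of the total weight.\<close>
  have first: "exp (- 3000) / 10 ^ 5 * ?Z \<le> (\<Sum>S\<in>?SS. tree_weight n S * X S)"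
  proof -
    have "real n / 10 \<le> real ?q" using n by (intro block_size_ge) simp
    then have "(real n / 10) ^ 5 \<le> real ?q ^ 5" by (intro power_mono) auto
    then have "(real n / 10) ^ 5 * (exp (- 3000) / n ^ 5 * ?Z) \<le> real ?q ^ 5 * (exp (- 3000) / n ^ 5 * ?Z)"
      using Z0 by (intro mult_right_mono) auto
    moreover have "(real n / 10) ^ 5 * (exp (- 3000) / n ^ 5 * ?Z) = exp (- 3000) / 10 ^ 5 * ?Z"
      using nz by (simp add: power_divide)
    moreover have "real ?q ^ 5 * (exp (- 3000) / n ^ 5 * ?Z) = (\<Sum>x\<in>?F. exp (- 3000) / n ^ 5 * ?Z)"
      by (simp only: sum_constant cF of_nat_power)
    moreover have "\<dots> \<le> (\<Sum>x\<in>?F. \<Sum>S\<in>?SS. tree_weight n S * ?av S x)"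
    proof (rule sum_mono)
      fix x assume x: "x \<in> ?F"
      interpret X: pentagon n "block_pentagon ?q x" by (rule pentagon_block[OF n16 x])
      have "(\<Sum>S\<in>?SS. tree_weight n S * ?av S x) = (\<Sum>S\<in>?SS. if S \<inter> X.others = {} then tree_weight n S else 0)"
        by (intro sum.cong) auto
      also have "\<dots> = (\<Sum>S\<in>{S \<in> ?SS. S \<inter> X.others = {}}. tree_weight n S)"
        by (rule sum.inter_filter[symmetric]) simp
      also have "{S \<in> ?SS. S \<inter> X.others = {}} = {S. S \<subseteq> triangles n \<and> card S = (n - 1) choose 2 \<and> S \<inter> X.others = {}}"
        by blast
      finally show "exp (- 3000) / n ^ 5 * ?Z \<le> (\<Sum>S\<in>?SS. tree_weight n S * ?av S x)"
        using X.tree_weight_avoiding_ge by simp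
    qed
    moreover have "\<dots> = (\<Sum>S\<in>?SS. tree_weight n S * X S)"
      unfolding X_def sum_distrib_left by (rule sum.swap)
    ultimately show ?thesis by linarith
  qed
  have second: "(\<Sum>S\<in>?SS. tree_weight n S * (X S)\<^sup>2) \<le> 19 ^ 5 * ?Z"
  proof -
    have sq: "(X S)\<^sup>2 = (\<Sum>x\<in>?F. \<Sum>y\<in>?F. ?av S x * ?av S y)" for S
      unfolding X_def power2_eq_square sum_product ..
    have "(\<Sum>S\<in>?SS. tree_weight n S * (X S)\<^sup>2) = (\<Sum>S\<in>?SS. \<Sum>x\<in>?F. \<Sum>y\<in>?F. tree_weight n S * (?av S x * ?av S y))"
      unfolding sq sum_distrib_left ..
    also have "\<dots> = (\<Sum>x\<in>?F. \<Sum>S\<in>?SS. \<Sum>y\<in>?F. tree_weight n S * (?av S x * ?av S y))"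
      by (rule sum.swap)
    also have "\<dots> = (\<Sum>x\<in>?F. \<Sum>y\<in>?F. \<Sum>S\<in>?SS. tree_weight n S * (?av S x * ?av S y))"
      by (intro sum.cong refl sum.swap)
    also have "\<dots> \<le> (\<Sum>x\<in>?F. \<Sum>y\<in>?F. (19 / real n) ^ (5 + card {i \<in> {..<5}. x i \<noteq> y i}) * ?Z)"
    proof (intro sum_mono)
      fix x y assume x: "x \<in> ?F" and y: "y \<in> ?F"
      interpret X: pentagon n "block_pentagon ?q x" by (rule pentagon_block[OF n16 x])
      interpret Y: pentagon n "block_pentagon ?q y" by (rule pentagon_block[OF n16 y])
      let ?A = "X.strip \<union> Y.strip"
      have "(\<Sum>S\<in>?SS. tree_weight n S * (?av S x * ?av S y)) \<le> (\<Sum>S\<in>?SS. if ?A \<subseteq> S then tree_weight n S else 0)"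
      proof (rule sum_mono)
        fix S assume S: "S \<in> ?SS"
        have t: "tree_weight n S \<ge> 0" using S tree_weight_nonneg by blast
        show "tree_weight n S * (?av S x * ?av S y) \<le> (if ?A \<subseteq> S then tree_weight n S else 0)"
        proof (cases "tree_weight n S \<noteq> 0 \<and> S \<inter> X.others = {} \<and> S \<inter> Y.others = {}")
          case True
          \<comment> \<open>Nonzero weight forces both strips into S; avoiding two families of
            triangles is thus bounded by containing the union of two strips.\<close>
          then have "?A \<subseteq> S" using X.strip_subset[of S] Y.strip_subset[of S] S by blast
          then show ?thesis using True by simp
        next
          case False
          then have *: "tree_weight n S * (?av S x * ?av S y) = 0" by auto
          show ?thesis unfolding * using t by simp
        qed
      qed
      also have "\<dots> = (\<Sum>S\<in>{S \<in> ?SS. ?A \<subseteq> S}. tree_weight n S)"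
        by (rule sum.inter_filter[symmetric]) simp
      also have "{S \<in> ?SS. ?A \<subseteq> S} = {S. S \<subseteq> triangles n \<and> card S = (n - 1) choose 2 \<and> ?A \<subseteq> S}" by blast
      also have "(\<Sum>S\<in>\<dots>. tree_weight n S) \<le> (19 / n) ^ card ?A * ?Z"
        using n X.strip_triangles Y.strip_triangles by (intro tree_weight_superset_le) auto
      also have "\<dots> \<le> (19 / real n) ^ (5 + card {i \<in> {..<5}. x i \<noteq> y i}) * ?Z"
        using n card_strip_union_ge[OF n16 x y] Z0 by (intro mult_right_mono power_decreasing) auto
      finally show "(\<Sum>S\<in>?SS. tree_weight n S * (?av S x * ?av S y)) \<le>
          (19 / real n) ^ (5 + card {i \<in> {..<5}. x i \<noteq> y i}) * ?Z" .
    qed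
    also have "\<dots> = (\<Sum>x\<in>?F. (\<Sum>y\<in>?F. (19 / real n) ^ (5 + card {i \<in> {..<5}. x i \<noteq> y i})) * ?Z)"
      by (simp only: sum_distrib_right)
    also have "\<dots> \<le> (\<Sum>x\<in>?F. (95 / real n) ^ 5 * ?Z)"
      using sum_over_choices_le[OF n] Z0 by (intro sum_mono mult_right_mono) auto
    also have "\<dots> = (real ?q * (95 / real n)) ^ 5 * ?Z"
      by (simp only: sum_constant cF of_nat_power power_mult_distrib mult.assoc)
    also have "\<dots> \<le> 19 ^ 5 * ?Z"
    proof (intro mult_right_mono power_mono)
      have "real ?q \<le> real n / 5" by (rule block_size_le)
      then have "real ?q * (95 / real n) \<le> real n / 5 * (95 / real n)" by (intro mult_right_mono) auto
      then show "real ?q * (95 / real n) \<le> 19" using nz by simp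
    qed (use Z0 in auto)
    finally show ?thesis .
  qed
  \<comment> \<open>In place of Cauchy-Schwarz: 2 l X - l^2 X^2 is at most 1 and vanishes for X = 0,
    so it lies below the indicator of X > 0. This l maximises the resulting bound 2 l a - l^2 b,
    where a and b are the bounds for the two moments.\<close>
  define l where "l = exp (- 3000) / 10 ^ 5 / (19 ^ 5 :: real)"
  have l0: "l \<ge> 0" by (simp add: l_def)
  have "(\<Sum>S\<in>?SS. tree_weight n S * (2 * l * X S - l\<^sup>2 * (X S)\<^sup>2)) \<le>
      (\<Sum>S\<in>?SS. if (\<exists>x\<in>?F. S \<inter> block_others n x = {}) then tree_weight n S else 0)"
  proof (rule sum_mono)
    fix S assume S: "S \<in> ?SS"
    have t: "tree_weight n S \<ge> 0" using S tree_weight_nonneg by blast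
    show "tree_weight n S * (2 * l * X S - l\<^sup>2 * (X S)\<^sup>2) \<le>
        (if (\<exists>x\<in>?F. S \<inter> block_others n x = {}) then tree_weight n S else 0)"
    proof (cases "\<exists>x\<in>?F. S \<inter> block_others n x = {}")
      case True
      have "0 \<le> (1 - l * X S)\<^sup>2" by simp
      then have "2 * l * X S - l\<^sup>2 * (X S)\<^sup>2 \<le> 1" by (simp add: power2_eq_square algebra_simps)
      then have "tree_weight n S * (2 * l * X S - l\<^sup>2 * (X S)\<^sup>2) \<le> tree_weight n S * 1"
        using t by (rule mult_left_mono)
      then show ?thesis unfolding if_P[OF True] by simp
    next
      case False
      then have "X S = 0" unfolding X_def by (intro sum.neutral) auto
      then show ?thesis unfolding if_not_P[OF False] by simp
    qed
  qed
  also have "\<dots> = (\<Sum>S\<in>{S \<in> ?SS. \<exists>x\<in>?F. S \<inter> block_others n x = {}}. tree_weight n S)"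
    by (rule sum.inter_filter[symmetric]) simp
  also have "{S \<in> ?SS. \<exists>x\<in>?F. S \<inter> block_others n x = {}} = {S. S \<subseteq> triangles n \<and> card S = (n - 1) choose 2 \<and>
       (\<exists>x\<in>?F. S \<inter> block_others n x = {})}" by blast
  finally have low: "(\<Sum>S\<in>?SS. tree_weight n S * (2 * l * X S - l\<^sup>2 * (X S)\<^sup>2)) \<le>
    (\<Sum>S | S \<subseteq> triangles n \<and> card S = (n - 1) choose 2 \<and> (\<exists>x\<in>?F. S \<inter> block_others n x = {}). tree_weight n S)" .
  have "(\<Sum>S\<in>?SS. tree_weight n S * (2 * l * X S - l\<^sup>2 * (X S)\<^sup>2)) =
      2 * l * (\<Sum>S\<in>?SS. tree_weight n S * X S) - l\<^sup>2 * (\<Sum>S\<in>?SS. tree_weight n S * (X S)\<^sup>2)"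
    unfolding right_diff_distrib sum_subtractf sum_distrib_left by (simp add: mult_ac)
  moreover have "2 * l * (exp (- 3000) / 10 ^ 5 * ?Z) \<le> 2 * l * (\<Sum>S\<in>?SS. tree_weight n S * X S)"
    using first l0 by (intro mult_left_mono) auto
  moreover have "l\<^sup>2 * (\<Sum>S\<in>?SS. tree_weight n S * (X S)\<^sup>2) \<le> l\<^sup>2 * (19 ^ 5 * ?Z)"
    using second by (intro mult_left_mono) auto
  moreover have "2 * l * (exp (- 3000) / 10 ^ 5 * ?Z) - l\<^sup>2 * (19 ^ 5 * ?Z) = success_bound * ?Z"
  proof -
    define a where "a = exp (- 3000 :: real) / 10 ^ 5"
    define b where "b = (19 ^ 5 :: real)"
    have "b \<noteq> 0" by (simp add: b_def)
    then have "2 * (a / b) * (a * ?Z) - (a / b)\<^sup>2 * (b * ?Z) = a\<^sup>2 / b * ?Z"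
      by (simp add: power2_eq_square field_simps)
    then show ?thesis by (simp only: a_def b_def l_def success_bound_def)
  qed
  ultimately show ?thesis using low by linarith
qed

section \<open>From tree weights to probabilities\<close>

text \<open>The law is the tree weight divided by a power of n. Taking P always true shows that this
  power is the total weight, since probabilities add up to 1; Kalai's value is thus read off from
  the law rather than computed.\<close>

lemma determinantal_hypertree_prob:
  assumes n: "n \<ge> 3" and dh: "determinantal_hypertree n M T"
  shows "total_weight n > 0"
    and "measure M {\<omega> \<in> space M. P (T \<omega>)} =
      (\<Sum>S | S \<subseteq> triangles n \<and> card S = (n - 1) choose 2 \<and> P (full_skeleton n \<union> S). tree_weight n S) / total_weight n"
proof -
  let ?H = "{S. S \<subseteq> triangles n \<and> card S = (n - 1) choose 2 \<and> tree_weight n S \<noteq> 0}"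
  let ?K = "\<lambda>S. full_skeleton n \<union> S"
  let ?N = "real n ^ ((n - 2) choose 2)"
  interpret prob_space M using dh by (simp add: determinantal_hypertree_def)
  have H: "hypertrees n = ?K ` ?H" by (rule hypertrees_eq(1)[OF n])
  have T: "T \<in> measurable M (count_space (hypertrees n))" using dh by (simp add: determinantal_hypertree_def)
  have law: "measure M {\<omega> \<in> space M. T \<omega> = K} = (real (order (simplicial_homology 1 K)))\<^sup>2 / ?N"
    if "K \<in> hypertrees n" for K
    using dh that unfolding determinantal_hypertree_def by blast
  have inj: "inj_on ?K ?H" using hypertrees_eq(2)[OF n] by (intro inj_on_inverseI[of _ "faces 2"]) auto
  have key: "measure M {\<omega> \<in> space M. P (T \<omega>)} =
      (\<Sum>S | S \<subseteq> triangles n \<and> card S = (n - 1) choose 2 \<and> P (?K S). tree_weight n S) / ?N" for P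
  proof -
    let ?HP = "{S \<in> ?H. P (?K S)}"
    let ?A = "\<lambda>S. {\<omega> \<in> space M. T \<omega> = ?K S}"
    have union: "{\<omega> \<in> space M. P (T \<omega>)} = (\<Union>S\<in>?HP. ?A S)"
    proof (intro equalityI subsetI)
      fix \<omega> assume \<omega>: "\<omega> \<in> {\<omega> \<in> space M. P (T \<omega>)}"
      then have "T \<omega> \<in> hypertrees n" using measurable_space[OF T, of \<omega>] by simp
      then obtain S where S: "T \<omega> = ?K S" "S \<in> ?H" unfolding H by (rule imageE)
      show "\<omega> \<in> (\<Union>S\<in>?HP. ?A S)" by (rule UN_I[of S]) (use \<omega> S in simp_all)
    next
      fix \<omega> assume "\<omega> \<in> (\<Union>S\<in>?HP. ?A S)"
      then obtain S where "S \<in> ?HP" "\<omega> \<in> ?A S" by (rule UN_E)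
      then show "\<omega> \<in> {\<omega> \<in> space M. P (T \<omega>)}" by simp
    qed
    have "measure M {\<omega> \<in> space M. P (T \<omega>)} = (\<Sum>S\<in>?HP. measure M (?A S))"
      unfolding union
    proof (rule finite_measure_finite_Union)
      show "finite ?HP" by (rule finite_subset[of _ "Pow (triangles n)"]) auto
      show "?A ` ?HP \<subseteq> sets M"
      proof
        fix B assume "B \<in> ?A ` ?HP"
        then obtain S where S: "S \<in> ?H" "B = ?A S" by blast
        have "T -` {?K S} \<inter> space M \<in> sets M"
          using T by (rule measurable_sets) (use S(1) H in auto)
        moreover have "B = T -` {?K S} \<inter> space M" using S(2) by auto
        ultimately show "B \<in> sets M" by simp
      qed
      show "disjoint_family_on ?A ?HP"
        unfolding disjoint_family_on_def
      proof (intro ballI impI equals0I)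
        fix S S' \<omega> assume S: "S \<in> ?HP" "S' \<in> ?HP" "S \<noteq> S'" and \<omega>: "\<omega> \<in> ?A S \<inter> ?A S'"
        have a: "T \<omega> = ?K S" using IntD1[OF \<omega>] by simp
        have b: "T \<omega> = ?K S'" using IntD2[OF \<omega>] by simp
        have "?K S = ?K S'" by (rule trans[OF sym[OF a] b])
        then have "S = S'" by (rule inj_onD[OF inj]) (use S in simp_all)
        then show False using S(3) by simp
      qed
    qed
    also have "\<dots> = (\<Sum>S\<in>?HP. tree_weight n S / ?N)"
    proof (rule sum.cong)
      fix S assume S: "S \<in> ?HP"
      then have SH: "S \<in> ?H" by simp
      have "measure M (?A S) = (real (order (simplicial_homology 1 (?K S))))\<^sup>2 / ?N"
        by (rule law) (unfold H, rule imageI[OF SH])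
      moreover have "(real (order (simplicial_homology 1 (?K S))))\<^sup>2 = tree_weight n S"
        by (rule hypertrees_eq(3)[OF n]) (use SH in simp_all)
      ultimately show "measure M (?A S) = tree_weight n S / ?N" by (simp only:)
    qed simp
    also have "\<dots> = (\<Sum>S\<in>?HP. tree_weight n S) / ?N" by (rule sum_divide_distrib[symmetric])
    finally have *: "measure M {\<omega> \<in> space M. P (T \<omega>)} = (\<Sum>S\<in>?HP. tree_weight n S) / ?N" .
    \<comment> \<open>Sets of weight 0 are no hypertrees and contribute nothing.\<close>
    have "(\<Sum>S\<in>?HP. tree_weight n S) =
        (\<Sum>S | S \<subseteq> triangles n \<and> card S = (n - 1) choose 2 \<and> P (?K S). tree_weight n S)"
      by (rule sum.mono_neutral_left) auto
    with * show ?thesis by (simp only:)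
  qed
  have "1 = total_weight n / ?N"
    using key[of "\<lambda>_. True"] by (simp only: simp_thms Collect_mem_eq prob_space total_weight_eq)
  moreover have N0: "?N > 0" using n by simp
  ultimately have N: "total_weight n = ?N" by (metis eq_divide_eq_1 less_irrefl)
  have "?N > 0" by (rule N0)
  then show "total_weight n > 0" by (simp only: N)
  show "measure M {\<omega> \<in> space M. P (T \<omega>)} =
      (\<Sum>S | S \<subseteq> triangles n \<and> card S = (n - 1) choose 2 \<and> P (?K S). tree_weight n S) / total_weight n"
    unfolding N by (rule key)
qed

(* There are no 2-dimensional complexes on fewer than three vertices. *)
theorem theorem5:
  fixes M :: "nat \<Rightarrow> 'w measure"
    and T :: "nat \<Rightarrow> 'w \<Rightarrow> nat set set"
  assumes "\<And>n. n \<ge> 3 \<Longrightarrow> determinantal_hypertree n (M n) (T n)"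
  shows "liminf (\<lambda>n. ereal (measure (M n)
           {\<omega> \<in> space (M n). syst 1 (T n \<omega>) \<le> ereal (7 / real n ^ 2)})) > 0"
proof -
  have "success_bound \<le> measure (M n) {\<omega> \<in> space (M n). syst 1 (T n \<omega>) \<le> ereal (7 / real n ^ 2)}"
    if n: "n \<ge> 63" for n
  proof -
    have n3: "n \<ge> 3" "n \<ge> 16" "n \<ge> 19" using n by auto
    let ?P = "\<lambda>K. syst 1 K \<le> ereal (7 / real n ^ 2)"
    have Z: "total_weight n > 0" by (rule determinantal_hypertree_prob(1)[OF n3(1) assms[OF n3(1)]])
    have "success_bound * total_weight n \<le>
      (\<Sum>S | S \<subseteq> triangles n \<and> card S = (n - 1) choose 2 \<and>
         (\<exists>x\<in>block_choices n. S \<inter> block_others n x = {}). tree_weight n S)"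
      by (rule tree_weight_success_ge[OF n3(3)])
    also have "\<dots> \<le> (\<Sum>S | S \<subseteq> triangles n \<and> card S = (n - 1) choose 2 \<and> ?P (full_skeleton n \<union> S). tree_weight n S)"
    proof (rule sum_mono2)
      show "{S. S \<subseteq> triangles n \<and> card S = (n - 1) choose 2 \<and> (\<exists>x\<in>block_choices n. S \<inter> block_others n x = {})}
        \<subseteq> {S. S \<subseteq> triangles n \<and> card S = (n - 1) choose 2 \<and> ?P (full_skeleton n \<union> S)}"
      proof
        fix S assume "S \<in> {S. S \<subseteq> triangles n \<and> card S = (n - 1) choose 2 \<and> (\<exists>x\<in>block_choices n. S \<inter> block_others n x = {})}"
        then obtain x where x: "x \<in> block_choices n" and S: "S \<subseteq> triangles n" "S \<inter> block_others n x = {}"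
          "card S = (n - 1) choose 2" by blast
        have "?P (full_skeleton n \<union> S)"
          by (rule pentagon.syst_le[OF pentagon_block[OF n3(2) x] S n])
        then show "S \<in> {S. S \<subseteq> triangles n \<and> card S = (n - 1) choose 2 \<and> ?P (full_skeleton n \<union> S)}"
          using S by blast
      qed
    qed (use tree_weight_nonneg in auto)
    finally show ?thesis
      unfolding determinantal_hypertree_prob(2)[OF n3(1) assms[OF n3(1)], of ?P]
      using Z by (simp only: pos_le_divide_eq)
  qed
  then have "\<forall>\<^sub>F n in sequentially. ereal success_bound \<le> ereal (measure (M n)
           {\<omega> \<in> space (M n). syst 1 (T n \<omega>) \<le> ereal (7 / real n ^ 2)})"
    by (intro eventually_sequentiallyI[of 63]) simp
  then have "ereal success_bound \<le> liminf (\<lambda>n. ereal (measure (M n)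
           {\<omega> \<in> space (M n). syst 1 (T n \<omega>) \<le> ereal (7 / real n ^ 2)}))"
    by (rule Liminf_bounded)
  moreover have "0 < ereal success_bound" using success_bound_pos by simp
  ultimately show ?thesis by (rule less_le_trans[rotated])
qed

end
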